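(* The two 2-functors $\mathrm{Y}\colon\mathbf{WCmd}\to\mathbf{CompCat}$ and $\mathrm{X}\colon\mathbf{CompCat}\to\mathbf{WCmd}$ give rise to an adjoint biequivalence such that $\mathrm{Y}\circ\mathrm{X}=\mathrm{Id}$. Moreover, the biequivalence restricts to the wide 2-full sub-2-categories $\mathbf{WCmd}_{\mathbf{ps}}$ and $\mathbf{CompCat}_{\mathbf{ps}}$ on the pseudo morphisms.
   Context: "Wide" means with the same 0-cells; "2-full" means with all 2-cells between the retained 1-cells. An adjoint biequivalence consists of 2-functors in both directions, together with a pseudo-natural unit and counit whose components are equivalences and which satisfy the triangle identities (up to invertible modification). **Fibrations.** "Fibration" means Grothendieck fibration. Standing assumption: the underlying fibrations of comprehension categories and of w-comonads are cloven (equipped with a cleavage), but morphisms are not required to preserve cleavages. The 2-category $\mathbf{Fib}$: 0-cells are fibrations $p\colon\mathcal E\to\mathcal B$; a 1-cell $p\to p'$ is a pair of functors $(B\colon\mathcal B\to\mathcal B',\,E\colon\mathcal E\to\mathcal E')$ with $p'E=Bp$ and $E$ preserving cartesian arrows; a 2-cell $(B_1,E_1)\Rightarrow(B_2,E_2)$ is a pair of natural transformations $(\psi\colon B_1\Rightarrow B_2,\ \phi\colon E_1\Rightarrow E_2)$ with $p'\phi=\psi p$. **Comprehension categories.** $\mathcal B^2$ is the arrow category. A comprehension category $(p,\chi)$ is a fibration $p\colon\mathcal E\to\mathcal B$ with a functor $\chi\colon\mathcal E\to\mathcal B^2$ such that $\mathrm{cod}\circ\chi=p$ and $\chi$ maps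 $p$-cartesian arrows to pullback squares. Write $\chi_E\colon X_E\to pE$ for the arrow $\chi(E)$. A lax morphism $(p,\chi)\to(p',\chi')$ is a triple $(B,H,\zeta)$ with $(B,H)\colon p\to p'$ a 1-cell in $\mathbf{Fib}$ and $\zeta\colon B^2\chi\Rightarrow\chi'H$ a natural transformation with $\mathrm{cod}\,\zeta=\mathrm{id}_{Bp}$ (so $\zeta_E$ amounts to an arrow $BX_E\to X'_{HE}$ over $BpE=p'HE$); it is pseudo if $\zeta$ is invertible. Composition: $(B_2B_1,H_2H_1,(\zeta_2H_1)(B_2^2\zeta_1))$. $\mathbf{CompCat}$ has these as 0- and 1-cells; a 2-cell $(B_1,H_1,\zeta_1)\Rightarrow(B_2,H_2,\zeta_2)$ is a 2-cell $(\psi,\phi)\colon(B_1,H_1)\Rightarrow(B_2,H_2)$ in $\mathbf{Fib}$ with $\chi'\phi\circ\zeta_1=\zeta_2\circ\psi^2\chi$. **W-comonads.** A weakening and contraction comonad (w-comonad) on a fibration $p\colon\mathcal E\to\mathcal B$ is a comonad $(K,\epsilon,\nu)$ on $\mathcal E$ such that every component of the counit $\epsilon$ is $p$-cartesian and, for every cartesian $f\colon A\to B$ in $\mathcal E$, the image under $p$ of the naturality square of $\epsilon$ at $f$ is a pullback in $\mathcal B$. (The comultiplication of a w-comonad is uniquely determined by its counit.) A lax morphism of comonads $(K,\epsilon,\nu)\to(K',\epsilon',\nu')$ is a pair $(H,\theta\colon HK\Rightarrow K'H)$ with $\epsilon'H\circ\theta=H\epsilon$ and $\nu'H\circ\theta=K'\theta\circ\theta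 K\circ H\nu$. $\mathbf{WCmd}$: 0-cells are pairs $(p,K)$ of a fibration and a w-comonad on it; a 1-cell $(p,K)\to(p',K')$ is a triple $(C,H,\theta)$ with $(C,H)\colon p\to p'$ a 1-cell in $\mathbf{Fib}$ and $(H,\theta)$ a lax morphism of comonads, pseudo if $\theta$ is invertible; composition $(C_2C_1,H_2H_1,(\theta_2H_1)(H_2\theta_1))$; a 2-cell $(C_1,H_1,\theta_1)\to(C_2,H_2,\theta_2)$ is a 2-cell $(\psi,\phi)$ in $\mathbf{Fib}$ with $(K'\phi)\theta_1=\theta_2(\phi K)$. **The 2-functor $\mathrm X$.** On objects, $\mathrm X(p,\chi)=(p,K_\chi)$, where the counit $\epsilon_E=\overline{\chi_E}\colon K_\chi E\to E$ is the chosen cartesian lift of $\chi_E\colon X_E\to pE$ at $E$, and $K_\chi$ acts on arrows by the universal property of these lifts (over the domain component of $\chi$), making $\epsilon$ natural. On 1-cells, $\mathrm X(B,H,\zeta)=(B,H,\theta)$, where $\theta_E\colon HK_\chi E\to K_{\chi'}HE$ is the unique arrow over $\zeta_E$ with $\epsilon'_{HE}\circ\theta_E=H\epsilon_E$. On 2-cells it is the identity. **The 2-functor $\mathrm Y$.** On objects, $\mathrm Y(p,K)=(p,\chi)$ with $\chi(E)=p\epsilon_E$. On 1-cells, $\mathrm Y(C,H,\theta)=(C,H,\zeta)$ with $\zeta_E$ given by $p'\theta_E\colon CpKE=p'HKE\to p'K'HE$. On 2-cells it is the identity. *)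

theory Defs
  imports Main "HOL-Library.FuncSet"
begin

section \<open>Categories, functors, natural transformations\<close>

text \<open>
  Objects and arrows range over carrier sets inside two types, so that a type instance plays
  the role of a universe. All operations are \<^const>\<open>undefined\<close> outside their proper domain; hence
  HOL equality of the records below is equality of categories, functors, and transformations.
\<close>

record ('o, 'a) cat =
  Ob :: "'o set"
  Ar :: "'a set"
  src :: "'a \<Rightarrow> 'o"
  tgt :: "'a \<Rightarrow> 'o"
  ide :: "'o \<Rightarrow> 'a"
  cmp :: "'a \<Rightarrow> 'a \<Rightarrow> 'a" (infixr "\<cdot>\<index>" 70)  \<comment> \<open>\<open>g \<cdot> f\<close> is \<open>g\<close> after \<open>f\<close>\<close>

definition hom :: "('o, 'a) cat \<Rightarrow> 'o \<Rightarrow> 'o \<Rightarrow> 'a set" where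
  "hom C a b = {f \<in> Ar C. src C f = a \<and> tgt C f = b}"

locale category =
  fixes C :: "('o, 'a) cat" (structure)
  assumes src_closed: "f \<in> Ar C \<Longrightarrow> src C f \<in> Ob C"
    and tgt_closed: "f \<in> Ar C \<Longrightarrow> tgt C f \<in> Ob C"
    and ide_hom: "a \<in> Ob C \<Longrightarrow> ide C a \<in> hom C a a"
    and cmp_hom: "\<lbrakk>f \<in> hom C a b; g \<in> hom C b c\<rbrakk> \<Longrightarrow> g \<cdot> f \<in> hom C a c"
    and cmp_ide_left: "f \<in> hom C a b \<Longrightarrow> ide C b \<cdot> f = f"
    and cmp_ide_right: "f \<in> hom C a b \<Longrightarrow> f \<cdot> ide C a = f"
    and cmp_assoc: "\<lbrakk>f \<in> hom C a b; g \<in> hom C b c; h \<in> hom C c d\<rbrakk>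
                    \<Longrightarrow> (h \<cdot> g) \<cdot> f = h \<cdot> (g \<cdot> f)"
    and src_ext: "src C \<in> extensional (Ar C)"
    and tgt_ext: "tgt C \<in> extensional (Ar C)"
    and ide_ext: "ide C \<in> extensional (Ob C)"
    and cmp_ext: "\<not> (f \<in> Ar C \<and> g \<in> Ar C \<and> src C g = tgt C f) \<Longrightarrow> g \<cdot> f = undefined"

record ('o, 'a, 'p, 'b) func =
  Dom :: "('o, 'a) cat"
  Cod :: "('p, 'b) cat"
  fob :: "'o \<Rightarrow> 'p"
  far :: "'a \<Rightarrow> 'b"

locale is_functor =
  fixes F :: "('o, 'a, 'p, 'b) func"
  assumes category_Dom: "category (Dom F)"
    and category_Cod: "category (Cod F)"
    and fob_closed: "fob F \<in> Ob (Dom F) \<rightarrow>\<^sub>E Ob (Cod F)"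
    and far_ext: "far F \<in> extensional (Ar (Dom F))"
    and far_hom: "f \<in> hom (Dom F) a b \<Longrightarrow> far F f \<in> hom (Cod F) (fob F a) (fob F b)"
    and far_ide: "a \<in> Ob (Dom F) \<Longrightarrow> far F (ide (Dom F) a) = ide (Cod F) (fob F a)"
    and far_cmp: "\<lbrakk>f \<in> hom (Dom F) a b; g \<in> hom (Dom F) b c\<rbrakk>
                  \<Longrightarrow> far F (g \<cdot>\<^bsub>Dom F\<^esub> f) = far F g \<cdot>\<^bsub>Cod F\<^esub> far F f"

definition idf :: "('o, 'a) cat \<Rightarrow> ('o, 'a, 'o, 'a) func" where
  "idf C = \<lparr>Dom = C, Cod = C, fob = restrict (\<lambda>a. a) (Ob C), far = restrict (\<lambda>f. f) (Ar C)\<rparr>"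

definition fcomp :: "('p, 'b, 'q, 'c) func \<Rightarrow> ('o, 'a, 'p, 'b) func \<Rightarrow> ('o, 'a, 'q, 'c) func"
    (infixr "\<circ>\<^sub>F" 75) where
  "G \<circ>\<^sub>F F = \<lparr>Dom = Dom F, Cod = Cod G,
     fob = compose (Ob (Dom F)) (fob G) (fob F),
     far = compose (Ar (Dom F)) (far G) (far F)\<rparr>"

record ('o, 'a, 'p, 'b) nt =
  nsrc :: "('o, 'a, 'p, 'b) func"
  ntgt :: "('o, 'a, 'p, 'b) func"
  cpt :: "'o \<Rightarrow> 'b"

locale nat_trans =
  fixes \<alpha> :: "('o, 'a, 'p, 'b) nt"
  assumes functor_nsrc: "is_functor (nsrc \<alpha>)"
    and functor_ntgt: "is_functor (ntgt \<alpha>)"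
    and Dom_eq: "Dom (ntgt \<alpha>) = Dom (nsrc \<alpha>)"
    and Cod_eq: "Cod (ntgt \<alpha>) = Cod (nsrc \<alpha>)"
    and cpt_ext: "cpt \<alpha> \<in> extensional (Ob (Dom (nsrc \<alpha>)))"
    and cpt_hom: "a \<in> Ob (Dom (nsrc \<alpha>))
                  \<Longrightarrow> cpt \<alpha> a \<in> hom (Cod (nsrc \<alpha>)) (fob (nsrc \<alpha>) a) (fob (ntgt \<alpha>) a)"
    and naturality: "f \<in> hom (Dom (nsrc \<alpha>)) a b
                  \<Longrightarrow> far (ntgt \<alpha>) f \<cdot>\<^bsub>Cod (nsrc \<alpha>)\<^esub> cpt \<alpha> a
                      = cpt \<alpha> b \<cdot>\<^bsub>Cod (nsrc \<alpha>)\<^esub> far (nsrc \<alpha>) f"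

definition nat_trans_from_to ::
    "('o, 'a, 'p, 'b) nt \<Rightarrow> ('o, 'a, 'p, 'b) func \<Rightarrow> ('o, 'a, 'p, 'b) func \<Rightarrow> bool"
    ("(_ : _ \<Rightarrow>\<^sub>N _)" [51, 51, 51] 50) where
  "(\<alpha> : F \<Rightarrow>\<^sub>N G) \<longleftrightarrow> nat_trans \<alpha> \<and> nsrc \<alpha> = F \<and> ntgt \<alpha> = G"

definition idn :: "('o, 'a, 'p, 'b) func \<Rightarrow> ('o, 'a, 'p, 'b) nt" where
  "idn F = \<lparr>nsrc = F, ntgt = F, cpt = (\<lambda>a\<in>Ob (Dom F). ide (Cod F) (fob F a))\<rparr>"

definition vcomp :: "('o, 'a, 'p, 'b) nt \<Rightarrow> ('o, 'a, 'p, 'b) nt \<Rightarrow> ('o, 'a, 'p, 'b) nt"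
    (infixr "\<bullet>\<^sub>N" 65) where
  "\<beta> \<bullet>\<^sub>N \<alpha> = \<lparr>nsrc = nsrc \<alpha>, ntgt = ntgt \<beta>,
     cpt = (\<lambda>a\<in>Ob (Dom (nsrc \<alpha>)). cpt \<beta> a \<cdot>\<^bsub>Cod (nsrc \<alpha>)\<^esub> cpt \<alpha> a)\<rparr>"

text \<open>The whiskerings \<open>G \<rhd> \<alpha>\<close> and \<open>\<alpha> \<lhd> F\<close> are written \<open>G\<alpha>\<close> and \<open>\<alpha>F\<close> on paper.\<close>

definition whisk_left :: "('p, 'b, 'q, 'c) func \<Rightarrow> ('o, 'a, 'p, 'b) nt \<Rightarrow> ('o, 'a, 'q, 'c) nt"
    (infixr "\<rhd>" 75) where
  "G \<rhd> \<alpha> = \<lparr>nsrc = G \<circ>\<^sub>F nsrc \<alpha>, ntgt = G \<circ>\<^sub>F ntgt \<alpha>,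
     cpt = (\<lambda>a\<in>Ob (Dom (nsrc \<alpha>)). far G (cpt \<alpha> a))\<rparr>"

definition whisk_right :: "('p, 'b, 'q, 'c) nt \<Rightarrow> ('o, 'a, 'p, 'b) func \<Rightarrow> ('o, 'a, 'q, 'c) nt"
    (infixl "\<lhd>" 75) where
  "\<alpha> \<lhd> F = \<lparr>nsrc = nsrc \<alpha> \<circ>\<^sub>F F, ntgt = ntgt \<alpha> \<circ>\<^sub>F F,
     cpt = (\<lambda>a\<in>Ob (Dom F). cpt \<alpha> (fob F a))\<rparr>"

definition hcomp :: "('p, 'b, 'q, 'c) nt \<Rightarrow> ('o, 'a, 'p, 'b) nt \<Rightarrow> ('o, 'a, 'q, 'c) nt"
    (infixr "\<star>\<^sub>N" 70) where
  "\<beta> \<star>\<^sub>N \<alpha> = (\<beta> \<lhd> ntgt \<alpha>) \<bullet>\<^sub>N (nsrc \<beta> \<rhd> \<alpha>)"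

definition nt_invertible :: "('o, 'a, 'p, 'b) nt \<Rightarrow> bool" where
  "nt_invertible \<alpha> \<longleftrightarrow> (\<exists>\<beta>. (\<beta> : ntgt \<alpha> \<Rightarrow>\<^sub>N nsrc \<alpha>) \<and>
     \<beta> \<bullet>\<^sub>N \<alpha> = idn (nsrc \<alpha>) \<and> \<alpha> \<bullet>\<^sub>N \<beta> = idn (ntgt \<alpha>))"


section \<open>Arrow categories and pullbacks\<close>

text \<open>
  An arrow \<open>f \<rightarrow> g\<close> of the arrow category is a commutative square; it carries \<open>f\<close> and \<open>g\<close> along
  with its domain and codomain components.
\<close>

datatype 'a square = Square (sq_src: 'a) (sq_tgt: 'a) (sq_dom: 'a) (sq_cod: 'a)

definition squares :: "('o, 'a) cat \<Rightarrow> 'a square set" where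
  "squares C = {s. sq_src s \<in> Ar C \<and> sq_tgt s \<in> Ar C \<and>
     sq_dom s \<in> hom C (src C (sq_src s)) (src C (sq_tgt s)) \<and>
     sq_cod s \<in> hom C (tgt C (sq_src s)) (tgt C (sq_tgt s)) \<and>
     sq_tgt s \<cdot>\<^bsub>C\<^esub> sq_dom s = sq_cod s \<cdot>\<^bsub>C\<^esub> sq_src s}"

definition arrow_cat :: "('o, 'a) cat \<Rightarrow> ('a, 'a square) cat" where
  "arrow_cat C = \<lparr>Ob = Ar C, Ar = squares C,
     src = restrict sq_src (squares C),
     tgt = restrict sq_tgt (squares C),
     ide = (\<lambda>f\<in>Ar C. Square f f (ide C (src C f)) (ide C (tgt C f))),
     cmp = (\<lambda>t s. if s \<in> squares C \<and> t \<in> squares C \<and> sq_src t = sq_tgt s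
                  then Square (sq_src s) (sq_tgt t)
                         (sq_dom t \<cdot>\<^bsub>C\<^esub> sq_dom s) (sq_cod t \<cdot>\<^bsub>C\<^esub> sq_cod s)
                  else undefined)\<rparr>"

definition cod_functor :: "('o, 'a) cat \<Rightarrow> ('a, 'a square, 'o, 'a) func" where
  "cod_functor C = \<lparr>Dom = arrow_cat C, Cod = C,
     fob = restrict (tgt C) (Ar C), far = restrict sq_cod (squares C)\<rparr>"

definition arrow_functor ::
    "('o, 'a, 'p, 'b) func \<Rightarrow> ('a, 'a square, 'b, 'b square) func" ("_\<^bold>\<two>" [1000] 999) where
  "F\<^bold>\<two> = \<lparr>Dom = arrow_cat (Dom F), Cod = arrow_cat (Cod F),
     fob = restrict (far F) (Ar (Dom F)),
     far = restrict (map_square (far F)) (squares (Dom F))\<rparr>"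

definition arrow_nt :: "('o, 'a, 'p, 'b) nt \<Rightarrow> ('a, 'a square, 'b, 'b square) nt"
    where
  "arrow_nt \<psi> = \<lparr>nsrc = arrow_functor (nsrc \<psi>), ntgt = arrow_functor (ntgt \<psi>),
     cpt = (\<lambda>f\<in>Ar (Dom (nsrc \<psi>)).
       Square (far (nsrc \<psi>) f) (far (ntgt \<psi>) f)
         (cpt \<psi> (src (Dom (nsrc \<psi>)) f)) (cpt \<psi> (tgt (Dom (nsrc \<psi>)) f)))\<rparr>"

definition is_pullback :: "('o, 'a) cat \<Rightarrow> 'a square \<Rightarrow> bool" where
  "is_pullback C s \<longleftrightarrow> s \<in> squares C \<and>
     (\<forall>x\<in>Ar C. \<forall>y\<in>Ar C. src C x = src C y \<and>
        tgt C x = src C (sq_tgt s) \<and> tgt C y = tgt C (sq_src s) \<and>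
        sq_tgt s \<cdot>\<^bsub>C\<^esub> x = sq_cod s \<cdot>\<^bsub>C\<^esub> y \<longrightarrow>
        (\<exists>!t. t \<in> hom C (src C x) (src C (sq_src s)) \<and>
              sq_dom s \<cdot>\<^bsub>C\<^esub> t = x \<and> sq_src s \<cdot>\<^bsub>C\<^esub> t = y))"


section \<open>Fibrations\<close>

definition cartesian :: "('e, 'f, 'o, 'a) func \<Rightarrow> 'f \<Rightarrow> bool" where
  "cartesian p f \<longleftrightarrow> f \<in> Ar (Dom p) \<and>
     (\<forall>g\<in>Ar (Dom p). \<forall>w\<in>hom (Cod p) (fob p (src (Dom p) g)) (fob p (src (Dom p) f)).
        tgt (Dom p) g = tgt (Dom p) f \<and> far p f \<cdot>\<^bsub>Cod p\<^esub> w = far p g \<longrightarrow>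
        (\<exists>!h. h \<in> hom (Dom p) (src (Dom p) g) (src (Dom p) f) \<and>
              far p h = w \<and> f \<cdot>\<^bsub>Dom p\<^esub> h = g))"

definition grothendieck_fibration :: "('e, 'f, 'o, 'a) func \<Rightarrow> bool" where
  "grothendieck_fibration p \<longleftrightarrow> is_functor p \<and>
     (\<forall>e\<in>Ob (Dom p). \<forall>u\<in>Ar (Cod p). tgt (Cod p) u = fob p e \<longrightarrow>
        (\<exists>f. cartesian p f \<and> tgt (Dom p) f = e \<and> far p f = u))"

text \<open>\<open>lift P e u\<close> is the chosen cartesian lift of \<open>u\<close> at \<open>e\<close>.\<close>

record ('e, 'f, 'o, 'a) cloven =
  proj :: "('e, 'f, 'o, 'a) func"
  lift :: "'e \<Rightarrow> 'a \<Rightarrow> 'f"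

abbreviation total_cat :: "('e, 'f, 'o, 'a) cloven \<Rightarrow> ('e, 'f) cat" where
  "total_cat P \<equiv> Dom (proj P)"

abbreviation base_cat :: "('e, 'f, 'o, 'a) cloven \<Rightarrow> ('o, 'a) cat" where
  "base_cat P \<equiv> Cod (proj P)"

locale cloven_fibration =
  fixes P :: "('e, 'f, 'o, 'a) cloven"
  assumes fibration: "grothendieck_fibration (proj P)"
    and lift: "\<lbrakk>e \<in> Ob (total_cat P); u \<in> Ar (base_cat P); tgt (base_cat P) u = fob (proj P) e\<rbrakk>
               \<Longrightarrow> cartesian (proj P) (lift P e u) \<and> tgt (total_cat P) (lift P e u) = e \<and>
                   far (proj P) (lift P e u) = u"
    and lift_ext: "\<not> (e \<in> Ob (total_cat P) \<and> u \<in> Ar (base_cat P) \<and> tgt (base_cat P) u = fob (proj P) e)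
               \<Longrightarrow> lift P e u = undefined"

text \<open>
  1-cells and 2-cells of \<open>Fib\<close>. All fibrations live over the same four types, which serve
  as the universe. Cleavages need not be preserved.
\<close>

definition fib_1cell :: "('e, 'f, 'o, 'a) cloven \<Rightarrow> ('e, 'f, 'o, 'a) cloven \<Rightarrow>
    ('o, 'a, 'o, 'a) func \<Rightarrow> ('e, 'f, 'e, 'f) func \<Rightarrow> bool" where
  "fib_1cell P P' B H \<longleftrightarrow> is_functor B \<and> is_functor H \<and>
     Dom B = base_cat P \<and> Cod B = base_cat P' \<and> Dom H = total_cat P \<and> Cod H = total_cat P' \<and>
     proj P' \<circ>\<^sub>F H = B \<circ>\<^sub>F proj P \<and>
     (\<forall>f. cartesian (proj P) f \<longrightarrow> cartesian (proj P') (far H f))"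

definition fib_2cell :: "('e, 'f, 'o, 'a) cloven \<Rightarrow> ('e, 'f, 'o, 'a) cloven \<Rightarrow>
    ('o, 'a, 'o, 'a) func \<Rightarrow> ('e, 'f, 'e, 'f) func \<Rightarrow>
    ('o, 'a, 'o, 'a) func \<Rightarrow> ('e, 'f, 'e, 'f) func \<Rightarrow>
    ('o, 'a, 'o, 'a) nt \<Rightarrow> ('e, 'f, 'e, 'f) nt \<Rightarrow> bool" where
  "fib_2cell P P' B\<^sub>1 H\<^sub>1 B\<^sub>2 H\<^sub>2 \<psi> \<phi> \<longleftrightarrow>
     (\<psi> : B\<^sub>1 \<Rightarrow>\<^sub>N B\<^sub>2) \<and> (\<phi> : H\<^sub>1 \<Rightarrow>\<^sub>N H\<^sub>2) \<and> proj P' \<rhd> \<phi> = \<psi> \<lhd> proj P"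


section \<open>Strict 2-categories\<close>

record ('o, 'm, 't) twocat =
  Cell0 :: "'o set"
  Cell1 :: "'m set"
  Cell2 :: "'t set"
  dom1 :: "'m \<Rightarrow> 'o"
  cod1 :: "'m \<Rightarrow> 'o"
  dom2 :: "'t \<Rightarrow> 'm"
  cod2 :: "'t \<Rightarrow> 'm"
  id1 :: "'o \<Rightarrow> 'm"
  id2 :: "'m \<Rightarrow> 't"
  cmp1 :: "'m \<Rightarrow> 'm \<Rightarrow> 'm" (infixr "\<odot>\<index>" 75)
  vcmp :: "'t \<Rightarrow> 't \<Rightarrow> 't" (infixr "\<bullet>\<index>" 65)
  hcmp :: "'t \<Rightarrow> 't \<Rightarrow> 't" (infixr "\<star>\<index>" 70)

definition cells1 :: "('o, 'm, 't) twocat \<Rightarrow> 'o \<Rightarrow> 'o \<Rightarrow> 'm set" where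
  "cells1 C a b = {f \<in> Cell1 C. dom1 C f = a \<and> cod1 C f = b}"

definition cells2 :: "('o, 'm, 't) twocat \<Rightarrow> 'm \<Rightarrow> 'm \<Rightarrow> 't set" where
  "cells2 C f g = {\<alpha> \<in> Cell2 C. dom2 C \<alpha> = f \<and> cod2 C \<alpha> = g}"

locale two_category =
  fixes C :: "('o, 'm, 't) twocat" (structure)
  assumes dom1_closed: "f \<in> Cell1 C \<Longrightarrow> dom1 C f \<in> Cell0 C"
    and cod1_closed: "f \<in> Cell1 C \<Longrightarrow> cod1 C f \<in> Cell0 C"
    and id1_cell: "a \<in> Cell0 C \<Longrightarrow> id1 C a \<in> cells1 C a a"
    and cmp1_cell: "\<lbrakk>f \<in> cells1 C a b; g \<in> cells1 C b c\<rbrakk> \<Longrightarrow> g \<odot> f \<in> cells1 C a c"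
    and cmp1_id_left: "f \<in> cells1 C a b \<Longrightarrow> id1 C b \<odot> f = f"
    and cmp1_id_right: "f \<in> cells1 C a b \<Longrightarrow> f \<odot> id1 C a = f"
    and cmp1_assoc: "\<lbrakk>f \<in> cells1 C a b; g \<in> cells1 C b c; h \<in> cells1 C c d\<rbrakk>
                     \<Longrightarrow> (h \<odot> g) \<odot> f = h \<odot> (g \<odot> f)"
    and dom2_closed: "\<alpha> \<in> Cell2 C \<Longrightarrow> dom2 C \<alpha> \<in> Cell1 C"
    and cod2_closed: "\<alpha> \<in> Cell2 C \<Longrightarrow> cod2 C \<alpha> \<in> Cell1 C"
    and dom2_dom1: "\<alpha> \<in> Cell2 C \<Longrightarrow> dom1 C (cod2 C \<alpha>) = dom1 C (dom2 C \<alpha>)"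
    and dom2_cod1: "\<alpha> \<in> Cell2 C \<Longrightarrow> cod1 C (cod2 C \<alpha>) = cod1 C (dom2 C \<alpha>)"
    and id2_cell: "f \<in> Cell1 C \<Longrightarrow> id2 C f \<in> cells2 C f f"
    and vcmp_cell: "\<lbrakk>\<alpha> \<in> cells2 C f g; \<beta> \<in> cells2 C g h\<rbrakk> \<Longrightarrow> \<beta> \<bullet> \<alpha> \<in> cells2 C f h"
    and vcmp_id_left: "\<alpha> \<in> cells2 C f g \<Longrightarrow> id2 C g \<bullet> \<alpha> = \<alpha>"
    and vcmp_id_right: "\<alpha> \<in> cells2 C f g \<Longrightarrow> \<alpha> \<bullet> id2 C f = \<alpha>"
    and vcmp_assoc: "\<lbrakk>\<alpha> \<in> cells2 C f g; \<beta> \<in> cells2 C g h; \<gamma> \<in> cells2 C h k\<rbrakk>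
                     \<Longrightarrow> (\<gamma> \<bullet> \<beta>) \<bullet> \<alpha> = \<gamma> \<bullet> (\<beta> \<bullet> \<alpha>)"
    and hcmp_cell: "\<lbrakk>f \<in> cells1 C a b; f' \<in> cells1 C b c; \<alpha> \<in> cells2 C f g; \<beta> \<in> cells2 C f' g'\<rbrakk>
                    \<Longrightarrow> \<beta> \<star> \<alpha> \<in> cells2 C (f' \<odot> f) (g' \<odot> g)"
    and hcmp_id_left: "\<lbrakk>f \<in> cells1 C a b; \<alpha> \<in> cells2 C f g\<rbrakk> \<Longrightarrow> id2 C (id1 C b) \<star> \<alpha> = \<alpha>"
    and hcmp_id_right: "\<lbrakk>f \<in> cells1 C a b; \<alpha> \<in> cells2 C f g\<rbrakk> \<Longrightarrow> \<alpha> \<star> id2 C (id1 C a) = \<alpha>"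
    and hcmp_assoc: "\<lbrakk>f \<in> cells1 C a b; f' \<in> cells1 C b c; f'' \<in> cells1 C c d;
                      \<alpha> \<in> cells2 C f g; \<beta> \<in> cells2 C f' g'; \<gamma> \<in> cells2 C f'' g''\<rbrakk>
                     \<Longrightarrow> (\<gamma> \<star> \<beta>) \<star> \<alpha> = \<gamma> \<star> (\<beta> \<star> \<alpha>)"
    and hcmp_id2: "\<lbrakk>f \<in> cells1 C a b; g \<in> cells1 C b c\<rbrakk>
                   \<Longrightarrow> id2 C g \<star> id2 C f = id2 C (g \<odot> f)"
    and interchange: "\<lbrakk>f \<in> cells1 C a b; f' \<in> cells1 C b c;
                       \<alpha> \<in> cells2 C f g; \<beta> \<in> cells2 C g h; \<alpha>' \<in> cells2 C f' g'; \<beta>' \<in> cells2 C g' h'\<rbrakk>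
                     \<Longrightarrow> (\<beta>' \<bullet> \<alpha>') \<star> (\<beta> \<bullet> \<alpha>) = (\<beta>' \<star> \<beta>) \<bullet> (\<alpha>' \<star> \<alpha>)"

definition wide_2full :: "('o, 'm, 't) twocat \<Rightarrow> ('m \<Rightarrow> bool) \<Rightarrow> ('o, 'm, 't) twocat" where
  "wide_2full C S = C\<lparr>Cell1 := {f \<in> Cell1 C. S f},
     Cell2 := {\<alpha> \<in> Cell2 C. S (dom2 C \<alpha>) \<and> S (cod2 C \<alpha>)}\<rparr>"

definition invertible2 :: "('o, 'm, 't) twocat \<Rightarrow> 't \<Rightarrow> bool" where
  "invertible2 C \<alpha> \<longleftrightarrow> \<alpha> \<in> Cell2 C \<and> (\<exists>\<beta>\<in>cells2 C (cod2 C \<alpha>) (dom2 C \<alpha>).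
     \<beta> \<bullet>\<^bsub>C\<^esub> \<alpha> = id2 C (dom2 C \<alpha>) \<and> \<alpha> \<bullet>\<^bsub>C\<^esub> \<beta> = id2 C (cod2 C \<alpha>))"

definition equivalence1 :: "('o, 'm, 't) twocat \<Rightarrow> 'm \<Rightarrow> bool" where
  "equivalence1 C f \<longleftrightarrow> f \<in> Cell1 C \<and> (\<exists>g\<in>cells1 C (cod1 C f) (dom1 C f).
     (\<exists>\<alpha>\<in>cells2 C (id1 C (dom1 C f)) (g \<odot>\<^bsub>C\<^esub> f). invertible2 C \<alpha>) \<and>
     (\<exists>\<beta>\<in>cells2 C (f \<odot>\<^bsub>C\<^esub> g) (id1 C (cod1 C f)). invertible2 C \<beta>))"


section \<open>2-functors, pseudo-natural transformations, modifications\<close>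

text \<open>
  Unlike functors above, 2-functors and the transformations between them are not normalised
  outside the carriers; 2-functors are therefore compared on the cells of their domain.
\<close>

record ('o, 'm, 't, 'p, 'n, 'u) twofunc =
  on0 :: "'o \<Rightarrow> 'p"
  on1 :: "'m \<Rightarrow> 'n"
  on2 :: "'t \<Rightarrow> 'u"

locale two_functor =
  fixes C :: "('o, 'm, 't) twocat" and D :: "('p, 'n, 'u) twocat"
    and F :: "('o, 'm, 't, 'p, 'n, 'u) twofunc"
  assumes two_category_dom: "two_category C"
    and two_category_cod: "two_category D"
    and on0_cell: "a \<in> Cell0 C \<Longrightarrow> on0 F a \<in> Cell0 D"
    and on1_cell: "f \<in> cells1 C a b \<Longrightarrow> on1 F f \<in> cells1 D (on0 F a) (on0 F b)"
    and on2_cell: "\<alpha> \<in> cells2 C f g \<Longrightarrow> on2 F \<alpha> \<in> cells2 D (on1 F f) (on1 F g)"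
    and on1_id1: "a \<in> Cell0 C \<Longrightarrow> on1 F (id1 C a) = id1 D (on0 F a)"
    and on1_cmp1: "\<lbrakk>f \<in> cells1 C a b; g \<in> cells1 C b c\<rbrakk>
                   \<Longrightarrow> on1 F (g \<odot>\<^bsub>C\<^esub> f) = on1 F g \<odot>\<^bsub>D\<^esub> on1 F f"
    and on2_id2: "f \<in> Cell1 C \<Longrightarrow> on2 F (id2 C f) = id2 D (on1 F f)"
    and on2_vcmp: "\<lbrakk>\<alpha> \<in> cells2 C f g; \<beta> \<in> cells2 C g h\<rbrakk>
                   \<Longrightarrow> on2 F (\<beta> \<bullet>\<^bsub>C\<^esub> \<alpha>) = on2 F \<beta> \<bullet>\<^bsub>D\<^esub> on2 F \<alpha>"
    and on2_hcmp: "\<lbrakk>f \<in> cells1 C a b; f' \<in> cells1 C b c; \<alpha> \<in> cells2 C f g; \<beta> \<in> cells2 C f' g'\<rbrakk>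
                   \<Longrightarrow> on2 F (\<beta> \<star>\<^bsub>C\<^esub> \<alpha>) = on2 F \<beta> \<star>\<^bsub>D\<^esub> on2 F \<alpha>"

definition id_2func :: "('o, 'm, 't, 'o, 'm, 't) twofunc" where
  "id_2func = \<lparr>on0 = id, on1 = id, on2 = id\<rparr>"

definition comp_2func :: "('p, 'n, 'u, 'q, 'l, 'v) twofunc \<Rightarrow> ('o, 'm, 't, 'p, 'n, 'u) twofunc \<Rightarrow>
    ('o, 'm, 't, 'q, 'l, 'v) twofunc" (infixr "\<circ>\<^sub>2" 75) where
  "G \<circ>\<^sub>2 F = \<lparr>on0 = on0 G \<circ> on0 F, on1 = on1 G \<circ> on1 F, on2 = on2 G \<circ> on2 F\<rparr>"

definition eq_2func_on :: "('o, 'm, 't) twocat \<Rightarrow> ('o, 'm, 't, 'p, 'n, 'u) twofunc \<Rightarrow>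
    ('o, 'm, 't, 'p, 'n, 'u) twofunc \<Rightarrow> bool" where
  "eq_2func_on C F G \<longleftrightarrow> (\<forall>a\<in>Cell0 C. on0 F a = on0 G a) \<and>
     (\<forall>f\<in>Cell1 C. on1 F f = on1 G f) \<and> (\<forall>\<alpha>\<in>Cell2 C. on2 F \<alpha> = on2 G \<alpha>)"

record ('o, 'm, 'n, 'u) pseudonat =
  pn0 :: "'o \<Rightarrow> 'n"
  pn1 :: "'m \<Rightarrow> 'u"

text \<open>Orientation: for \<open>f : a \<rightarrow> b\<close>, the 2-cell \<open>pn1 \<sigma> f\<close> goes from \<open>G f \<odot> \<sigma>\<^sub>a\<close> to \<open>\<sigma>\<^sub>b \<odot> F f\<close>.\<close>

locale pseudo_nat =
  fixes C :: "('o, 'm, 't) twocat" and D :: "('p, 'n, 'u) twocat" (structure)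
    and F :: "('o, 'm, 't, 'p, 'n, 'u) twofunc" and G :: "('o, 'm, 't, 'p, 'n, 'u) twofunc"
    and \<sigma> :: "('o, 'm, 'n, 'u) pseudonat"
  assumes two_functor_dom: "two_functor C D F"
    and two_functor_cod: "two_functor C D G"
    and pn0_cell: "a \<in> Cell0 C \<Longrightarrow> pn0 \<sigma> a \<in> cells1 D (on0 F a) (on0 G a)"
    and pn1_cell: "f \<in> cells1 C a b
                   \<Longrightarrow> pn1 \<sigma> f \<in> cells2 D (on1 G f \<odot> pn0 \<sigma> a) (pn0 \<sigma> b \<odot> on1 F f)"
    and pn1_invertible: "f \<in> Cell1 C \<Longrightarrow> invertible2 D (pn1 \<sigma> f)"
    and pn1_natural: "\<lbrakk>f \<in> cells1 C a b; \<alpha> \<in> cells2 C f g\<rbrakk>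
                   \<Longrightarrow> pn1 \<sigma> g \<bullet> (on2 G \<alpha> \<star> id2 D (pn0 \<sigma> a))
                       = (id2 D (pn0 \<sigma> b) \<star> on2 F \<alpha>) \<bullet> pn1 \<sigma> f"
    and pn1_id1: "a \<in> Cell0 C \<Longrightarrow> pn1 \<sigma> (id1 C a) = id2 D (pn0 \<sigma> a)"
    and pn1_cmp1: "\<lbrakk>f \<in> cells1 C a b; g \<in> cells1 C b c\<rbrakk>
                   \<Longrightarrow> pn1 \<sigma> (g \<odot>\<^bsub>C\<^esub> f)
                       = (pn1 \<sigma> g \<star> id2 D (on1 F f)) \<bullet> (id2 D (on1 G g) \<star> pn1 \<sigma> f)"

definition pn_id :: "('p, 'n, 'u) twocat \<Rightarrow> ('o, 'm, 't, 'p, 'n, 'u) twofunc \<Rightarrow>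
    ('o, 'm, 'n, 'u) pseudonat" where
  "pn_id D F = \<lparr>pn0 = (\<lambda>a. id1 D (on0 F a)), pn1 = (\<lambda>f. id2 D (on1 F f))\<rparr>"

definition pn_comp :: "('o, 'm, 't) twocat \<Rightarrow> ('p, 'n, 'u) twocat \<Rightarrow>
    ('o, 'm, 'n, 'u) pseudonat \<Rightarrow> ('o, 'm, 'n, 'u) pseudonat \<Rightarrow> ('o, 'm, 'n, 'u) pseudonat" where
  "pn_comp C D \<tau> \<sigma> = \<lparr>pn0 = (\<lambda>a. pn0 \<tau> a \<odot>\<^bsub>D\<^esub> pn0 \<sigma> a),
     pn1 = (\<lambda>f. (id2 D (pn0 \<tau> (cod1 C f)) \<star>\<^bsub>D\<^esub> pn1 \<sigma> f)
                \<bullet>\<^bsub>D\<^esub> (pn1 \<tau> f \<star>\<^bsub>D\<^esub> id2 D (pn0 \<sigma> (dom1 C f))))\<rparr>"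

definition pn_whisk_left :: "('p, 'n, 'u, 'q, 'l, 'v) twofunc \<Rightarrow> ('o, 'm, 'n, 'u) pseudonat \<Rightarrow>
    ('o, 'm, 'l, 'v) pseudonat" where
  "pn_whisk_left K \<sigma> = \<lparr>pn0 = on1 K \<circ> pn0 \<sigma>, pn1 = on2 K \<circ> pn1 \<sigma>\<rparr>"

definition pn_whisk_right :: "('p, 'n, 'l, 'v) pseudonat \<Rightarrow> ('o, 'm, 't, 'p, 'n, 'u) twofunc \<Rightarrow>
    ('o, 'm, 'l, 'v) pseudonat" where
  "pn_whisk_right \<sigma> J = \<lparr>pn0 = pn0 \<sigma> \<circ> on0 J, pn1 = pn1 \<sigma> \<circ> on1 J\<rparr>"

locale invertible_modification =
  fixes C :: "('o, 'm, 't) twocat" and D :: "('p, 'n, 'u) twocat" (structure)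
    and F :: "('o, 'm, 't, 'p, 'n, 'u) twofunc" and G :: "('o, 'm, 't, 'p, 'n, 'u) twofunc"
    and \<sigma> :: "('o, 'm, 'n, 'u) pseudonat" and \<tau> :: "('o, 'm, 'n, 'u) pseudonat"
    and \<Gamma> :: "'o \<Rightarrow> 'u"
  assumes pseudo_nat_dom: "pseudo_nat C D F G \<sigma>"
    and pseudo_nat_cod: "pseudo_nat C D F G \<tau>"
    and mod_cell: "a \<in> Cell0 C \<Longrightarrow> \<Gamma> a \<in> cells2 D (pn0 \<sigma> a) (pn0 \<tau> a)"
    and mod_invertible: "a \<in> Cell0 C \<Longrightarrow> invertible2 D (\<Gamma> a)"
    and mod_natural: "f \<in> cells1 C a b
                      \<Longrightarrow> pn1 \<tau> f \<bullet> (id2 D (on1 G f) \<star> \<Gamma> a)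
                          = (\<Gamma> b \<star> id2 D (on1 F f)) \<bullet> pn1 \<sigma> f"

locale adjoint_biequivalence =
  fixes C :: "('o, 'm, 't) twocat" and D :: "('p, 'n, 'u) twocat"
    and L :: "('o, 'm, 't, 'p, 'n, 'u) twofunc" and R :: "('p, 'n, 'u, 'o, 'm, 't) twofunc"
    and \<eta> :: "('o, 'm, 'm, 't) pseudonat" and \<epsilon> :: "('p, 'n, 'n, 'u) pseudonat"
  assumes left_2functor: "two_functor C D L"
    and right_2functor: "two_functor D C R"
    and unit: "pseudo_nat C C id_2func (R \<circ>\<^sub>2 L) \<eta>"
    and counit: "pseudo_nat D D (L \<circ>\<^sub>2 R) id_2func \<epsilon>"
    and unit_equivalence: "a \<in> Cell0 C \<Longrightarrow> equivalence1 C (pn0 \<eta> a)"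
    and counit_equivalence: "d \<in> Cell0 D \<Longrightarrow> equivalence1 D (pn0 \<epsilon> d)"
    and triangle_left: "\<exists>\<Gamma>. invertible_modification C D L L
          (pn_comp C D (pn_whisk_right \<epsilon> L) (pn_whisk_left L \<eta>)) (pn_id D L) \<Gamma>"
    and triangle_right: "\<exists>\<Gamma>. invertible_modification D C R R
          (pn_comp D C (pn_whisk_left R \<epsilon>) (pn_whisk_right \<eta> R)) (pn_id C R) \<Gamma>"


section \<open>Comprehension categories\<close>

record ('e, 'f, 'o, 'a) compcat =
  cfib :: "('e, 'f, 'o, 'a) cloven"
  chi :: "('e, 'f, 'a, 'a square) func"

locale comprehension_category =
  fixes Q :: "('e, 'f, 'o, 'a) compcat"
  assumes cloven: "cloven_fibration (cfib Q)"
    and functor_chi: "is_functor (chi Q)"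
    and Dom_chi: "Dom (chi Q) = total_cat (cfib Q)"
    and Cod_chi: "Cod (chi Q) = arrow_cat (base_cat (cfib Q))"
    and cod_chi: "cod_functor (base_cat (cfib Q)) \<circ>\<^sub>F chi Q = proj (cfib Q)"
    and chi_cartesian: "cartesian (proj (cfib Q)) f \<Longrightarrow> is_pullback (base_cat (cfib Q)) (far (chi Q) f)"

record ('e, 'f, 'o, 'a) compmor =
  csrc :: "('e, 'f, 'o, 'a) compcat"
  ctgt :: "('e, 'f, 'o, 'a) compcat"
  cbase :: "('o, 'a, 'o, 'a) func"
  ctotal :: "('e, 'f, 'e, 'f) func"
  zeta :: "('e, 'f, 'a, 'a square) nt"

locale lax_comp_morphism =
  fixes m :: "('e, 'f, 'o, 'a) compmor"
  assumes src_comprehension: "comprehension_category (csrc m)"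
    and tgt_comprehension: "comprehension_category (ctgt m)"
    and fib_1cell: "fib_1cell (cfib (csrc m)) (cfib (ctgt m)) (cbase m) (ctotal m)"
    and zeta_nt: "zeta m : (cbase m)\<^bold>\<two> \<circ>\<^sub>F chi (csrc m) \<Rightarrow>\<^sub>N chi (ctgt m) \<circ>\<^sub>F ctotal m"
    and cod_zeta: "cod_functor (base_cat (cfib (ctgt m))) \<rhd> zeta m
                   = idn (cbase m \<circ>\<^sub>F proj (cfib (csrc m)))"

text \<open>
  2-cells of both 2-categories are 2-cells of \<open>Fib\<close> subject to a compatibility condition;
  \<open>'m\<close> is the type of 1-cells.
\<close>

record ('m, 'e, 'f, 'o, 'a) fib2 =
  csrc2 :: 'm
  ctgt2 :: 'm
  base_nt :: "('o, 'a, 'o, 'a) nt"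
  total_nt :: "('e, 'f, 'e, 'f) nt"

definition fib2_vcmp :: "('m, 'e, 'f, 'o, 'a) fib2 \<Rightarrow> ('m, 'e, 'f, 'o, 'a) fib2 \<Rightarrow>
    ('m, 'e, 'f, 'o, 'a) fib2" where
  "fib2_vcmp t s = \<lparr>csrc2 = csrc2 s, ctgt2 = ctgt2 t,
     base_nt = base_nt t \<bullet>\<^sub>N base_nt s, total_nt = total_nt t \<bullet>\<^sub>N total_nt s\<rparr>"

definition fib2_hcmp :: "('m \<Rightarrow> 'm \<Rightarrow> 'm) \<Rightarrow> ('m, 'e, 'f, 'o, 'a) fib2 \<Rightarrow>
    ('m, 'e, 'f, 'o, 'a) fib2 \<Rightarrow> ('m, 'e, 'f, 'o, 'a) fib2" where
  "fib2_hcmp c t s = \<lparr>csrc2 = c (csrc2 t) (csrc2 s), ctgt2 = c (ctgt2 t) (ctgt2 s),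
     base_nt = base_nt t \<star>\<^sub>N base_nt s, total_nt = total_nt t \<star>\<^sub>N total_nt s\<rparr>"

locale comp_2cell =
  fixes t :: "(('e, 'f, 'o, 'a) compmor, 'e, 'f, 'o, 'a) fib2"
  assumes lax_csrc2: "lax_comp_morphism (csrc2 t)"
    and lax_ctgt2: "lax_comp_morphism (ctgt2 t)"
    and csrc_eq: "csrc (ctgt2 t) = csrc (csrc2 t)"
    and ctgt_eq: "ctgt (ctgt2 t) = ctgt (csrc2 t)"
    and fib_2cell: "fib_2cell (cfib (csrc (csrc2 t))) (cfib (ctgt (csrc2 t)))
          (cbase (csrc2 t)) (ctotal (csrc2 t)) (cbase (ctgt2 t)) (ctotal (ctgt2 t))
          (base_nt t) (total_nt t)"
    and zeta_compat: "(chi (ctgt (csrc2 t)) \<rhd> total_nt t) \<bullet>\<^sub>N zeta (csrc2 t)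
          = zeta (ctgt2 t) \<bullet>\<^sub>N (arrow_nt (base_nt t) \<lhd> chi (csrc (csrc2 t)))"

definition compmor_id :: "('e, 'f, 'o, 'a) compcat \<Rightarrow> ('e, 'f, 'o, 'a) compmor" where
  "compmor_id Q = \<lparr>csrc = Q, ctgt = Q, cbase = idf (base_cat (cfib Q)),
     ctotal = idf (total_cat (cfib Q)), zeta = idn (chi Q)\<rparr>"

definition compmor_comp :: "('e, 'f, 'o, 'a) compmor \<Rightarrow> ('e, 'f, 'o, 'a) compmor \<Rightarrow>
    ('e, 'f, 'o, 'a) compmor" where
  "compmor_comp n m = \<lparr>csrc = csrc m, ctgt = ctgt n,
     cbase = cbase n \<circ>\<^sub>F cbase m, ctotal = ctotal n \<circ>\<^sub>F ctotal m,
     zeta = (zeta n \<lhd> ctotal m) \<bullet>\<^sub>N ((cbase n)\<^bold>\<two> \<rhd> zeta m)\<rparr>"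

type_synonym ('e, 'f, 'o, 'a) compcat_2cat =
  "(('e, 'f, 'o, 'a) compcat, ('e, 'f, 'o, 'a) compmor,
    (('e, 'f, 'o, 'a) compmor, 'e, 'f, 'o, 'a) fib2) twocat"

definition CompCat :: "('e, 'f, 'o, 'a) compcat_2cat" where
  "CompCat = \<lparr>
     Cell0 = {Q. comprehension_category Q},
     Cell1 = {m. lax_comp_morphism m},
     Cell2 = {t. comp_2cell t},
     dom1 = csrc, cod1 = ctgt, dom2 = csrc2, cod2 = ctgt2,
     id1 = compmor_id,
     id2 = (\<lambda>m. \<lparr>csrc2 = m, ctgt2 = m, base_nt = idn (cbase m), total_nt = idn (ctotal m)\<rparr>),
     cmp1 = compmor_comp, vcmp = fib2_vcmp, hcmp = fib2_hcmp compmor_comp\<rparr>"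

definition CompCat_ps :: "('e, 'f, 'o, 'a) compcat_2cat" where
  "CompCat_ps = wide_2full CompCat (\<lambda>m. nt_invertible (zeta m))"


section \<open>Weakening and contraction comonads\<close>

record ('e, 'f) comonad =
  cmK :: "('e, 'f, 'e, 'f) func"
  cm\<epsilon> :: "('e, 'f, 'e, 'f) nt"
  cm\<nu> :: "('e, 'f, 'e, 'f) nt"

locale is_comonad =
  fixes E :: "('e, 'f) cat" and W :: "('e, 'f) comonad"
  assumes functor_K: "is_functor (cmK W)"
    and Dom_K: "Dom (cmK W) = E"
    and Cod_K: "Cod (cmK W) = E"
    and counit_nt: "cm\<epsilon> W : cmK W \<Rightarrow>\<^sub>N idf E"
    and comult_nt: "cm\<nu> W : cmK W \<Rightarrow>\<^sub>N cmK W \<circ>\<^sub>F cmK W"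
    and counit_left: "(cm\<epsilon> W \<lhd> cmK W) \<bullet>\<^sub>N cm\<nu> W = idn (cmK W)"
    and counit_right: "(cmK W \<rhd> cm\<epsilon> W) \<bullet>\<^sub>N cm\<nu> W = idn (cmK W)"
    and coassoc: "(cm\<nu> W \<lhd> cmK W) \<bullet>\<^sub>N cm\<nu> W = (cmK W \<rhd> cm\<nu> W) \<bullet>\<^sub>N cm\<nu> W"

record ('e, 'f, 'o, 'a) wcmd =
  wfib :: "('e, 'f, 'o, 'a) cloven"
  wcm :: "('e, 'f) comonad"

abbreviation "wK W \<equiv> cmK (wcm W)"
abbreviation "w\<epsilon> W \<equiv> cm\<epsilon> (wcm W)"
abbreviation "w\<nu> W \<equiv> cm\<nu> (wcm W)"

locale w_comonad =
  fixes W :: "('e, 'f, 'o, 'a) wcmd"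
  assumes cloven: "cloven_fibration (wfib W)"
    and comonad: "is_comonad (total_cat (wfib W)) (wcm W)"
    and counit_cartesian: "e \<in> Ob (total_cat (wfib W)) \<Longrightarrow> cartesian (proj (wfib W)) (cpt (w\<epsilon> W) e)"
    and counit_pullback: "\<lbrakk>cartesian (proj (wfib W)) f; f \<in> hom (total_cat (wfib W)) a b\<rbrakk>
          \<Longrightarrow> is_pullback (base_cat (wfib W))
                (Square (far (proj (wfib W)) (cpt (w\<epsilon> W) a)) (far (proj (wfib W)) (cpt (w\<epsilon> W) b))
                        (far (proj (wfib W)) (far (wK W) f)) (far (proj (wfib W)) f))"

record ('e, 'f, 'o, 'a) wmor =
  wsrc :: "('e, 'f, 'o, 'a) wcmd"
  wtgt :: "('e, 'f, 'o, 'a) wcmd"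
  wbase :: "('o, 'a, 'o, 'a) func"
  wtotal :: "('e, 'f, 'e, 'f) func"
  theta :: "('e, 'f, 'e, 'f) nt"

locale lax_comonad_morphism =
  fixes K :: "('e, 'f) comonad" and K' :: "('e, 'f) comonad"
    and H :: "('e, 'f, 'e, 'f) func" and \<theta> :: "('e, 'f, 'e, 'f) nt"
  assumes theta_nt: "\<theta> : H \<circ>\<^sub>F cmK K \<Rightarrow>\<^sub>N cmK K' \<circ>\<^sub>F H"
    and theta_counit: "(cm\<epsilon> K' \<lhd> H) \<bullet>\<^sub>N \<theta> = H \<rhd> cm\<epsilon> K"
    and theta_comult: "(cm\<nu> K' \<lhd> H) \<bullet>\<^sub>N \<theta> = (cmK K' \<rhd> \<theta>) \<bullet>\<^sub>N (\<theta> \<lhd> cmK K) \<bullet>\<^sub>N (H \<rhd> cm\<nu> K)"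

locale lax_w_morphism =
  fixes m :: "('e, 'f, 'o, 'a) wmor"
  assumes src_w_comonad: "w_comonad (wsrc m)"
    and tgt_w_comonad: "w_comonad (wtgt m)"
    and fib_1cell: "fib_1cell (wfib (wsrc m)) (wfib (wtgt m)) (wbase m) (wtotal m)"
    and comonad_morphism: "lax_comonad_morphism (wcm (wsrc m)) (wcm (wtgt m)) (wtotal m) (theta m)"

locale w_2cell =
  fixes t :: "(('e, 'f, 'o, 'a) wmor, 'e, 'f, 'o, 'a) fib2"
  assumes lax_csrc2: "lax_w_morphism (csrc2 t)"
    and lax_ctgt2: "lax_w_morphism (ctgt2 t)"
    and wsrc_eq: "wsrc (ctgt2 t) = wsrc (csrc2 t)"
    and wtgt_eq: "wtgt (ctgt2 t) = wtgt (csrc2 t)"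
    and fib_2cell: "fib_2cell (wfib (wsrc (csrc2 t))) (wfib (wtgt (csrc2 t)))
          (wbase (csrc2 t)) (wtotal (csrc2 t)) (wbase (ctgt2 t)) (wtotal (ctgt2 t))
          (base_nt t) (total_nt t)"
    and theta_compat: "(wK (wtgt (csrc2 t)) \<rhd> total_nt t) \<bullet>\<^sub>N theta (csrc2 t)
          = theta (ctgt2 t) \<bullet>\<^sub>N (total_nt t \<lhd> wK (wsrc (csrc2 t)))"

definition wmor_id :: "('e, 'f, 'o, 'a) wcmd \<Rightarrow> ('e, 'f, 'o, 'a) wmor" where
  "wmor_id W = \<lparr>wsrc = W, wtgt = W, wbase = idf (base_cat (wfib W)),
     wtotal = idf (total_cat (wfib W)), theta = idn (wK W)\<rparr>"

definition wmor_comp :: "('e, 'f, 'o, 'a) wmor \<Rightarrow> ('e, 'f, 'o, 'a) wmor \<Rightarrow>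
    ('e, 'f, 'o, 'a) wmor" where
  "wmor_comp n m = \<lparr>wsrc = wsrc m, wtgt = wtgt n,
     wbase = wbase n \<circ>\<^sub>F wbase m, wtotal = wtotal n \<circ>\<^sub>F wtotal m,
     theta = (theta n \<lhd> wtotal m) \<bullet>\<^sub>N (wtotal n \<rhd> theta m)\<rparr>"

type_synonym ('e, 'f, 'o, 'a) wcmd_2cat =
  "(('e, 'f, 'o, 'a) wcmd, ('e, 'f, 'o, 'a) wmor,
    (('e, 'f, 'o, 'a) wmor, 'e, 'f, 'o, 'a) fib2) twocat"

definition WCmd :: "('e, 'f, 'o, 'a) wcmd_2cat" where
  "WCmd = \<lparr>
     Cell0 = {W. w_comonad W},
     Cell1 = {m. lax_w_morphism m},
     Cell2 = {t. w_2cell t},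
     dom1 = wsrc, cod1 = wtgt, dom2 = csrc2, cod2 = ctgt2,
     id1 = wmor_id,
     id2 = (\<lambda>m. \<lparr>csrc2 = m, ctgt2 = m, base_nt = idn (wbase m), total_nt = idn (wtotal m)\<rparr>),
     cmp1 = wmor_comp, vcmp = fib2_vcmp, hcmp = fib2_hcmp wmor_comp\<rparr>"

definition WCmd_ps :: "('e, 'f, 'o, 'a) wcmd_2cat" where
  "WCmd_ps = wide_2full WCmd (\<lambda>m. nt_invertible (theta m))"


section \<open>The 2-functor X\<close>

definition X_counit :: "('e, 'f, 'o, 'a) compcat \<Rightarrow> 'e \<Rightarrow> 'f" where
  "X_counit Q e = lift (cfib Q) e (fob (chi Q) e)"

definition X_functor :: "('e, 'f, 'o, 'a) compcat \<Rightarrow> ('e, 'f, 'e, 'f) func" where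
  "X_functor Q = (let E = total_cat (cfib Q); K = (\<lambda>e. src E (X_counit Q e)) in
     \<lparr>Dom = E, Cod = E, fob = restrict K (Ob E),
      far = (\<lambda>f\<in>Ar E. THE h. h \<in> hom E (K (src E f)) (K (tgt E f)) \<and>
               far (proj (cfib Q)) h = sq_dom (far (chi Q) f) \<and>
               X_counit Q (tgt E f) \<cdot>\<^bsub>E\<^esub> h = f \<cdot>\<^bsub>E\<^esub> X_counit Q (src E f))\<rparr>)"

text \<open>
  The comultiplication of a w-comonad is determined by the counit: its components are the unique
  arrows satisfying the two counit laws.
\<close>

definition X_comonad :: "('e, 'f, 'o, 'a) compcat \<Rightarrow> ('e, 'f) comonad" where
  "X_comonad Q = (let E = total_cat (cfib Q); K = X_functor Q in
     \<lparr>cmK = K,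
      cm\<epsilon> = \<lparr>nsrc = K, ntgt = idf E, cpt = restrict (X_counit Q) (Ob E)\<rparr>,
      cm\<nu> = \<lparr>nsrc = K, ntgt = K \<circ>\<^sub>F K,
        cpt = (\<lambda>e\<in>Ob E. THE n. n \<in> hom E (fob K e) (fob K (fob K e)) \<and>
                 X_counit Q (fob K e) \<cdot>\<^bsub>E\<^esub> n = ide E (fob K e) \<and>
                 far K (X_counit Q e) \<cdot>\<^bsub>E\<^esub> n = ide E (fob K e))\<rparr>\<rparr>)"

definition X0 :: "('e, 'f, 'o, 'a) compcat \<Rightarrow> ('e, 'f, 'o, 'a) wcmd" where
  "X0 Q = \<lparr>wfib = cfib Q, wcm = X_comonad Q\<rparr>"

definition X1 :: "('e, 'f, 'o, 'a) compmor \<Rightarrow> ('e, 'f, 'o, 'a) wmor" where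
  "X1 m = (let K = X_functor (csrc m); K' = X_functor (ctgt m); H = ctotal m;
               E = total_cat (cfib (csrc m)); E' = total_cat (cfib (ctgt m)) in
     \<lparr>wsrc = X0 (csrc m), wtgt = X0 (ctgt m), wbase = cbase m, wtotal = H,
      theta = \<lparr>nsrc = H \<circ>\<^sub>F K, ntgt = K' \<circ>\<^sub>F H,
        cpt = (\<lambda>e\<in>Ob E. THE h. h \<in> hom E' (fob H (fob K e)) (fob K' (fob H e)) \<and>
                 far (proj (cfib (ctgt m))) h = sq_dom (cpt (zeta m) e) \<and>
                 X_counit (ctgt m) (fob H e) \<cdot>\<^bsub>E'\<^esub> h = far H (X_counit (csrc m) e))\<rparr>\<rparr>)"

definition X2 :: "(('e, 'f, 'o, 'a) compmor, 'e, 'f, 'o, 'a) fib2 \<Rightarrow>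
    (('e, 'f, 'o, 'a) wmor, 'e, 'f, 'o, 'a) fib2" where
  "X2 t = \<lparr>csrc2 = X1 (csrc2 t), ctgt2 = X1 (ctgt2 t),
           base_nt = base_nt t, total_nt = total_nt t\<rparr>"

definition X_2func :: "(('e, 'f, 'o, 'a) compcat, ('e, 'f, 'o, 'a) compmor,
    (('e, 'f, 'o, 'a) compmor, 'e, 'f, 'o, 'a) fib2,
    ('e, 'f, 'o, 'a) wcmd, ('e, 'f, 'o, 'a) wmor,
    (('e, 'f, 'o, 'a) wmor, 'e, 'f, 'o, 'a) fib2) twofunc" where
  "X_2func = \<lparr>on0 = X0, on1 = X1, on2 = X2\<rparr>"


section \<open>The 2-functor Y\<close>

definition Y_chi :: "('e, 'f, 'o, 'a) wcmd \<Rightarrow> ('e, 'f, 'a, 'a square) func" where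
  "Y_chi W = (let p = proj (wfib W); E = total_cat (wfib W); d = (\<lambda>e. far p (cpt (w\<epsilon> W) e)) in
     \<lparr>Dom = E, Cod = arrow_cat (base_cat (wfib W)), fob = restrict d (Ob E),
      far = (\<lambda>f\<in>Ar E. Square (d (src E f)) (d (tgt E f)) (far p (far (wK W) f)) (far p f))\<rparr>)"

definition Y0 :: "('e, 'f, 'o, 'a) wcmd \<Rightarrow> ('e, 'f, 'o, 'a) compcat" where
  "Y0 W = \<lparr>cfib = wfib W, chi = Y_chi W\<rparr>"

text \<open>\<open>\<zeta>\<^sub>e\<close> is the square from \<open>C (p \<epsilon>\<^sub>e)\<close> to \<open>p' \<epsilon>'\<^bsub>H e\<^esub>\<close> with components \<open>p' \<theta>\<^sub>e\<close> and the identity.\<close>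

definition Y1 :: "('e, 'f, 'o, 'a) wmor \<Rightarrow> ('e, 'f, 'o, 'a) compmor" where
  "Y1 m = (let C = wbase m; H = wtotal m; p = proj (wfib (wsrc m)); p' = proj (wfib (wtgt m)) in
     \<lparr>csrc = Y0 (wsrc m), ctgt = Y0 (wtgt m), cbase = C, ctotal = H,
      zeta = \<lparr>nsrc = C\<^bold>\<two> \<circ>\<^sub>F Y_chi (wsrc m), ntgt = Y_chi (wtgt m) \<circ>\<^sub>F H,
        cpt = (\<lambda>e\<in>Ob (total_cat (wfib (wsrc m))).
                 Square (far C (far p (cpt (w\<epsilon> (wsrc m)) e)))
                        (far p' (cpt (w\<epsilon> (wtgt m)) (fob H e)))
                        (far p' (cpt (theta m) e))
                        (ide (base_cat (wfib (wtgt m))) (fob p' (fob H e))))\<rparr>\<rparr>)"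

definition Y2 :: "(('e, 'f, 'o, 'a) wmor, 'e, 'f, 'o, 'a) fib2 \<Rightarrow>
    (('e, 'f, 'o, 'a) compmor, 'e, 'f, 'o, 'a) fib2" where
  "Y2 t = \<lparr>csrc2 = Y1 (csrc2 t), ctgt2 = Y1 (ctgt2 t),
           base_nt = base_nt t, total_nt = total_nt t\<rparr>"

definition Y_2func :: "(('e, 'f, 'o, 'a) wcmd, ('e, 'f, 'o, 'a) wmor,
    (('e, 'f, 'o, 'a) wmor, 'e, 'f, 'o, 'a) fib2,
    ('e, 'f, 'o, 'a) compcat, ('e, 'f, 'o, 'a) compmor,
    (('e, 'f, 'o, 'a) compmor, 'e, 'f, 'o, 'a) fib2) twofunc" where
  "Y_2func = \<lparr>on0 = Y0, on1 = Y1, on2 = Y2\<rparr>"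

end

theory Submission
  imports Defs
begin

text \<open>
  The counit of a w-comonad is cartesian, so \<open>\<theta>\<close> is determined by \<open>p \<theta>\<close>, and a family \<open>\<zeta>\<close>
  lifts uniquely along the counit: \<open>Y\<close> is bijective on the 1-cells and 2-cells between two given
  w-comonads. The naturality square of the counit at itself lies over a pullback, so an arrow into
  \<open>K (K e)\<close> is determined by its composites with \<open>\<epsilon>\<^bsub>K e\<^esub>\<close> and \<open>K \<epsilon>\<^sub>e\<close>; hence every condition on
  comultiplications follows from the counit laws. Since \<open>Y X = Id\<close>, the w-comonads \<open>W\<close> and \<open>X Y W\<close>
  have the same image under \<open>Y\<close>, and the unit at \<open>W\<close> is the 1-cell corresponding to the identity of
  \<open>Y W\<close>. It is invertible, strictly 2-natural and trivial under \<open>Y\<close> and at \<open>X Q\<close>, all of which may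
  be checked after applying \<open>Y\<close>; so both triangle identities hold strictly. Finally \<open>\<theta>\<close> is invertible
  iff \<open>p \<theta>\<close> is, because both legs of the triangle over it are cartesian.
\<close>

section \<open>Categories, functors and transformations\<close>

text \<open>The shape is dictated by the choice of lifts. \<open>X0\<close> takes its counit from
  the cleavage, so the counit of \<open>X0 (Y0 W)\<close> lies over the same base arrows as that of
  \<open>W\<close> but is in general a different one; the composite in this direction can only be
  isomorphic to the identity, and all non-strictness sits in the unit. 1-cells may ignore cleavages
  because \<open>theta\<close> is specified by a universal property of cartesian arrows, not by the
  chosen lifts. Calculations are placed where they are cheapest: a structure cell of
  \<open>CompCat\<close> has an identity as codomain part, so laws there are equations between
  single arrows of a base category, and the laws of \<open>WCmd\<close> are pulled back along
  \<open>Y\<close> instead of being verified upstairs. What both 2-categories share, the underlying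
  fibrations and their transformations, is treated once in \<open>over_Fib\<close>. The pseudo case
  needs no second argument: unit and counit have identity structure cells, \<open>wide_2full\<close>
  changes only carriers, and the comparison 1-cells are pseudo, so the same two transformations
  serve in both statements.\<close>

context category
begin

text \<open>The axioms are phrased with \<open>hom\<close>, whose object arguments a rewriter would
  have to guess. In terms of \<open>Ar\<close>, \<open>src\<close> and \<open>tgt\<close> the same
  laws become rewrite rules that type composites and bracket them to the right.\<close>

lemma ide_Ar: "a \<in> Ob C \<Longrightarrow> ide C a \<in> Ar C"
  and src_ide: "a \<in> Ob C \<Longrightarrow> src C (ide C a) = a"
  and tgt_ide: "a \<in> Ob C \<Longrightarrow> tgt C (ide C a) = a"
  using ide_hom by (auto simp: hom_def)

lemma cmp_Ar: "\<lbrakk>f \<in> Ar C; g \<in> Ar C; src C g = tgt C f\<rbrakk> \<Longrightarrow> g \<cdot> f \<in> Ar C"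
  and src_cmp: "\<lbrakk>f \<in> Ar C; g \<in> Ar C; src C g = tgt C f\<rbrakk> \<Longrightarrow> src C (g \<cdot> f) = src C f"
  and tgt_cmp: "\<lbrakk>f \<in> Ar C; g \<in> Ar C; src C g = tgt C f\<rbrakk> \<Longrightarrow> tgt C (g \<cdot> f) = tgt C g"
  using cmp_hom[of f "src C f" "tgt C f" g "tgt C g"] by (auto simp: hom_def)

lemma ide_left: "\<lbrakk>f \<in> Ar C; tgt C f = b\<rbrakk> \<Longrightarrow> ide C b \<cdot> f = f"
  and ide_right: "\<lbrakk>f \<in> Ar C; src C f = a\<rbrakk> \<Longrightarrow> f \<cdot> ide C a = f"
  using cmp_ide_left cmp_ide_right by (auto simp: hom_def)

lemma assoc: "\<lbrakk>f \<in> Ar C; g \<in> Ar C; h \<in> Ar C; src C g = tgt C f; src C h = tgt C g\<rbrakk>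
    \<Longrightarrow> (h \<cdot> g) \<cdot> f = h \<cdot> (g \<cdot> f)"
  using cmp_assoc[of f "src C f" "tgt C f" g "tgt C g" h "tgt C h"] by (auto simp: hom_def)

lemma hom_Ob: "f \<in> hom C a b \<Longrightarrow> a \<in> Ob C" "f \<in> hom C a b \<Longrightarrow> b \<in> Ob C"
  using src_closed tgt_closed by (auto simp: hom_def)

lemmas chase = ide_Ar src_ide tgt_ide cmp_Ar src_cmp tgt_cmp ide_left ide_right assoc
  src_closed tgt_closed

end

section \<open>Functors typed by their domain and codomain\<close>

lemma hom_self: "f \<in> Ar C \<Longrightarrow> f \<in> hom C (src C f) (tgt C f)"
  by (simp add: hom_def)

text \<open>A functor record stores its own domain and codomain. Naming them in a judgement lets
  composability be tracked by variables, while the record selectors are rewritten away.\<close>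

definition functor_betw ::
    "('o, 'a, 'p, 'b) func \<Rightarrow> ('o, 'a) cat \<Rightarrow> ('p, 'b) cat \<Rightarrow> bool"
    ("(_ : _ \<rightarrow>\<^sub>F _)" [51, 51, 51] 50) where
  "(F : C \<rightarrow>\<^sub>F D) \<longleftrightarrow> is_functor F \<and> Dom F = C \<and> Cod F = D"

lemma functor_betwD:
  assumes "F : C \<rightarrow>\<^sub>F D"
  shows "is_functor F" "Dom F = C" "Cod F = D" "category C" "category D"
    "fob F \<in> extensional (Ob C)" "far F \<in> extensional (Ar C)"
  using assms is_functor.category_Dom[of F] is_functor.category_Cod[of F]
    is_functor.fob_closed[of F] is_functor.far_ext[of F]
  by (auto simp: functor_betw_def PiE_def)

lemma fob_Ob: "\<lbrakk>F : C \<rightarrow>\<^sub>F D; a \<in> Ob C\<rbrakk> \<Longrightarrow> fob F a \<in> Ob D"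
  using is_functor.fob_closed[of F] by (auto simp: functor_betw_def)

lemma far_hom: "\<lbrakk>F : C \<rightarrow>\<^sub>F D; f \<in> hom C a b\<rbrakk> \<Longrightarrow> far F f \<in> hom D (fob F a) (fob F b)"
  using is_functor.far_hom[of F] by (auto simp: functor_betw_def)

lemma far_ide: "\<lbrakk>F : C \<rightarrow>\<^sub>F D; a \<in> Ob C\<rbrakk> \<Longrightarrow> far F (ide C a) = ide D (fob F a)"
  using is_functor.far_ide[of F] by (auto simp: functor_betw_def)

lemma far_cmp: "\<lbrakk>F : C \<rightarrow>\<^sub>F D; f \<in> Ar C; g \<in> Ar C; src C g = tgt C f\<rbrakk>
    \<Longrightarrow> far F (g \<cdot>\<^bsub>C\<^esub> f) = far F g \<cdot>\<^bsub>D\<^esub> far F f"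
  using is_functor.far_cmp[of F f "src C f" "tgt C f" g "tgt C g"]
  by (auto simp: functor_betw_def hom_def)

lemma far_Ar: "\<lbrakk>F : C \<rightarrow>\<^sub>F D; f \<in> Ar C\<rbrakk> \<Longrightarrow> far F f \<in> Ar D"
  and src_far: "\<lbrakk>F : C \<rightarrow>\<^sub>F D; f \<in> Ar C\<rbrakk> \<Longrightarrow> src D (far F f) = fob F (src C f)"
  and tgt_far: "\<lbrakk>F : C \<rightarrow>\<^sub>F D; f \<in> Ar C\<rbrakk> \<Longrightarrow> tgt D (far F f) = fob F (tgt C f)"
  using far_hom[of F C D f "src C f" "tgt C f"] by (auto simp: hom_def)

lemmas functor_chase = far_Ar src_far tgt_far far_ide far_cmp fob_Ob

lemma functor_betwI:
  assumes "category C" "category D" "Dom F = C" "Cod F = D"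
    and "fob F \<in> extensional (Ob C)" "far F \<in> extensional (Ar C)"
    and "\<And>a. a \<in> Ob C \<Longrightarrow> fob F a \<in> Ob D"
    and "\<And>f a b. \<lbrakk>f \<in> hom C a b; a \<in> Ob C; b \<in> Ob C\<rbrakk> \<Longrightarrow> far F f \<in> hom D (fob F a) (fob F b)"
    and "\<And>a. a \<in> Ob C \<Longrightarrow> far F (ide C a) = ide D (fob F a)"
    and "\<And>f g a b c. \<lbrakk>f \<in> hom C a b; g \<in> hom C b c; a \<in> Ob C; b \<in> Ob C; c \<in> Ob C\<rbrakk>
      \<Longrightarrow> far F (g \<cdot>\<^bsub>C\<^esub> f) = far F g \<cdot>\<^bsub>D\<^esub> far F f"
  shows "F : C \<rightarrow>\<^sub>F D"
proof -
  interpret category C by fact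
  show ?thesis unfolding functor_betw_def
    by (intro conjI is_functor.intro) (use assms hom_Ob in \<open>auto simp: PiE_def\<close>)
qed

text \<open>The records contain total functions; \<open>extensional\<close> settles their values
  outside the carriers, so agreement on objects and arrows gives equality of records.\<close>

lemma functor_eqI:
  assumes "F : C \<rightarrow>\<^sub>F D" "G : C \<rightarrow>\<^sub>F D"
    and "\<And>a. a \<in> Ob C \<Longrightarrow> fob F a = fob G a" "\<And>f. f \<in> Ar C \<Longrightarrow> far F f = far G f"
  shows "F = G"
  using functor_betwD[OF assms(1)] functor_betwD[OF assms(2)] assms(3,4)
  by (auto intro!: func.equality extensionalityI)

lemma idf_simps [simp]: "Dom (idf C) = C" "Cod (idf C) = C"
    "a \<in> Ob C \<Longrightarrow> fob (idf C) a = a" "f \<in> Ar C \<Longrightarrow> far (idf C) f = f"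
  by (simp_all add: idf_def)

lemma fcomp_simps [simp]: "Dom (G \<circ>\<^sub>F F) = Dom F" "Cod (G \<circ>\<^sub>F F) = Cod G"
    "a \<in> Ob (Dom F) \<Longrightarrow> fob (G \<circ>\<^sub>F F) a = fob G (fob F a)"
    "f \<in> Ar (Dom F) \<Longrightarrow> far (G \<circ>\<^sub>F F) f = far G (far F f)"
  by (simp_all add: fcomp_def compose_def)

lemma idf_betw:
  assumes "category C" shows "idf C : C \<rightarrow>\<^sub>F C"
proof -
  interpret category C by fact
  show ?thesis
    by (rule functor_betwI) (auto simp: hom_def chase assms idf_def)
qed

lemma fcomp_betw:
  assumes F: "F : C \<rightarrow>\<^sub>F D" and G: "G : D \<rightarrow>\<^sub>F E"
  shows "G \<circ>\<^sub>F F : C \<rightarrow>\<^sub>F E"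
proof -
  note [simp] = functor_betwD[OF F] functor_betwD[OF G]
  interpret C: category C by simp
  show ?thesis
    by (rule functor_betwI)
      (auto simp: hom_def fcomp_def compose_def functor_chase[OF F] functor_chase[OF G] C.chase)
qed

lemma fcomp_assoc:
  assumes F: "F : C \<rightarrow>\<^sub>F D" and G: "G : D \<rightarrow>\<^sub>F E"
  shows "(H \<circ>\<^sub>F G) \<circ>\<^sub>F F = H \<circ>\<^sub>F (G \<circ>\<^sub>F F)"
  using functor_betwD[OF F] functor_betwD[OF G] fob_Ob[OF F] far_Ar[OF F]
  by (auto simp: fcomp_def compose_def fun_eq_iff)

lemma fcomp_idf_left: "F : C \<rightarrow>\<^sub>F D \<Longrightarrow> idf D \<circ>\<^sub>F F = F"
  by (rule functor_eqI[OF fcomp_betw[OF _ idf_betw]]) (auto simp: functor_betwD functor_chase)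

lemma fcomp_idf_right: "F : C \<rightarrow>\<^sub>F D \<Longrightarrow> F \<circ>\<^sub>F idf C = F"
  by (rule functor_eqI[OF fcomp_betw[OF idf_betw]]) (auto simp: functor_betwD functor_chase)

section \<open>Natural transformations, vertical composition and whiskering\<close>

lemma nt_betwD:
  assumes "\<alpha> : F \<Rightarrow>\<^sub>N G"
  shows "nsrc \<alpha> = F" "ntgt \<alpha> = G" "nat_trans \<alpha>"
  using assms by (auto simp: nat_trans_from_to_def)

lemma nt_tgt_betw: "\<lbrakk>\<alpha> : F \<Rightarrow>\<^sub>N G; F : C \<rightarrow>\<^sub>F D\<rbrakk> \<Longrightarrow> G : C \<rightarrow>\<^sub>F D"
  using nat_trans.functor_nsrc[of \<alpha>] nat_trans.functor_ntgt[of \<alpha>] nat_trans.Dom_eq[of \<alpha>]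
    nat_trans.Cod_eq[of \<alpha>]
  by (auto simp: nat_trans_from_to_def functor_betw_def)

lemma cpt_ext: "\<lbrakk>\<alpha> : F \<Rightarrow>\<^sub>N G; F : C \<rightarrow>\<^sub>F D\<rbrakk> \<Longrightarrow> cpt \<alpha> \<in> extensional (Ob C)"
  using nat_trans.cpt_ext[of \<alpha>] by (auto simp: nat_trans_from_to_def functor_betw_def)

lemma cpt_hom: "\<lbrakk>\<alpha> : F \<Rightarrow>\<^sub>N G; F : C \<rightarrow>\<^sub>F D; a \<in> Ob C\<rbrakk> \<Longrightarrow> cpt \<alpha> a \<in> hom D (fob F a) (fob G a)"
  using nat_trans.cpt_hom[of \<alpha>] by (auto simp: nat_trans_from_to_def functor_betw_def)

lemma naturality: "\<lbrakk>\<alpha> : F \<Rightarrow>\<^sub>N G; F : C \<rightarrow>\<^sub>F D; f \<in> hom C a b\<rbrakk>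
    \<Longrightarrow> far G f \<cdot>\<^bsub>D\<^esub> cpt \<alpha> a = cpt \<alpha> b \<cdot>\<^bsub>D\<^esub> far F f"
  using nat_trans.naturality[of \<alpha>] by (auto simp: nat_trans_from_to_def functor_betw_def)

lemma cpt_Ar: "\<lbrakk>\<alpha> : F \<Rightarrow>\<^sub>N G; F : C \<rightarrow>\<^sub>F D; a \<in> Ob C\<rbrakk> \<Longrightarrow> cpt \<alpha> a \<in> Ar D"
  and src_cpt: "\<lbrakk>\<alpha> : F \<Rightarrow>\<^sub>N G; F : C \<rightarrow>\<^sub>F D; a \<in> Ob C\<rbrakk> \<Longrightarrow> src D (cpt \<alpha> a) = fob F a"
  and tgt_cpt: "\<lbrakk>\<alpha> : F \<Rightarrow>\<^sub>N G; F : C \<rightarrow>\<^sub>F D; a \<in> Ob C\<rbrakk> \<Longrightarrow> tgt D (cpt \<alpha> a) = fob G a"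
  using cpt_hom[of \<alpha> F G C D a] by (auto simp: hom_def)

lemmas cpt_chase = cpt_Ar src_cpt tgt_cpt

lemma nt_betwI:
  assumes "F : C \<rightarrow>\<^sub>F D" "G : C \<rightarrow>\<^sub>F D" "nsrc \<alpha> = F" "ntgt \<alpha> = G" "cpt \<alpha> \<in> extensional (Ob C)"
    and "\<And>a. a \<in> Ob C \<Longrightarrow> cpt \<alpha> a \<in> hom D (fob F a) (fob G a)"
    and "\<And>f a b. \<lbrakk>f \<in> hom C a b; a \<in> Ob C; b \<in> Ob C\<rbrakk>
      \<Longrightarrow> far G f \<cdot>\<^bsub>D\<^esub> cpt \<alpha> a = cpt \<alpha> b \<cdot>\<^bsub>D\<^esub> far F f"
  shows "\<alpha> : F \<Rightarrow>\<^sub>N G"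
proof -
  note [simp] = functor_betwD[OF assms(1)] functor_betwD[OF assms(2)]
  interpret category C by simp
  show ?thesis unfolding nat_trans_from_to_def
    by (intro conjI nat_trans.intro) (use assms hom_Ob in auto)
qed

lemma nt_eqI:
  fixes \<alpha> \<beta> :: "('o, 'a, 'p, 'b) nt"
  assumes "nsrc \<alpha> = nsrc \<beta>" "ntgt \<alpha> = ntgt \<beta>"
    "cpt \<alpha> \<in> extensional S" "cpt \<beta> \<in> extensional S" "\<And>a. a \<in> S \<Longrightarrow> cpt \<alpha> a = cpt \<beta> a"
  shows "\<alpha> = \<beta>"
  using assms by (auto intro!: nt.equality extensionalityI)

lemma idn_simps [simp]: "nsrc (idn F) = F" "ntgt (idn F) = F"
    "a \<in> Ob (Dom F) \<Longrightarrow> cpt (idn F) a = ide (Cod F) (fob F a)"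
    "cpt (idn F) \<in> extensional (Ob (Dom F))"
  by (simp_all add: idn_def)

lemma vcomp_simps [simp]: "nsrc (\<beta> \<bullet>\<^sub>N \<alpha>) = nsrc \<alpha>" "ntgt (\<beta> \<bullet>\<^sub>N \<alpha>) = ntgt \<beta>"
    "a \<in> Ob (Dom (nsrc \<alpha>)) \<Longrightarrow> cpt (\<beta> \<bullet>\<^sub>N \<alpha>) a = cpt \<beta> a \<cdot>\<^bsub>Cod (nsrc \<alpha>)\<^esub> cpt \<alpha> a"
    "cpt (\<beta> \<bullet>\<^sub>N \<alpha>) \<in> extensional (Ob (Dom (nsrc \<alpha>)))"
  by (simp_all add: vcomp_def)

lemma whisk_left_simps [simp]: "nsrc (G \<rhd> \<alpha>) = G \<circ>\<^sub>F nsrc \<alpha>" "ntgt (G \<rhd> \<alpha>) = G \<circ>\<^sub>F ntgt \<alpha>"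
    "a \<in> Ob (Dom (nsrc \<alpha>)) \<Longrightarrow> cpt (G \<rhd> \<alpha>) a = far G (cpt \<alpha> a)"
    "cpt (G \<rhd> \<alpha>) \<in> extensional (Ob (Dom (nsrc \<alpha>)))"
  by (simp_all add: whisk_left_def)

lemma whisk_right_simps [simp]: "nsrc (\<alpha> \<lhd> F) = nsrc \<alpha> \<circ>\<^sub>F F" "ntgt (\<alpha> \<lhd> F) = ntgt \<alpha> \<circ>\<^sub>F F"
    "a \<in> Ob (Dom F) \<Longrightarrow> cpt (\<alpha> \<lhd> F) a = cpt \<alpha> (fob F a)"
    "cpt (\<alpha> \<lhd> F) \<in> extensional (Ob (Dom F))"
  by (simp_all add: whisk_right_def)

lemma idn_betw:
  assumes F: "F : C \<rightarrow>\<^sub>F D" shows "idn F : F \<Rightarrow>\<^sub>N F"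
proof -
  note [simp] = functor_betwD[OF F]
  interpret D: category D by simp
  show ?thesis
    by (rule nt_betwI[OF F F]) (auto simp: idn_def hom_def functor_chase[OF F] D.chase)
qed

lemma vcomp_betw:
  assumes F: "F : C \<rightarrow>\<^sub>F D" and a: "\<alpha> : F \<Rightarrow>\<^sub>N G" and b: "\<beta> : G \<Rightarrow>\<^sub>N H"
  shows "\<beta> \<bullet>\<^sub>N \<alpha> : F \<Rightarrow>\<^sub>N H"
proof -
  note G = nt_tgt_betw[OF a F]
  note H = nt_tgt_betw[OF b G]
  note [simp] = functor_betwD[OF F] functor_betwD[OF G] functor_betwD[OF H] nt_betwD[OF a] nt_betwD[OF b]
  interpret C: category C by simp
  interpret D: category D by simp
  show ?thesis
  proof (rule nt_betwI[OF F H]; (simp add: vcomp_def; fail)?)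
    fix x assume "x \<in> Ob C"
    then show "cpt (\<beta> \<bullet>\<^sub>N \<alpha>) x \<in> hom D (fob F x) (fob H x)"
      by (auto intro: D.cmp_hom cpt_hom[OF a F] cpt_hom[OF b G])
  next
    fix f x y assume *: "f \<in> hom C x y" "x \<in> Ob C" "y \<in> Ob C"
    then have "f \<in> Ar C" "src C f = x" "tgt C f = y" by (auto simp: hom_def)
    then show "far H f \<cdot>\<^bsub>D\<^esub> cpt (\<beta> \<bullet>\<^sub>N \<alpha>) x = cpt (\<beta> \<bullet>\<^sub>N \<alpha>) y \<cdot>\<^bsub>D\<^esub> far F f"
      using naturality[OF a F *(1)] naturality[OF b G *(1)] *(2,3)
        D.assoc[of "cpt \<alpha> x" "cpt \<beta> x" "far H f"] D.assoc[of "cpt \<alpha> x" "far G f" "cpt \<beta> y"]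
      by (simp add: D.chase functor_chase[OF F] functor_chase[OF G] functor_chase[OF H]
          cpt_chase[OF a F] cpt_chase[OF b G])
  qed
qed

lemma whisk_left_betw:
  assumes F: "F : C \<rightarrow>\<^sub>F D" and K: "K : D \<rightarrow>\<^sub>F E" and a: "\<alpha> : F \<Rightarrow>\<^sub>N G"
  shows "K \<rhd> \<alpha> : K \<circ>\<^sub>F F \<Rightarrow>\<^sub>N K \<circ>\<^sub>F G"
proof -
  note G = nt_tgt_betw[OF a F]
  note [simp] = functor_betwD[OF F] functor_betwD[OF G] functor_betwD[OF K] nt_betwD[OF a]
  show ?thesis
  proof (rule nt_betwI[OF fcomp_betw[OF F K] fcomp_betw[OF G K]]; (simp add: whisk_left_def; fail)?)
    fix x assume "x \<in> Ob C"
    then show "cpt (K \<rhd> \<alpha>) x \<in> hom E (fob (K \<circ>\<^sub>F F) x) (fob (K \<circ>\<^sub>F G) x)"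
      by (auto intro: far_hom[OF K] cpt_hom[OF a F])
  next
    fix f x y assume *: "f \<in> hom C x y" "x \<in> Ob C" "y \<in> Ob C"
    then have "f \<in> Ar C" "src C f = x" "tgt C f = y" by (auto simp: hom_def)
    then show "far (K \<circ>\<^sub>F G) f \<cdot>\<^bsub>E\<^esub> cpt (K \<rhd> \<alpha>) x = cpt (K \<rhd> \<alpha>) y \<cdot>\<^bsub>E\<^esub> far (K \<circ>\<^sub>F F) f"
      using *(2,3) arg_cong[OF naturality[OF a F *(1)], of "far K"]
      by (simp add: functor_chase[OF F] functor_chase[OF G] functor_chase[OF K] cpt_chase[OF a F])
  qed
qed

lemma whisk_right_betw:
  assumes F: "F : C \<rightarrow>\<^sub>F D" and J: "J : B \<rightarrow>\<^sub>F C" and a: "\<alpha> : F \<Rightarrow>\<^sub>N G"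
  shows "\<alpha> \<lhd> J : F \<circ>\<^sub>F J \<Rightarrow>\<^sub>N G \<circ>\<^sub>F J"
proof -
  note G = nt_tgt_betw[OF a F]
  note [simp] = functor_betwD[OF F] functor_betwD[OF G] functor_betwD[OF J] nt_betwD[OF a]
  show ?thesis
  proof (rule nt_betwI[OF fcomp_betw[OF J F] fcomp_betw[OF J G]]; (simp add: whisk_right_def; fail)?)
    fix x assume "x \<in> Ob B"
    then show "cpt (\<alpha> \<lhd> J) x \<in> hom D (fob (F \<circ>\<^sub>F J) x) (fob (G \<circ>\<^sub>F J) x)"
      by (auto intro: cpt_hom[OF a F] simp: functor_chase[OF J])
  next
    fix f x y assume *: "f \<in> hom B x y" "x \<in> Ob B" "y \<in> Ob B"
    then have "f \<in> Ar B" "src B f = x" "tgt B f = y" by (auto simp: hom_def)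
    then show "far (G \<circ>\<^sub>F J) f \<cdot>\<^bsub>D\<^esub> cpt (\<alpha> \<lhd> J) x = cpt (\<alpha> \<lhd> J) y \<cdot>\<^bsub>D\<^esub> far (F \<circ>\<^sub>F J) f"
      using *(2,3) naturality[OF a F far_hom[OF J *(1)]] by simp
  qed
qed

lemma vcomp_idn_left: "\<lbrakk>F : C \<rightarrow>\<^sub>F D; \<alpha> : F \<Rightarrow>\<^sub>N G\<rbrakk> \<Longrightarrow> idn G \<bullet>\<^sub>N \<alpha> = \<alpha>"
  using functor_betwD[of F C D] functor_betwD[OF nt_tgt_betw, of \<alpha> F G C D]
  by (intro nt_eqI[where S = "Ob C"])
    (auto simp: nt_betwD cpt_chase category.ide_left cpt_ext functor_chase vcomp_def)

lemma vcomp_idn_right: "\<lbrakk>F : C \<rightarrow>\<^sub>F D; \<alpha> : F \<Rightarrow>\<^sub>N G\<rbrakk> \<Longrightarrow> \<alpha> \<bullet>\<^sub>N idn F = \<alpha>"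
  using functor_betwD[of F C D] functor_betwD[OF nt_tgt_betw, of \<alpha> F G C D]
  by (intro nt_eqI[where S = "Ob C"])
    (auto simp: nt_betwD cpt_chase category.ide_right cpt_ext functor_chase vcomp_def)

lemma vcomp_assoc:
  assumes F: "F : C \<rightarrow>\<^sub>F D" and a: "\<alpha> : F \<Rightarrow>\<^sub>N G" and b: "\<beta> : G \<Rightarrow>\<^sub>N H" and c: "\<gamma> : H \<Rightarrow>\<^sub>N K"
  shows "(\<gamma> \<bullet>\<^sub>N \<beta>) \<bullet>\<^sub>N \<alpha> = \<gamma> \<bullet>\<^sub>N (\<beta> \<bullet>\<^sub>N \<alpha>)"
proof -
  note G = nt_tgt_betw[OF a F]
  note H = nt_tgt_betw[OF b G]
  note [simp] = functor_betwD[OF F] functor_betwD[OF G] functor_betwD[OF H]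
     nt_betwD[OF a] nt_betwD[OF b] nt_betwD[OF c]
  interpret D: category D by simp
  show ?thesis
    by (rule nt_eqI[where S = "Ob C"])
      (auto simp: vcomp_def D.assoc cpt_chase[OF a F] cpt_chase[OF b G] cpt_chase[OF c H])
qed

section \<open>Horizontal composition and interchange\<close>

lemma hcomp_simps [simp]: "nsrc (\<beta> \<star>\<^sub>N \<alpha>) = nsrc \<beta> \<circ>\<^sub>F nsrc \<alpha>" "ntgt (\<beta> \<star>\<^sub>N \<alpha>) = ntgt \<beta> \<circ>\<^sub>F ntgt \<alpha>"
  by (simp_all add: hcomp_def)

lemma hcomp_cpt:
  assumes F: "F : C \<rightarrow>\<^sub>F D" and F': "F' : D \<rightarrow>\<^sub>F E" and a: "\<alpha> : F \<Rightarrow>\<^sub>N G" and b: "\<beta> : F' \<Rightarrow>\<^sub>N G'"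
    and x: "x \<in> Ob C"
  shows "cpt (\<beta> \<star>\<^sub>N \<alpha>) x = cpt \<beta> (fob G x) \<cdot>\<^bsub>E\<^esub> far F' (cpt \<alpha> x)"
proof -
  note G = nt_tgt_betw[OF a F]
  note [simp] = functor_betwD[OF F] functor_betwD[OF G] functor_betwD[OF F'] nt_betwD[OF a]
    nt_betwD[OF b]
  show ?thesis using x by (simp add: hcomp_def)
qed

lemma hcomp_betw:
  assumes F: "F : C \<rightarrow>\<^sub>F D" and F': "F' : D \<rightarrow>\<^sub>F E" and a: "\<alpha> : F \<Rightarrow>\<^sub>N G" and b: "\<beta> : F' \<Rightarrow>\<^sub>N G'"
  shows "\<beta> \<star>\<^sub>N \<alpha> : F' \<circ>\<^sub>F F \<Rightarrow>\<^sub>N G' \<circ>\<^sub>F G"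
proof -
  note G = nt_tgt_betw[OF a F]
  show ?thesis unfolding hcomp_def nt_betwD[OF a] nt_betwD[OF b]
    by (rule vcomp_betw[OF fcomp_betw[OF F F'] whisk_left_betw[OF F F' a] whisk_right_betw[OF F' G b]])
qed

lemma hcomp_ext:
  assumes "nsrc \<alpha> : C \<rightarrow>\<^sub>F D"
  shows "cpt (\<beta> \<star>\<^sub>N \<alpha>) \<in> extensional (Ob C)"
  using functor_betwD[OF assms] by (simp add: hcomp_def vcomp_def)

lemma hcomp_idn:
  assumes F: "F : C \<rightarrow>\<^sub>F D" and F': "F' : D \<rightarrow>\<^sub>F E"
  shows "idn F' \<star>\<^sub>N idn F = idn (F' \<circ>\<^sub>F F)"
proof -
  note [simp] = functor_betwD[OF F] functor_betwD[OF F']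
  interpret E: category E by simp
  show ?thesis
  proof (rule nt_eqI[where S = "Ob C"])
    show "cpt (idn F' \<star>\<^sub>N idn F) \<in> extensional (Ob C)" using hcomp_ext[of "idn F" C D] F by simp
    show "cpt (idn (F' \<circ>\<^sub>F F)) \<in> extensional (Ob C)" by (simp add: idn_def)
  qed (auto simp: hcomp_cpt[OF F F' idn_betw[OF F] idn_betw[OF F']] functor_chase[OF F]
      functor_chase[OF F'] E.chase)
qed

lemma hcomp_idf_left:
  assumes F: "F : C \<rightarrow>\<^sub>F D" and a: "\<alpha> : F \<Rightarrow>\<^sub>N G"
  shows "idn (idf D) \<star>\<^sub>N \<alpha> = \<alpha>"
proof -
  note G = nt_tgt_betw[OF a F]
  note [simp] = functor_betwD[OF F] functor_betwD[OF G]  nt_betwD[OF a]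
  note I = idf_betw[of D, simplified]
  interpret D: category D by simp
  show ?thesis
  proof (rule nt_eqI[where S = "Ob C"])
    show "cpt (idn (idf D) \<star>\<^sub>N \<alpha>) \<in> extensional (Ob C)" using hcomp_ext[of \<alpha> C D] F by simp
    show "cpt \<alpha> \<in> extensional (Ob C)" by (rule cpt_ext[OF a F])
  qed (auto simp: fcomp_idf_left[OF F] fcomp_idf_left[OF G] hcomp_cpt[OF F I a idn_betw[OF I]]
      cpt_chase[OF a F]
     functor_chase[OF F] functor_chase[OF G] D.chase)
qed

lemma hcomp_idf_right:
  assumes F: "F : C \<rightarrow>\<^sub>F D" and a: "\<alpha> : F \<Rightarrow>\<^sub>N G"
  shows "\<alpha> \<star>\<^sub>N idn (idf C) = \<alpha>"
proof -
  note G = nt_tgt_betw[OF a F]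
  note [simp] = functor_betwD[OF F] functor_betwD[OF G]  nt_betwD[OF a]
  note I = idf_betw[of C, simplified]
  interpret C: category C by simp
  interpret D: category D by simp
  show ?thesis
  proof (rule nt_eqI[where S = "Ob C"])
    show "cpt (\<alpha> \<star>\<^sub>N idn (idf C)) \<in> extensional (Ob C)" using hcomp_ext[of "idn (idf C)" C C] I by simp
    show "cpt \<alpha> \<in> extensional (Ob C)" by (rule cpt_ext[OF a F])
  qed (auto simp: fcomp_idf_right[OF F] fcomp_idf_right[OF G] hcomp_cpt[OF I F idn_betw[OF I] a]
      cpt_chase[OF a F]
     functor_chase[OF F] functor_chase[OF G] C.chase D.chase)
qed

lemma hcomp_assoc:
  assumes F: "F : B \<rightarrow>\<^sub>F C" and F': "F' : C \<rightarrow>\<^sub>F D" and F'': "F'' : D \<rightarrow>\<^sub>F E"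
    and a: "\<alpha> : F \<Rightarrow>\<^sub>N G" and b: "\<beta> : F' \<Rightarrow>\<^sub>N G'" and c: "\<gamma> : F'' \<Rightarrow>\<^sub>N G''"
  shows "(\<gamma> \<star>\<^sub>N \<beta>) \<star>\<^sub>N \<alpha> = \<gamma> \<star>\<^sub>N (\<beta> \<star>\<^sub>N \<alpha>)"
proof -
  note G = nt_tgt_betw[OF a F]
  note G' = nt_tgt_betw[OF b F']
  note G'' = nt_tgt_betw[OF c F'']
  note [simp] = functor_betwD[OF F] functor_betwD[OF F'] functor_betwD[OF F'']
    functor_betwD[OF G] functor_betwD[OF G'] functor_betwD[OF G''] nt_betwD[OF a] nt_betwD[OF b]
        nt_betwD[OF c]
  interpret E: category E by simp
  note ab = hcomp_betw[OF F F' a b]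
  note bc = hcomp_betw[OF F' F'' b c]
  show ?thesis
  proof (rule nt_eqI[where S = "Ob B"])
    show "cpt ((\<gamma> \<star>\<^sub>N \<beta>) \<star>\<^sub>N \<alpha>) \<in> extensional (Ob B)" using hcomp_ext[of \<alpha> B C] F by simp
    show "cpt (\<gamma> \<star>\<^sub>N (\<beta> \<star>\<^sub>N \<alpha>)) \<in> extensional (Ob B)"
      using hcomp_ext[of "\<beta> \<star>\<^sub>N \<alpha>" B D] fcomp_betw[OF F F'] by simp
    show "nsrc ((\<gamma> \<star>\<^sub>N \<beta>) \<star>\<^sub>N \<alpha>) = nsrc (\<gamma> \<star>\<^sub>N (\<beta> \<star>\<^sub>N \<alpha>))"
      by (simp add: fcomp_assoc[OF F F'])
    show "ntgt ((\<gamma> \<star>\<^sub>N \<beta>) \<star>\<^sub>N \<alpha>) = ntgt (\<gamma> \<star>\<^sub>N (\<beta> \<star>\<^sub>N \<alpha>))"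
      by (simp add: fcomp_assoc[OF G G'])
  qed (simp add: hcomp_cpt[OF F fcomp_betw[OF F' F''] a bc] hcomp_cpt[OF fcomp_betw[OF F F'] F'' ab c]
     hcomp_cpt[OF F F' a b] hcomp_cpt[OF F' F'' b c] functor_chase[OF F] functor_chase[OF G]
         functor_chase[OF F']
     functor_chase[OF G'] functor_chase[OF F''] cpt_chase[OF a F] cpt_chase[OF b F'] cpt_chase[OF c F'']
         E.assoc)
qed

lemma hcomp_interchange:
  assumes F: "F : C \<rightarrow>\<^sub>F D" and F': "F' : D \<rightarrow>\<^sub>F E"
    and a: "\<alpha> : F \<Rightarrow>\<^sub>N G" and b: "\<beta> : G \<Rightarrow>\<^sub>N H" and a': "\<alpha>' : F' \<Rightarrow>\<^sub>N G'" and b': "\<beta>' : G' \<Rightarrow>\<^sub>N H'"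
  shows "(\<beta>' \<bullet>\<^sub>N \<alpha>') \<star>\<^sub>N (\<beta> \<bullet>\<^sub>N \<alpha>) = (\<beta>' \<star>\<^sub>N \<beta>) \<bullet>\<^sub>N (\<alpha>' \<star>\<^sub>N \<alpha>)"
proof -
  note G = nt_tgt_betw[OF a F]
  note H = nt_tgt_betw[OF b G]
  note G' = nt_tgt_betw[OF a' F']
  note H' = nt_tgt_betw[OF b' G']
  note [simp] = functor_betwD[OF F] functor_betwD[OF F'] functor_betwD[OF H] functor_betwD[OF H']
    functor_betwD[OF G] functor_betwD[OF G'] nt_betwD[OF a] nt_betwD[OF b] nt_betwD[OF a']
        nt_betwD[OF b']
  interpret D: category D by simp
  interpret E: category E by simp
  note ba = vcomp_betw[OF F a b]
  note ba' = vcomp_betw[OF F' a' b']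
  note aa = hcomp_betw[OF F F' a a']
  show ?thesis
  proof (rule nt_eqI[where S = "Ob C"])
    show "cpt ((\<beta>' \<bullet>\<^sub>N \<alpha>') \<star>\<^sub>N (\<beta> \<bullet>\<^sub>N \<alpha>)) \<in> extensional (Ob C)" using hcomp_ext[of "\<beta> \<bullet>\<^sub>N \<alpha>" C D] F by simp
    show "cpt ((\<beta>' \<star>\<^sub>N \<beta>) \<bullet>\<^sub>N (\<alpha>' \<star>\<^sub>N \<alpha>)) \<in> extensional (Ob C)" by (simp add: vcomp_def)
    fix x assume x: "x \<in> Ob C"
    let ?H = "fob H x"
    \<comment> \<open>Only this naturality square of \<open>\<alpha>'\<close>, taken at the
      component of \<open>\<beta>\<close>, is not formal; it exchanges the two middle
      factors.\<close>
    have n: "far G' (cpt \<beta> x) \<cdot>\<^bsub>E\<^esub> cpt \<alpha>' (fob G x) = cpt \<alpha>' (fob H x) \<cdot>\<^bsub>E\<^esub> far F' (cpt \<beta> x)"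
      by (rule naturality[OF a' F' cpt_hom[OF b G x]])
    have "cpt \<alpha>' (fob H x) \<cdot>\<^bsub>E\<^esub> (far F' (cpt \<beta> x) \<cdot>\<^bsub>E\<^esub> far F' (cpt \<alpha> x))
       = far G' (cpt \<beta> x) \<cdot>\<^bsub>E\<^esub> (cpt \<alpha>' (fob G x) \<cdot>\<^bsub>E\<^esub> far F' (cpt \<alpha> x))"
      using x n E.assoc[of "far F' (cpt \<alpha> x)" "far F' (cpt \<beta> x)" "cpt \<alpha>' (fob H x)"]
        E.assoc[of "far F' (cpt \<alpha> x)" "cpt \<alpha>' (fob G x)" "far G' (cpt \<beta> x)"]
      by (simp add: functor_chase[OF F] functor_chase[OF G] functor_chase[OF H] functor_chase[OF F']
     functor_chase[OF G'] cpt_chase[OF a F] cpt_chase[OF b G] cpt_chase[OF a' F'] cpt_chase[OF b' G'])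
    then show "cpt ((\<beta>' \<bullet>\<^sub>N \<alpha>') \<star>\<^sub>N (\<beta> \<bullet>\<^sub>N \<alpha>)) x = cpt ((\<beta>' \<star>\<^sub>N \<beta>) \<bullet>\<^sub>N (\<alpha>' \<star>\<^sub>N \<alpha>)) x"
      using x by (simp add: hcomp_cpt[OF F F' ba ba'] hcomp_cpt[OF F F' a a'] hcomp_cpt[OF G G' b b']
        functor_chase[OF F] functor_chase[OF G] functor_chase[OF H] functor_chase[OF F'] E.chase
     functor_chase[OF G'] cpt_chase[OF a F] cpt_chase[OF b G] cpt_chase[OF a' F'] cpt_chase[OF b' G'])
  qed auto
qed

section \<open>Isomorphisms and pointwise invertibility\<close>

definition is_iso :: "('o, 'a) cat \<Rightarrow> 'a \<Rightarrow> bool" where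
  "is_iso C f \<longleftrightarrow> f \<in> Ar C \<and> (\<exists>g\<in>hom C (tgt C f) (src C f).
     g \<cdot>\<^bsub>C\<^esub> f = ide C (src C f) \<and> f \<cdot>\<^bsub>C\<^esub> g = ide C (tgt C f))"

text \<open>Pointwise inverses are automatically natural: conjugating the naturality square of
  \<open>\<alpha>\<close> with them gives theirs. Invertibility of structure cells can therefore be
  tested one component at a time.\<close>

lemma nt_invertible_iff:
  assumes F: "F : C \<rightarrow>\<^sub>F D" and a: "\<alpha> : F \<Rightarrow>\<^sub>N G"
  shows "nt_invertible \<alpha> \<longleftrightarrow> (\<forall>x\<in>Ob C. is_iso D (cpt \<alpha> x))"
proof
  note G = nt_tgt_betw[OF a F]
  note [simp] = functor_betwD[OF F] functor_betwD[OF G] nt_betwD[OF a]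
  {
    assume "nt_invertible \<alpha>"
    then obtain \<beta> where b: "\<beta> : G \<Rightarrow>\<^sub>N F" and *: "\<beta> \<bullet>\<^sub>N \<alpha> = idn F" "\<alpha> \<bullet>\<^sub>N \<beta> = idn G"
      by (auto simp: nt_invertible_def)
    show "\<forall>x\<in>Ob C. is_iso D (cpt \<alpha> x)"
    proof
      fix x assume x: "x \<in> Ob C"
      have "cpt (\<beta> \<bullet>\<^sub>N \<alpha>) x = cpt (idn F) x" "cpt (\<alpha> \<bullet>\<^sub>N \<beta>) x = cpt (idn G) x" using * by simp_all
      then show "is_iso D (cpt \<alpha> x)" unfolding is_iso_def
        using x cpt_hom[OF b G x] by (auto simp: nt_betwD[OF b] cpt_chase[OF a F])
    qed
  next
    interpret C: category C by simp
    interpret D: category D by simp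
    assume "\<forall>x\<in>Ob C. is_iso D (cpt \<alpha> x)"
    then have "\<forall>x\<in>Ob C. \<exists>g\<in>hom D (fob G x) (fob F x).
      g \<cdot>\<^bsub>D\<^esub> cpt \<alpha> x = ide D (fob F x) \<and> cpt \<alpha> x \<cdot>\<^bsub>D\<^esub> g = ide D (fob G x)"
      by (auto simp: is_iso_def cpt_chase[OF a F])
    then obtain b where b: "\<And>x. x \<in> Ob C \<Longrightarrow> b x \<in> hom D (fob G x) (fob F x) \<and>
      b x \<cdot>\<^bsub>D\<^esub> cpt \<alpha> x = ide D (fob F x) \<and> cpt \<alpha> x \<cdot>\<^bsub>D\<^esub> b x = ide D (fob G x)"
      by metis
    define \<beta> where "\<beta> = \<lparr>nsrc = G, ntgt = F, cpt = restrict b (Ob C)\<rparr>"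
    have bb: "b x \<in> Ar D" "src D (b x) = fob G x" "tgt D (b x) = fob F x" if "x \<in> Ob C" for x
      using b[OF that] by (auto simp: hom_def)
    have "\<beta> : G \<Rightarrow>\<^sub>N F"
    proof (rule nt_betwI[OF G F])
      fix f x y assume f: "f \<in> hom C x y" and x: "x \<in> Ob C" and y: "y \<in> Ob C"
      then have f': "f \<in> Ar C" "src C f = x" "tgt C f = y" by (auto simp: hom_def)
      note * = functor_chase[OF F] functor_chase[OF G] cpt_chase[OF a F] f' x y bb
      \<comment> \<open>Insert the identity \<open>b y \<cdot> cpt \<alpha> y\<close>, use
        naturality of \<open>\<alpha>\<close> in the middle, and cancel
        \<open>cpt \<alpha> x\<close> against \<open>b x\<close>.\<close>
      have "far F f \<cdot>\<^bsub>D\<^esub> b x = (b y \<cdot>\<^bsub>D\<^esub> cpt \<alpha> y) \<cdot>\<^bsub>D\<^esub> far F f \<cdot>\<^bsub>D\<^esub> b x"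
        using b[OF y] by (simp add: * D.chase)
      also have "\<dots> = b y \<cdot>\<^bsub>D\<^esub> (cpt \<alpha> y \<cdot>\<^bsub>D\<^esub> far F f) \<cdot>\<^bsub>D\<^esub> b x"
        by (simp add: * D.chase)
      also have "\<dots> = b y \<cdot>\<^bsub>D\<^esub> (far G f \<cdot>\<^bsub>D\<^esub> cpt \<alpha> x) \<cdot>\<^bsub>D\<^esub> b x"
        by (simp add: naturality[OF a F f])
      also have "\<dots> = b y \<cdot>\<^bsub>D\<^esub> far G f \<cdot>\<^bsub>D\<^esub> (cpt \<alpha> x \<cdot>\<^bsub>D\<^esub> b x)"
        by (simp add: * D.chase)
      also have "\<dots> = b y \<cdot>\<^bsub>D\<^esub> far G f"
        using b[OF x] by (simp add: * D.chase)
      finally show "far F f \<cdot>\<^bsub>D\<^esub> cpt \<beta> x = cpt \<beta> y \<cdot>\<^bsub>D\<^esub> far G f"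
        using x y by (simp add: \<beta>_def)
    qed (use b in \<open>auto simp: \<beta>_def\<close>)
    moreover have "\<beta> \<bullet>\<^sub>N \<alpha> = idn F" "\<alpha> \<bullet>\<^sub>N \<beta> = idn G"
      using b by (auto simp: \<beta>_def vcomp_def idn_def fun_eq_iff)
    ultimately show "nt_invertible \<alpha>"
      unfolding nt_invertible_def by auto
  }
qed

lemma is_iso_ide: "\<lbrakk>category C; a \<in> Ob C\<rbrakk> \<Longrightarrow> is_iso C (ide C a)"
  by (auto simp: is_iso_def hom_def category.chase intro!: bexI[of _ "ide C a"])

lemma is_iso_cmp:
  fixes C (structure)
  assumes "category C" "is_iso C f" "is_iso C g" "src C g = tgt C f"
  shows "is_iso C (g \<cdot> f)"
proof -
  interpret category C by fact
  obtain f' where f': "f' \<in> Ar C" "src C f' = tgt C f" "tgt C f' = src C f"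
      "f' \<cdot> f = ide C (src C f)" "f \<cdot> f' = ide C (tgt C f)" and f: "f \<in> Ar C"
    using assms(2) by (auto simp: is_iso_def hom_def)
  obtain g' where g': "g' \<in> Ar C" "src C g' = tgt C g" "tgt C g' = src C g"
      "g' \<cdot> g = ide C (src C g)" "g \<cdot> g' = ide C (tgt C g)" and g: "g \<in> Ar C"
    using assms(3) by (auto simp: is_iso_def hom_def)
  note [simp] = f f' g g' assms(4) chase
  \<comment> \<open>The cancellation laws of \<open>g\<close> are withheld here so that rewriting
    only rebrackets; the next line applies them.\<close>
  have "(f' \<cdot> g') \<cdot> (g \<cdot> f) = f' \<cdot> (g' \<cdot> g) \<cdot> f"
    by (simp del: g'(4,5))
  then have 1: "(f' \<cdot> g') \<cdot> (g \<cdot> f) = ide C (src C f)" by simp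
  have "(g \<cdot> f) \<cdot> (f' \<cdot> g') = g \<cdot> (f \<cdot> f') \<cdot> g'"
    by (simp del: f'(4,5))
  then have 2: "(g \<cdot> f) \<cdot> (f' \<cdot> g') = ide C (tgt C g)" by (simp del: assms(4) add: assms(4)[symmetric])
  show ?thesis unfolding is_iso_def
    by (intro conjI bexI[of _ "f' \<cdot> g'"]) (use 1 2 in \<open>simp_all add: hom_def\<close>)
qed

lemma is_iso_far:
  assumes F: "F : C \<rightarrow>\<^sub>F D" and f: "is_iso C f"
  shows "is_iso D (far F f)"
proof -
  interpret C: category C using functor_betwD[OF F] by simp
  obtain f' where f': "f' \<in> Ar C" "src C f' = tgt C f" "tgt C f' = src C f"
      "f' \<cdot>\<^bsub>C\<^esub> f = ide C (src C f)" "f \<cdot>\<^bsub>C\<^esub> f' = ide C (tgt C f)" and f: "f \<in> Ar C"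
    using f by (auto simp: is_iso_def hom_def)
  have "far F (f' \<cdot>\<^bsub>C\<^esub> f) = far F (ide C (src C f))" "far F (f \<cdot>\<^bsub>C\<^esub> f') = far F (ide C (tgt C f))"
    using f' by simp_all
  then show ?thesis unfolding is_iso_def
    by (intro conjI bexI[of _ "far F f'"])
      (simp_all add: hom_def f f'(1-3) functor_chase[OF F] C.src_closed C.tgt_closed)
qed

section \<open>Cells of fibrations\<close>

lemma proj_betw: "is_functor (proj P) \<Longrightarrow> proj P : total_cat P \<rightarrow>\<^sub>F base_cat P"
  by (simp add: functor_betw_def)

lemma fib_1cellD:
  assumes "fib_1cell P P' B H"
  shows "B : base_cat P \<rightarrow>\<^sub>F base_cat P'" "H : total_cat P \<rightarrow>\<^sub>F total_cat P'"
    "proj P' \<circ>\<^sub>F H = B \<circ>\<^sub>F proj P"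
    "e \<in> Ob (total_cat P) \<Longrightarrow> fob (proj P') (fob H e) = fob B (fob (proj P) e)"
    "f \<in> Ar (total_cat P) \<Longrightarrow> far (proj P') (far H f) = far B (far (proj P) f)"
    "cartesian (proj P) g \<Longrightarrow> cartesian (proj P') (far H g)"
proof -
  show *: "B : base_cat P \<rightarrow>\<^sub>F base_cat P'" "H : total_cat P \<rightarrow>\<^sub>F total_cat P'"
    "proj P' \<circ>\<^sub>F H = B \<circ>\<^sub>F proj P" "cartesian (proj P) g \<Longrightarrow> cartesian (proj P') (far H g)"
    using assms by (simp_all add: fib_1cell_def functor_betw_def)
  note [simp] = functor_betwD[OF *(2)]
  show "e \<in> Ob (total_cat P) \<Longrightarrow> fob (proj P') (fob H e) = fob B (fob (proj P) e)"
    "f \<in> Ar (total_cat P) \<Longrightarrow> far (proj P') (far H f) = far B (far (proj P) f)"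
    using arg_cong[OF *(3), of "\<lambda>F. fob F e"] arg_cong[OF *(3), of "\<lambda>F. far F f"]
    by (simp_all)
qed

lemma fib_1cell_id:
  assumes "is_functor (proj P)"
  shows "fib_1cell P P (idf (base_cat P)) (idf (total_cat P))"
proof -
  note p = proj_betw[OF assms]
  note [simp] = functor_betwD(4,5)[OF p]
  show ?thesis unfolding fib_1cell_def
    using fcomp_idf_left[OF p] fcomp_idf_right[OF p] idf_betw[of "base_cat P"] idf_betw[of "total_cat P"]
    by (auto simp: functor_betw_def) (auto simp: cartesian_def)
qed

lemma fib_1cell_comp:
  assumes m: "fib_1cell P P' B H" and n: "fib_1cell P' P'' B' H'"
    and p: "is_functor (proj P)" and p': "is_functor (proj P')"
  shows "fib_1cell P P'' (B' \<circ>\<^sub>F B) (H' \<circ>\<^sub>F H)"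
proof -
  note m' = fib_1cellD[OF m]
  note n' = fib_1cellD[OF n]
  have "proj P'' \<circ>\<^sub>F (H' \<circ>\<^sub>F H) = (proj P'' \<circ>\<^sub>F H') \<circ>\<^sub>F H"
    by (rule fcomp_assoc[OF m'(2) n'(2), symmetric])
  also have "\<dots> = B' \<circ>\<^sub>F proj P' \<circ>\<^sub>F H"
    unfolding n'(3) by (rule fcomp_assoc[OF m'(2) proj_betw[OF p']])
  also have "\<dots> = (B' \<circ>\<^sub>F B) \<circ>\<^sub>F proj P"
    unfolding m'(3) by (rule fcomp_assoc[OF proj_betw[OF p] m'(1), symmetric])
  finally show ?thesis
    using fcomp_betw[OF m'(1) n'(1)] fcomp_betw[OF m'(2) n'(2)] m'(6) n'(6) functor_betwD[OF m'(2)]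
    by (auto simp: fib_1cell_def functor_betw_def cartesian_def)
qed

text \<open>The two whiskerings have equal boundaries because 1-cells of \<open>Fib\<close> commute
  with the projections, so the equation between them concerns components only.\<close>

lemma fib_2cell_iff:
  assumes p: "is_functor (proj P)"
    and m: "fib_1cell P P' B H" and n: "fib_1cell P P' C K"
  shows "fib_2cell P P' B H C K \<psi> \<phi> \<longleftrightarrow> (\<psi> : B \<Rightarrow>\<^sub>N C) \<and> (\<phi> : H \<Rightarrow>\<^sub>N K) \<and>
    (\<forall>e\<in>Ob (total_cat P). far (proj P') (cpt \<phi> e) = cpt \<psi> (fob (proj P) e))"
proof -
  note m' = fib_1cellD[OF m]
  note n' = fib_1cellD[OF n]
  note [simp] = functor_betwD[OF m'(1)] functor_betwD[OF m'(2)]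
  have "proj P' \<rhd> \<phi> = \<psi> \<lhd> proj P \<longleftrightarrow>
     (\<forall>e\<in>Ob (total_cat P). far (proj P') (cpt \<phi> e) = cpt \<psi> (fob (proj P) e))"
    if psi: "\<psi> : B \<Rightarrow>\<^sub>N C" and phi: "\<phi> : H \<Rightarrow>\<^sub>N K"
  proof
    note [simp] = nt_betwD[OF psi] nt_betwD[OF phi]
    show "\<forall>e\<in>Ob (total_cat P). far (proj P') (cpt \<phi> e) = cpt \<psi> (fob (proj P) e)"
      if "proj P' \<rhd> \<phi> = \<psi> \<lhd> proj P"
    proof
      fix e assume "e \<in> Ob (total_cat P)"
      then show "far (proj P') (cpt \<phi> e) = cpt \<psi> (fob (proj P) e)"
        using arg_cong[OF that, of "\<lambda>\<alpha>. cpt \<alpha> e"] by simp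
    qed
    show "proj P' \<rhd> \<phi> = \<psi> \<lhd> proj P"
      if "\<forall>e\<in>Ob (total_cat P). far (proj P') (cpt \<phi> e) = cpt \<psi> (fob (proj P) e)"
      using that by (intro nt_eqI[where S = "Ob (total_cat P)"])
        (auto simp: whisk_left_def whisk_right_def m'(3) n'(3))
  qed
  then show ?thesis unfolding fib_2cell_def by blast
qed

lemma fib_2cell_id:
  assumes p: "is_functor (proj P)" and p': "is_functor (proj P')" and m: "fib_1cell P P' B H"
  shows "fib_2cell P P' B H B H (idn B) (idn H)"
proof -
  note m' = fib_1cellD[OF m] and p = proj_betw[OF p] and p' = proj_betw[OF p']
  note [simp] = functor_betwD[OF m'(1)] functor_betwD[OF m'(2)]
  show ?thesis
    by (simp add: fib_2cell_iff[OF assms(1) m m] idn_betw[OF m'(1)] idn_betw[OF m'(2)]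
      functor_chase[OF p'] functor_chase[OF p] functor_chase[OF m'(2)] m'(4))
qed

lemma fib_2cell_vcomp:
  assumes p: "is_functor (proj P)" and p': "is_functor (proj P')"
    and m: "fib_1cell P P' B H" and n: "fib_1cell P P' B\<^sub>1 H\<^sub>1" and k: "fib_1cell P P' B\<^sub>2 H\<^sub>2"
    and s: "fib_2cell P P' B H B\<^sub>1 H\<^sub>1 \<psi> \<phi>" and t: "fib_2cell P P' B\<^sub>1 H\<^sub>1 B\<^sub>2 H\<^sub>2 \<psi>' \<phi>'"
  shows "fib_2cell P P' B H B\<^sub>2 H\<^sub>2 (\<psi>' \<bullet>\<^sub>N \<psi>) (\<phi>' \<bullet>\<^sub>N \<phi>)"
proof -
  note p1 = proj_betw[OF p] and p2 = proj_betw[OF p']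
  note m' = fib_1cellD[OF m] and n' = fib_1cellD[OF n]
  note s' = s[unfolded fib_2cell_iff[OF p m n]] and t' = t[unfolded fib_2cell_iff[OF p n k]]
  have s1: "\<psi> : B \<Rightarrow>\<^sub>N B\<^sub>1" and s2: "\<phi> : H \<Rightarrow>\<^sub>N H\<^sub>1" and t1: "\<psi>' : B\<^sub>1 \<Rightarrow>\<^sub>N B\<^sub>2" and t2: "\<phi>' : H\<^sub>1 \<Rightarrow>\<^sub>N H\<^sub>2"
    using s' t' by auto
  note [simp] = functor_betwD[OF m'(1)] functor_betwD[OF m'(2)] nt_betwD[OF s1] nt_betwD[OF s2]
  show ?thesis unfolding fib_2cell_iff[OF p m k]
    using s' t' by (auto simp: vcomp_betw[OF m'(1) s1 t1] vcomp_betw[OF m'(2) s2 t2]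
       functor_chase[OF p1] functor_chase[OF p2] cpt_chase[OF s2 m'(2)] cpt_chase[OF t2 n'(2)])
qed

lemma fib_2cell_hcomp:
  assumes p: "is_functor (proj P)" and p': "is_functor (proj P')" and p'': "is_functor (proj P'')"
    and m: "fib_1cell P P' B H" and n: "fib_1cell P P' B\<^sub>1 H\<^sub>1"
    and m': "fib_1cell P' P'' B' H'" and n': "fib_1cell P' P'' B\<^sub>1' H\<^sub>1'"
    and s: "fib_2cell P P' B H B\<^sub>1 H\<^sub>1 \<psi> \<phi>" and t: "fib_2cell P' P'' B' H' B\<^sub>1' H\<^sub>1' \<psi>' \<phi>'"
  shows "fib_2cell P P'' (B' \<circ>\<^sub>F B) (H' \<circ>\<^sub>F H) (B\<^sub>1' \<circ>\<^sub>F B\<^sub>1) (H\<^sub>1' \<circ>\<^sub>F H\<^sub>1) (\<psi>' \<star>\<^sub>N \<psi>) (\<phi>' \<star>\<^sub>N \<phi>)"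
proof -
  note p1 = proj_betw[OF p] and p2 = proj_betw[OF p'] and p3 = proj_betw[OF p'']
  note M = fib_1cellD[OF m] and N = fib_1cellD[OF n] and M' = fib_1cellD[OF m']
    and N' = fib_1cellD[OF n']
  note s' = s[unfolded fib_2cell_iff[OF p m n]] and t' = t[unfolded fib_2cell_iff[OF p' m' n']]
  have s1: "\<psi> : B \<Rightarrow>\<^sub>N B\<^sub>1" and s2: "\<phi> : H \<Rightarrow>\<^sub>N H\<^sub>1" and t1: "\<psi>' : B' \<Rightarrow>\<^sub>N B\<^sub>1'" and t2: "\<phi>' : H' \<Rightarrow>\<^sub>N H\<^sub>1'"
    using s' t' by auto
  note [simp] = functor_betwD[OF M(1)] functor_betwD[OF M(2)] nt_betwD[OF s1] nt_betwD[OF s2]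
  show ?thesis unfolding fib_2cell_iff[OF p fib_1cell_comp[OF m m' p p'] fib_1cell_comp[OF n n' p p']]
    using s' t' by (auto simp: hcomp_betw[OF M(1) M'(1) s1 t1] hcomp_betw[OF M(2) M'(2) s2 t2]
       hcomp_cpt[OF M(1) M'(1) s1 t1] hcomp_cpt[OF M(2) M'(2) s2 t2] M(4,5) M'(4,5) N(4,5) N'(4,5)
       functor_chase[OF p1] functor_chase[OF p2] functor_chase[OF p3] functor_chase[OF M(2)]
           functor_chase[OF M'(2)]
       functor_chase[OF N(2)] cpt_chase[OF s2 M(2)] cpt_chase[OF t2 M'(2)])
qed


section \<open>2-categories\<close>

lemma cells1I: "\<lbrakk>f \<in> Cell1 C; dom1 C f = a; cod1 C f = b\<rbrakk> \<Longrightarrow> f \<in> cells1 C a b"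
  and cells1D: "f \<in> cells1 C a b \<Longrightarrow> f \<in> Cell1 C" "f \<in> cells1 C a b \<Longrightarrow> dom1 C f = a"
    "f \<in> cells1 C a b \<Longrightarrow> cod1 C f = b"
  by (simp_all add: cells1_def)

lemma cells2D: "\<alpha> \<in> cells2 C f g \<Longrightarrow> \<alpha> \<in> Cell2 C" "\<alpha> \<in> cells2 C f g \<Longrightarrow> dom2 C \<alpha> = f"
    "\<alpha> \<in> cells2 C f g \<Longrightarrow> cod2 C \<alpha> = g"
  by (simp_all add: cells2_def)

context two_category
begin

lemma cells2_par:
  assumes "f \<in> cells1 C a b" "\<alpha> \<in> cells2 C f g"
  shows "g \<in> cells1 C a b"
  using assms cod2_closed[of \<alpha>] dom2_dom1[of \<alpha>] dom2_cod1[of \<alpha>] by (auto simp: cells1_def cells2_def)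

lemma cells1_Cell0:
  assumes "f \<in> cells1 C a b" shows "a \<in> Cell0 C" "b \<in> Cell0 C"
  using assms dom1_closed cod1_closed by (auto simp: cells1_def)

lemma invertible2_id2: "f \<in> Cell1 C \<Longrightarrow> invertible2 C (id2 C f)"
  using id2_cell[of f] vcmp_id_left[of "id2 C f" f f]
  by (auto simp: invertible2_def cells2_def)

text \<open>Identity 2-cells witness both conditions. The components of the unit and the counit are
  equivalences in this strict sense.\<close>

lemma equivalence1I:
  assumes "f \<in> cells1 C a b" "g \<in> cells1 C b a" "g \<odot> f = id1 C a" "f \<odot> g = id1 C b"
  shows "equivalence1 C f"
proof -
  have "id1 C a \<in> cells1 C a a" "id1 C b \<in> cells1 C b b"
    using assms cells1_Cell0 id1_cell by auto
  then have *: "id2 C (id1 C a) \<in> cells2 C (id1 C a) (id1 C a)" "invertible2 C (id2 C (id1 C a))"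
    "id2 C (id1 C b) \<in> cells2 C (id1 C b) (id1 C b)" "invertible2 C (id2 C (id1 C b))"
    using id2_cell invertible2_id2 by (auto dest: cells1D)
  show ?thesis unfolding equivalence1_def cells1D(2,3)[OF assms(1)]
    using cells1D(1)[OF assms(1)] assms(2) * assms(3,4)
    by (intro conjI bexI[of _ g] bexI[of _ "id2 C (id1 C a)"] bexI[of _ "id2 C (id1 C b)"]) simp_all
qed

end

lemma wide_2full_simps [simp]:
  "Cell0 (wide_2full C S) = Cell0 C" "dom1 (wide_2full C S) = dom1 C" "cod1 (wide_2full C S) = cod1 C"
  "dom2 (wide_2full C S) = dom2 C" "cod2 (wide_2full C S) = cod2 C" "id1 (wide_2full C S) = id1 C"
  "id2 (wide_2full C S) = id2 C" "cmp1 (wide_2full C S) = cmp1 C" "vcmp (wide_2full C S) = vcmp C"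
  "hcmp (wide_2full C S) = hcmp C"
  "\<alpha> \<in> Cell2 (wide_2full C S) \<longleftrightarrow> \<alpha> \<in> Cell2 C \<and> S (dom2 C \<alpha>) \<and> S (cod2 C \<alpha>)"
  "f \<in> Cell1 (wide_2full C S) \<longleftrightarrow> f \<in> Cell1 C \<and> S f"
  "f \<in> cells1 (wide_2full C S) a b \<longleftrightarrow> f \<in> cells1 C a b \<and> S f"
  "\<alpha> \<in> cells2 (wide_2full C S) f g \<longleftrightarrow> \<alpha> \<in> cells2 C f g \<and> S f \<and> S g"
  by (auto simp: wide_2full_def cells1_def cells2_def)

text \<open>Lets statements about wide 2-full sub-2-categories cover the unrestricted case as
  well.\<close>

lemma wide_2full_True: "wide_2full C (\<lambda>_. True) = C"
  by (simp add: wide_2full_def)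

text \<open>By 2-fullness the laws of 2-cells are inherited outright; what can fail is only closure
  of the retained 1-cells.\<close>

lemma two_category_wide_2full:
  assumes "two_category C"
    and id1: "\<And>a. a \<in> Cell0 C \<Longrightarrow> S (id1 C a)"
    and cmp1: "\<And>f g a b c. \<lbrakk>f \<in> cells1 C a b; g \<in> cells1 C b c; S f; S g\<rbrakk> \<Longrightarrow> S (g \<odot>\<^bsub>C\<^esub> f)"
  shows "two_category (wide_2full C S)"
proof -
  interpret two_category C by fact
  show ?thesis
  proof (rule two_category.intro, goal_cases)
    case (13 \<alpha> f g \<beta> h) then show ?case using vcmp_cell by auto
  next
    \<comment> \<open>The target composite must satisfy \<open>S\<close> too;
      \<open>cells2_par\<close> types the target 1-cells so that \<open>cmp1\<close> applies to
      them.\<close>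
    case (17 f a b f' c \<alpha> g \<beta> g')
    then show ?case using hcmp_cell cells2_par cmp1 by simp metis
  next
    case (20 f a b f' c f'' d \<alpha> g \<beta> g' \<gamma> g'')
    then show ?case using hcmp_assoc[of f a b f' c f'' d \<alpha> g \<beta> g' \<gamma> g''] by simp
  next
    case (22 f a b f' c \<alpha> g \<beta> h \<alpha>' g' \<beta>' h')
    then show ?case using interchange[of f a b f' c \<alpha> g \<beta> h \<alpha>' g' \<beta>' h'] by simp
  qed (auto intro: dom1_closed cod1_closed id1_cell id1 cmp1_cell cmp1 cmp1_id_left cmp1_id_right
      cmp1_assoc
    dom2_closed cod2_closed dom2_dom1 dom2_cod1 id2_cell vcmp_id_left vcmp_id_right vcmp_assoc
    hcmp_id_left hcmp_id_right hcmp_id2)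
qed

lemma two_functor_wide_2full:
  assumes "two_functor C D F" "two_category (wide_2full C S)" "two_category (wide_2full D T)"
    and S: "\<And>f. \<lbrakk>f \<in> Cell1 C; S f\<rbrakk> \<Longrightarrow> T (on1 F f)"
  shows "two_functor (wide_2full C S) (wide_2full D T) F"
proof -
  interpret two_functor C D F by fact
  interpret C: two_category C by (rule two_category_dom)
  show ?thesis
  proof (rule two_functor.intro, goal_cases)
    case (5 \<alpha> f g)
    then show ?case using on2_cell[of \<alpha> f g] S[of f] S[of g] C.dom2_closed[of \<alpha>] C.cod2_closed[of \<alpha>]
      by (auto dest: cells2D)
  qed (use assms(2,3) on0_cell on1_cell S on1_id1 on1_cmp1 on2_id2 on2_vcmp on2_hcmp in \<open>auto dest:
      cells1D\<close>)
qed

section \<open>Identity and composite 2-functors\<close>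

lemma two_functor_id:
  assumes "two_category C" shows "two_functor C C id_2func"
  by (rule two_functor.intro) (use assms in \<open>auto simp: id_2func_def\<close>)

lemma two_functor_comp:
  assumes "two_functor C D F" "two_functor D E G"
  shows "two_functor C E (G \<circ>\<^sub>2 F)"
proof -
  interpret F: two_functor C D F by fact
  interpret G: two_functor D E G by fact
  show ?thesis
  proof (rule two_functor.intro, goal_cases)
    case (6 a) then show ?case by (simp add: comp_2func_def F.on1_id1 G.on1_id1 F.on0_cell)
  next
    case (7 f a b g c) then show ?case
      using F.on1_cell[of f a b] F.on1_cell[of g b c] by (simp add: comp_2func_def F.on1_cmp1 G.on1_cmp1)
  next
    case (8 f) then show ?case
      using F.on1_cell[of f "dom1 C f" "cod1 C f"]
        by (simp add: comp_2func_def F.on2_id2 G.on2_id2 cells1_def)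
  next
    case (9 \<alpha> f g \<beta> h) then show ?case
      using F.on2_cell[of \<alpha> f g] F.on2_cell[of \<beta> g h] by (simp add: comp_2func_def F.on2_vcmp G.on2_vcmp)
  next
    case (10 f a b f' c \<alpha> g \<beta> g') then show ?case
      using F.on2_cell[of \<alpha> f g] F.on2_cell[of \<beta> f' g'] F.on1_cell[of f a b] F.on1_cell[of f' b c]
      by (simp add: comp_2func_def F.on2_hcmp[of f a b f' c \<alpha> g \<beta> g']
         G.on2_hcmp[of "on1 F f" "on0 F a" "on0 F b" "on1 F f'" "on0 F c" "on2 F \<alpha>" "on1 F g" "on2 F \<beta>"
             "on1 F g'"])
  qed (use F.two_category_dom G.two_category_cod F.on0_cell G.on0_cell F.on1_cell G.on1_cell F.on2_cell
      G.on2_cell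
     in \<open>auto simp: comp_2func_def\<close>)
qed

text \<open>The structure cells are identities, written on the source side of the naturality square.
  The categories enter only through \<open>dom1\<close>, \<open>id2\<close> and \<open>cmp1\<close>,
  which \<open>wide_2full\<close> leaves unchanged, so one record serves on all 1-cells and on the
  pseudo ones.\<close>

definition strict_pn :: "('o, 'm, 't) twocat \<Rightarrow> ('p, 'n, 'u) twocat \<Rightarrow>
    ('o, 'm, 't, 'p, 'n, 'u) twofunc \<Rightarrow> ('o \<Rightarrow> 'n) \<Rightarrow> ('o, 'm, 'n, 'u) pseudonat" where
  "strict_pn C D G s = \<lparr>pn0 = s, pn1 = (\<lambda>f. id2 D (on1 G f \<odot>\<^bsub>D\<^esub> s (dom1 C f)))\<rparr>"

text \<open>With identity structure cells, well-typedness amounts to \<open>nat1\<close> and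
  naturality in 2-cells to \<open>nat2\<close>; the unit and composition axioms only say that
  certain identity 2-cells sit on the same 1-cell.\<close>

lemma pseudo_nat_strict:
  assumes F: "two_functor C D F" and G: "two_functor C D G"
    and s: "\<And>a. a \<in> Cell0 C \<Longrightarrow> s a \<in> cells1 D (on0 F a) (on0 G a)"
    and nat1: "\<And>f a b. f \<in> cells1 C a b \<Longrightarrow> on1 G f \<odot>\<^bsub>D\<^esub> s a = s b \<odot>\<^bsub>D\<^esub> on1 F f"
    and nat2: "\<And>f g a b \<alpha>. \<lbrakk>f \<in> cells1 C a b; \<alpha> \<in> cells2 C f g\<rbrakk>
       \<Longrightarrow> on2 G \<alpha> \<star>\<^bsub>D\<^esub> id2 D (s a) = id2 D (s b) \<star>\<^bsub>D\<^esub> on2 F \<alpha>"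
  shows "pseudo_nat C D F G (strict_pn C D G s)"
proof -
  interpret F: two_functor C D F by fact
  interpret G: two_functor C D G by fact
  interpret C: two_category C by (rule F.two_category_dom)
  interpret D: two_category D by (rule F.two_category_cod)
  have Gs: "on1 G f \<odot>\<^bsub>D\<^esub> s a \<in> cells1 D (on0 F a) (on0 G b)" if "f \<in> cells1 C a b" for f a b
    using s C.cells1_Cell0[OF that] G.on1_cell[OF that] D.cmp1_cell by blast
  show ?thesis
  proof (rule pseudo_nat.intro[OF F G], goal_cases)
    case (1 a) then show ?case by (simp add: strict_pn_def s)
  next
    case (2 f a b) then show ?case
      using D.id2_cell[of "on1 G f \<odot>\<^bsub>D\<^esub> s a"] Gs[OF 2] cells1D[OF 2] nat1[OF 2]
        by (simp add: strict_pn_def cells1_def)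
  next
    case (3 f)
    then show ?case using Gs[OF cells1I[OF 3 refl refl]]
      by (simp add: strict_pn_def D.invertible2_id2 cells1_def)
  next
    case (4 f a b \<alpha> g)
    note * = cells1D[OF 4(1)] C.cells2_par[OF 4] C.cells1_Cell0[OF 4(1)]
    have sa: "s a \<in> cells1 D (on0 F a) (on0 G a)" using s * by simp
    have "on2 G \<alpha> \<star>\<^bsub>D\<^esub> id2 D (s a) \<in> cells2 D (on1 G f \<odot>\<^bsub>D\<^esub> s a) (on1 G g \<odot>\<^bsub>D\<^esub> s a)"
      by (rule D.hcmp_cell[OF sa G.on1_cell[OF 4(1)] D.id2_cell[OF cells1D(1)[OF sa]] G.on2_cell[OF
        4(2)]])
    then show ?case using * cells1D[OF *(4)] nat2[OF 4]
      by (simp add: strict_pn_def D.vcmp_id_left D.vcmp_id_right)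
  next
    case (5 a)
    then show ?case using cells1D[OF C.id1_cell[OF 5]] s[OF 5]
      by (simp add: strict_pn_def G.on1_id1 D.cmp1_id_left)
  next
    case (6 f a b g c)
    note f = cells1D[OF 6(1)] C.cells1_Cell0[OF 6(1)] and g = cells1D[OF 6(2)]
    note gf = cells1D[OF C.cmp1_cell[OF 6]]
    note Gg = G.on1_cell[OF 6(2)] and Gf = G.on1_cell[OF 6(1)] and Ff = F.on1_cell[OF 6(1)]
    note Gsf = Gs[OF 6(1)] and Gsg = Gs[OF 6(2)]
    have sa: "s a \<in> cells1 D (on0 F a) (on0 G a)" using s f by simp
    \<comment> \<open>Both whiskered structure cells are identities; \<open>e\<close> and
      \<open>e'\<close> show that they sit on the same 1-cell, so that their vertical composite is
      an identity again.\<close>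
    have e: "on1 G g \<odot>\<^bsub>D\<^esub> (on1 G f \<odot>\<^bsub>D\<^esub> s a) = on1 G (g \<odot>\<^bsub>C\<^esub> f) \<odot>\<^bsub>D\<^esub> s a"
      using D.cmp1_assoc[OF sa Gf Gg] by (simp add: G.on1_cmp1[OF 6])
    have e': "(on1 G g \<odot>\<^bsub>D\<^esub> s b) \<odot>\<^bsub>D\<^esub> on1 F f = on1 G (g \<odot>\<^bsub>C\<^esub> f) \<odot>\<^bsub>D\<^esub> s a"
      using D.cmp1_assoc[OF Ff s Gg] f nat1[OF 6(1)] e by simp
    show ?case
      using f g gf D.hcmp_id2[OF Gsf Gg] D.hcmp_id2[OF Ff Gsg]
        D.vcmp_id_left[OF D.id2_cell[OF cells1D(1)[OF D.cmp1_cell[OF Gsf Gg]]]]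
      by (simp add: strict_pn_def e e')
  qed
qed

text \<open>Records of transformations carry arbitrary values off the cells, so two descriptions of
  one transformation need not be equal as records; the axioms see only the cells.\<close>

lemma pseudo_nat_cong:
  assumes "pseudo_nat C D F G \<tau>"
    and "\<And>a. a \<in> Cell0 C \<Longrightarrow> pn0 \<sigma> a = pn0 \<tau> a" "\<And>f. f \<in> Cell1 C \<Longrightarrow> pn1 \<sigma> f = pn1 \<tau> f"
  shows "pseudo_nat C D F G \<sigma>"
proof -
  interpret pseudo_nat C D F G \<tau> by fact
  interpret F: two_functor C D F by (rule two_functor_dom)
  interpret C: two_category C by (rule F.two_category_dom)
  show ?thesis
  proof (rule pseudo_nat.intro[OF two_functor_dom two_functor_cod], goal_cases)
    case (4 f a b \<alpha> g)
    then show ?case using cells1D(1)[OF C.cells2_par[OF 4]] C.cells1_Cell0[OF 4(1)] cells1D(1)[OF 4(1)]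
      pn1_natural[OF 4] assms(2,3) by simp
  next
    case (6 f a b g c)
    then show ?case using cells1D(1)[OF C.cmp1_cell[OF 6]] cells1D(1)[OF 6(1)] cells1D(1)[OF 6(2)]
      pn1_cmp1[OF 6] assms(3) by simp
  next
    case (2 f a b)
    then show ?case using pn1_cell[OF 2] C.cells1_Cell0[OF 2] cells1D(1)[OF 2] assms(2,3) by simp
  next
    case (5 a)
    then show ?case using pn1_id1[OF 5] cells1D(1)[OF C.id1_cell[OF 5]] assms(2,3) by simp
  qed (use assms(2,3) pn0_cell pn1_invertible in auto)
qed

text \<open>This turns a triangle identity that holds cell by cell into one up to invertible
  modification, whose components are identity 2-cells.\<close>

lemma invertible_modification_refl:
  assumes "pseudo_nat C D F G \<tau>"
    and eq: "\<And>a. a \<in> Cell0 C \<Longrightarrow> pn0 \<sigma> a = pn0 \<tau> a" "\<And>f. f \<in> Cell1 C \<Longrightarrow> pn1 \<sigma> f = pn1 \<tau> f"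
  shows "invertible_modification C D F G \<sigma> \<tau> (\<lambda>a. id2 D (pn0 \<tau> a))"
proof -
  interpret pseudo_nat C D F G \<tau> by fact
  interpret F: two_functor C D F by (rule two_functor_dom)
  interpret G: two_functor C D G by (rule two_functor_cod)
  interpret C: two_category C by (rule F.two_category_dom)
  interpret D: two_category D by (rule F.two_category_cod)
  have "pseudo_nat C D F G \<sigma>" by (rule pseudo_nat_cong[OF assms])
  then show ?thesis
  proof (rule invertible_modification.intro[OF _ assms(1)], goal_cases)
    case (1 a) then show ?case using pn0_cell[OF 1] eq D.id2_cell by (auto simp: cells1_def)
  next
    case (2 a) then show ?case using pn0_cell[OF 2] D.invertible2_id2 by (auto simp: cells1_def)
  next
    case (3 f a b)
    note f = cells1D[OF 3] C.cells1_Cell0[OF 3]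
    note n = pn1_cell[OF 3]
    show ?case
      using f eq n D.vcmp_id_left[OF n] D.vcmp_id_right[OF n]
      by (simp add: D.hcmp_id2[OF pn0_cell G.on1_cell[OF 3]] D.hcmp_id2[OF F.on1_cell[OF 3] pn0_cell])
  qed
qed

text \<open>By the unit law for 1-cells the identity transformation agrees on cells with a strict
  one, whose boundary is \<open>on1 L f\<close> composed with an identity.\<close>

lemma pseudo_nat_id:
  assumes "two_functor C D L" shows "pseudo_nat C D L L (pn_id D L)"
proof -
  interpret L: two_functor C D L by fact
  interpret C: two_category C by (rule L.two_category_dom)
  interpret D: two_category D by (rule L.two_category_cod)
  have "pseudo_nat C D L L (strict_pn C D L (\<lambda>a. id1 D (on0 L a)))"
  proof (rule pseudo_nat_strict[OF assms assms], goal_cases)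
    case (3 f g a b \<alpha>)
    show ?case using D.hcmp_id_left[OF L.on1_cell[OF 3(1)] L.on2_cell[OF 3(2)]]
      D.hcmp_id_right[OF L.on1_cell[OF 3(1)] L.on2_cell[OF 3(2)]] by simp
  next
    case (2 f a b)
    then show ?case using L.on1_cell[OF 2] D.cmp1_id_left D.cmp1_id_right by simp
  qed (use L.on0_cell D.id1_cell in auto)
  then show ?thesis
  proof (rule pseudo_nat_cong)
    fix f assume "f \<in> Cell1 C"
    then show "pn1 (pn_id D L) f = pn1 (strict_pn C D L (\<lambda>a. id1 D (on0 L a))) f"
      using D.cmp1_id_right[OF L.on1_cell, OF cells1I[OF _ refl refl]]
        by (simp add: strict_pn_def pn_id_def)
  qed (simp add: strict_pn_def pn_id_def)
qed

text \<open>As \<open>L\<close> after \<open>R\<close> is the identity, identity 1-cells have the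
  type of a counit. \<open>Lh\<close> and \<open>hR\<close> are exactly the triangle identities on
  0-cells; on 1-cells all structure cells involved are identities, so it remains to compare their
  boundaries.\<close>

lemma adjoint_biequivalence_strict:
  assumes L: "two_functor C D L" and R: "two_functor D C R"
    and LR: "eq_2func_on D (L \<circ>\<^sub>2 R) id_2func"
    and h: "\<And>a. a \<in> Cell0 C \<Longrightarrow> h a \<in> cells1 C a (on0 R (on0 L a))"
    and k: "\<And>a. a \<in> Cell0 C \<Longrightarrow> k a \<in> cells1 C (on0 R (on0 L a)) a"
    and kh: "\<And>a. a \<in> Cell0 C \<Longrightarrow> k a \<odot>\<^bsub>C\<^esub> h a = id1 C a"
    and hk: "\<And>a. a \<in> Cell0 C \<Longrightarrow> h a \<odot>\<^bsub>C\<^esub> k a = id1 C (on0 R (on0 L a))"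
    and nat1: "\<And>f a b. f \<in> cells1 C a b \<Longrightarrow> on1 R (on1 L f) \<odot>\<^bsub>C\<^esub> h a = h b \<odot>\<^bsub>C\<^esub> f"
    and nat2: "\<And>f g a b \<alpha>. \<lbrakk>f \<in> cells1 C a b; \<alpha> \<in> cells2 C f g\<rbrakk>
       \<Longrightarrow> on2 R (on2 L \<alpha>) \<star>\<^bsub>C\<^esub> id2 C (h a) = id2 C (h b) \<star>\<^bsub>C\<^esub> \<alpha>"
    and Lh: "\<And>a. a \<in> Cell0 C \<Longrightarrow> on1 L (h a) = id1 D (on0 L a)"
    and hR: "\<And>d. d \<in> Cell0 D \<Longrightarrow> h (on0 R d) = id1 C (on0 R d)"
  shows "adjoint_biequivalence C D L R (strict_pn C C (R \<circ>\<^sub>2 L) h) (strict_pn D D id_2func (id1 D))"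
proof -
  interpret L: two_functor C D L by fact
  interpret R: two_functor D C R by fact
  interpret C: two_category C by (rule L.two_category_dom)
  interpret D: two_category D by (rule L.two_category_cod)
  have LR0: "on0 L (on0 R d) = d" if "d \<in> Cell0 D" for d
    using LR that by (simp add: eq_2func_on_def comp_2func_def id_2func_def)
  have LR1: "on1 L (on1 R f) = f" if "f \<in> Cell1 D" for f
    using LR that by (simp add: eq_2func_on_def comp_2func_def id_2func_def)
  have LR2: "on2 L (on2 R \<alpha>) = \<alpha>" if "\<alpha> \<in> Cell2 D" for \<alpha>
    using LR that by (simp add: eq_2func_on_def comp_2func_def id_2func_def)
  let ?\<eta> = "strict_pn C C (R \<circ>\<^sub>2 L) h" and ?\<epsilon> = "strict_pn D D id_2func (id1 D)"
  have idc: "id1 D d \<in> Cell1 D" "id1 D d \<odot>\<^bsub>D\<^esub> id1 D d = id1 D d" if "d \<in> Cell0 D" for d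
    using D.id1_cell[OF that] D.cmp1_id_left[OF D.id1_cell[OF that]] by (auto simp: cells1_def)
  have idc': "id1 C d \<in> Cell1 C" "id1 C d \<odot>\<^bsub>C\<^esub> id1 C d = id1 C d" if "d \<in> Cell0 C" for d
    using C.id1_cell[OF that] C.cmp1_id_left[OF C.id1_cell[OF that]] by (auto simp: cells1_def)
  have unit: "pseudo_nat C C id_2func (R \<circ>\<^sub>2 L) ?\<eta>"
    by (rule pseudo_nat_strict[OF two_functor_id two_functor_comp[OF L R]])
      (use C.two_category_axioms h nat1 nat2 in \<open>auto simp: comp_2func_def id_2func_def\<close>)
  have counit: "pseudo_nat D D (L \<circ>\<^sub>2 R) id_2func ?\<epsilon>"
  proof (rule pseudo_nat_strict[OF two_functor_comp[OF R L] two_functor_id])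
    fix f g a b \<alpha> assume *: "f \<in> cells1 D a b" "\<alpha> \<in> cells2 D f g"
    show "on2 id_2func \<alpha> \<star>\<^bsub>D\<^esub> id2 D (id1 D a) = id2 D (id1 D b) \<star>\<^bsub>D\<^esub> on2 (L \<circ>\<^sub>2 R) \<alpha>"
      using D.hcmp_id_left[OF *] D.hcmp_id_right[OF *] cells2D[OF *(2)]
      by (simp add: comp_2func_def id_2func_def LR2)
  next
    fix f a b assume *: "f \<in> cells1 D a b"
    show "on1 id_2func f \<odot>\<^bsub>D\<^esub> id1 D a = id1 D b \<odot>\<^bsub>D\<^esub> on1 (L \<circ>\<^sub>2 R) f"
      using D.cmp1_id_left[OF *] D.cmp1_id_right[OF *] cells1D[OF *]
      by (simp add: comp_2func_def id_2func_def LR1)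
  qed (use D.two_category_axioms in \<open>auto simp: comp_2func_def id_2func_def LR0 LR1 D.id1_cell
      D.cmp1_id_left D.cmp1_id_right
     dest: cells1D\<close>)
  show ?thesis
  proof (rule adjoint_biequivalence.intro[OF L R unit counit], goal_cases)
    case (1 a)
    show ?case using C.equivalence1I[OF h[OF 1] k[OF 1] kh[OF 1] hk[OF 1]] by (simp add: strict_pn_def)
  next
    case (2 d)
    show ?case using D.equivalence1I[OF D.id1_cell[OF 2] D.id1_cell[OF 2]] idc[OF 2]
      by (simp add: strict_pn_def)
  next
    case 3
    have "invertible_modification C D L L (pn_comp C D (pn_whisk_right ?\<epsilon> L) (pn_whisk_left L ?\<eta>)) (pn_id
        D L)
       (\<lambda>a. id2 D (pn0 (pn_id D L) a))"
    proof (rule invertible_modification_refl[OF pseudo_nat_id[OF L]])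
      fix a assume a: "a \<in> Cell0 C"
      then show "pn0 (pn_comp C D (pn_whisk_right ?\<epsilon> L) (pn_whisk_left L ?\<eta>)) a = pn0 (pn_id D L) a"
        using idc[OF L.on0_cell[OF a]]
        by (simp add: strict_pn_def pn_comp_def pn_whisk_left_def pn_whisk_right_def pn_id_def Lh)
    next
      fix f assume f: "f \<in> Cell1 C"
      have f': "f \<in> cells1 C (dom1 C f) (cod1 C f)" using f by (simp add: cells1_def)
      note dc = C.cells1_Cell0[OF f']
      note Lf = L.on1_cell[OF f']
      note Lf2 = L.two_category_cod[THEN two_category.id2_cell, OF cells1D(1)[OF Lf]]
      \<comment> \<open>\<open>L\<close> sends the boundary of the structure cell of the unit at
        \<open>f\<close> to \<open>on1 L f\<close>, because it sends the component of the unit to an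
        identity and \<open>L\<close> after \<open>R\<close> is the identity.\<close>
      have "on1 L (on1 R (on1 L f) \<odot>\<^bsub>C\<^esub> h (dom1 C f)) = on1 L f"
        using L.on1_cmp1[OF h[OF dc(1)] R.on1_cell[OF Lf]] Lh[OF dc(1)] LR1[OF cells1D(1)[OF Lf]]
          D.cmp1_id_right[OF Lf]
        by simp
      moreover have "on1 R (on1 L f) \<odot>\<^bsub>C\<^esub> h (dom1 C f) \<in> Cell1 C"
        using C.cmp1_cell[OF h[OF dc(1)] R.on1_cell[OF Lf]] by (simp add: cells1_def)
      ultimately show "pn1 (pn_comp C D (pn_whisk_right ?\<epsilon> L) (pn_whisk_left L ?\<eta>)) f
          = pn1 (pn_id D L) f"
        using cells1D[OF Lf] D.cmp1_id_right[OF Lf] D.hcmp_id_left[OF Lf Lf2] D.hcmp_id_right[OF Lf Lf2]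
          D.vcmp_id_left[OF Lf2]
        by (simp add: strict_pn_def pn_comp_def pn_whisk_left_def pn_whisk_right_def pn_id_def
          Lh[OF dc(1)] L.on2_id2
           comp_2func_def id_2func_def)
    qed
    then show ?case by blast
  next
    case 4
    have "invertible_modification D C R R (pn_comp D C (pn_whisk_left R ?\<epsilon>) (pn_whisk_right ?\<eta> R)) (pn_id
        C R)
       (\<lambda>a. id2 C (pn0 (pn_id C R) a))"
    proof (rule invertible_modification_refl[OF pseudo_nat_id[OF R]])
      fix a assume a: "a \<in> Cell0 D"
      then show "pn0 (pn_comp D C (pn_whisk_left R ?\<epsilon>) (pn_whisk_right ?\<eta> R)) a = pn0 (pn_id C R) a"
        using idc'[OF R.on0_cell[OF a]]
        by (simp add: strict_pn_def pn_comp_def pn_whisk_left_def pn_whisk_right_def pn_id_def hR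
          R.on1_id1)
    next
      fix f assume f: "f \<in> Cell1 D"
      have f': "f \<in> cells1 D (dom1 D f) (cod1 D f)" using f by (simp add: cells1_def)
      note dc = D.cells1_Cell0[OF f']
      note Rf = R.on1_cell[OF f']
      note Rf2 = C.id2_cell[OF cells1D(1)[OF Rf]]
      show "pn1 (pn_comp D C (pn_whisk_left R ?\<epsilon>) (pn_whisk_right ?\<eta> R)) f = pn1 (pn_id C R) f"
        using f cells1D[OF Rf] C.cmp1_id_right[OF Rf] C.hcmp_id_left[OF Rf Rf2]
          C.hcmp_id_right[OF Rf Rf2] C.vcmp_id_left[OF Rf2]
        by (simp add: strict_pn_def pn_comp_def pn_whisk_left_def pn_whisk_right_def pn_id_def
          hR[OF dc(1)] R.on2_id2
           comp_2func_def id_2func_def LR1 D.cmp1_id_right[OF f'] R.on1_id1 dc)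
    qed
    then show ?case by blast
  qed
qed

text \<open>\<open>compat\<close> is the only way in which the 2-cells of \<open>WCmd\<close> and \<open>CompCat\<close> differ from each other.\<close>

locale over_Fib =
  fixes C :: "('c, 'm, ('m, 'e, 'f, 'o, 'a) fib2) twocat"
    and fib :: "'c \<Rightarrow> ('e, 'f, 'o, 'a) cloven"
    and base :: "'m \<Rightarrow> ('o, 'a, 'o, 'a) func" and total :: "'m \<Rightarrow> ('e, 'f, 'e, 'f) func"
    and compat :: "('m, 'e, 'f, 'o, 'a) fib2 \<Rightarrow> bool"
  assumes dom1_closed: "f \<in> Cell1 C \<Longrightarrow> dom1 C f \<in> Cell0 C"
    and cod1_closed: "f \<in> Cell1 C \<Longrightarrow> cod1 C f \<in> Cell0 C"
    and id1_cell: "a \<in> Cell0 C \<Longrightarrow> id1 C a \<in> cells1 C a a"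
    and cmp1_cell: "\<lbrakk>f \<in> cells1 C a b; g \<in> cells1 C b c\<rbrakk> \<Longrightarrow> g \<odot>\<^bsub>C\<^esub> f \<in> cells1 C a c"
    and cmp1_id_left: "f \<in> cells1 C a b \<Longrightarrow> id1 C b \<odot>\<^bsub>C\<^esub> f = f"
    and cmp1_id_right: "f \<in> cells1 C a b \<Longrightarrow> f \<odot>\<^bsub>C\<^esub> id1 C a = f"
    and cmp1_assoc: "\<lbrakk>f \<in> cells1 C a b; g \<in> cells1 C b c; h \<in> cells1 C c d\<rbrakk>
      \<Longrightarrow> (h \<odot>\<^bsub>C\<^esub> g) \<odot>\<^bsub>C\<^esub> f = h \<odot>\<^bsub>C\<^esub> (g \<odot>\<^bsub>C\<^esub> f)"
    and proj_functor: "a \<in> Cell0 C \<Longrightarrow> is_functor (proj (fib a))"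
    and fib_1cell: "f \<in> cells1 C a b \<Longrightarrow> fib_1cell (fib a) (fib b) (base f) (total f)"
    and base_id1: "base (id1 C a) = idf (base_cat (fib a))"
    and total_id1: "total (id1 C a) = idf (total_cat (fib a))"
    and base_cmp1: "base (g \<odot>\<^bsub>C\<^esub> f) = base g \<circ>\<^sub>F base f"
    and total_cmp1: "total (g \<odot>\<^bsub>C\<^esub> f) = total g \<circ>\<^sub>F total f"
    and dom2_eq: "dom2 C = csrc2" and cod2_eq: "cod2 C = ctgt2"
    and id2_eq: "id2 C = (\<lambda>m. \<lparr>csrc2 = m, ctgt2 = m, base_nt = idn (base m), total_nt = idn (total m)\<rparr>)"
    and vcmp_eq: "vcmp C = fib2_vcmp" and hcmp_eq: "hcmp C = fib2_hcmp (cmp1 C)"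
    and Cell2_iff: "t \<in> Cell2 C \<longleftrightarrow> csrc2 t \<in> Cell1 C \<and> ctgt2 t \<in> Cell1 C \<and>
      dom1 C (ctgt2 t) = dom1 C (csrc2 t) \<and> cod1 C (ctgt2 t) = cod1 C (csrc2 t) \<and>
      fib_2cell (fib (dom1 C (csrc2 t))) (fib (cod1 C (csrc2 t)))
        (base (csrc2 t)) (total (csrc2 t)) (base (ctgt2 t)) (total (ctgt2 t)) (base_nt t) (total_nt t) \<and>
      compat t"
    and compat_id2: "f \<in> Cell1 C \<Longrightarrow> compat (id2 C f)"
    and compat_vcmp: "\<lbrakk>f \<in> cells1 C a b; \<alpha> \<in> cells2 C f g; \<beta> \<in> cells2 C g h\<rbrakk> \<Longrightarrow> compat (\<beta> \<bullet>\<^bsub>C\<^esub> \<alpha>)"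
    and compat_hcmp: "\<lbrakk>f \<in> cells1 C a b; f' \<in> cells1 C b c; \<alpha> \<in> cells2 C f g; \<beta> \<in> cells2 C f' g'\<rbrakk>
       \<Longrightarrow> compat (\<beta> \<star>\<^bsub>C\<^esub> \<alpha>)"
begin

lemma fib2_eqI:
  fixes s t :: "('m, 'e, 'f, 'o, 'a) fib2"
  shows "\<lbrakk>csrc2 s = csrc2 t; ctgt2 s = ctgt2 t; base_nt s = base_nt t; total_nt s = total_nt t\<rbrakk> \<Longrightarrow> s = t"
  by simp

lemma cells2_iff:
  assumes "f \<in> cells1 C a b"
  shows "t \<in> cells2 C f g \<longleftrightarrow> csrc2 t = f \<and> ctgt2 t = g \<and> g \<in> cells1 C a b \<and>
      fib_2cell (fib a) (fib b) (base f) (total f) (base g) (total g) (base_nt t) (total_nt t) \<and>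
      compat t"
  using assms by (auto simp: cells2_def Cell2_iff cells1_def dom2_eq cod2_eq)

lemma cells1_Cell0: "f \<in> cells1 C a b \<Longrightarrow> a \<in> Cell0 C" "f \<in> cells1 C a b \<Longrightarrow> b \<in> Cell0 C"
  using dom1_closed cod1_closed by (auto simp: cells1_def)

lemmas base_betw = fib_1cellD(1)[OF fib_1cell] and total_betw = fib_1cellD(2)[OF fib_1cell]

lemma
  assumes "f \<in> cells1 C a b" "t \<in> cells2 C f g"
  shows base_nt_betw: "base_nt t : base f \<Rightarrow>\<^sub>N base g"
    and total_nt_betw: "total_nt t : total f \<Rightarrow>\<^sub>N total g"
    and cells2_tgt: "g \<in> cells1 C a b"
  using assms cells2_iff[OF assms(1)] by (auto simp: fib_2cell_def)

lemma fib2_vcmp_simps [simp]: "csrc2 (fib2_vcmp t s) = csrc2 s" "ctgt2 (fib2_vcmp t s) = ctgt2 t"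
  "base_nt (fib2_vcmp t s) = base_nt t \<bullet>\<^sub>N base_nt s" "total_nt (fib2_vcmp t s) = total_nt t
      \<bullet>\<^sub>N total_nt s"
  by (simp_all add: fib2_vcmp_def)

lemma fib2_hcmp_simps [simp]: "csrc2 (fib2_hcmp c t s) = c (csrc2 t) (csrc2 s)"
  "ctgt2 (fib2_hcmp c t s) = c (ctgt2 t) (ctgt2 s)"
  "base_nt (fib2_hcmp c t s) = base_nt t \<star>\<^sub>N base_nt s" "total_nt (fib2_hcmp c t s) = total_nt t
      \<star>\<^sub>N total_nt s"
  by (simp_all add: fib2_hcmp_def)

text \<open>The laws are equations between pairs of natural transformations and come from the
  calculus of \<open>vcomp\<close> and \<open>hcomp\<close>. The predicate \<open>compat\<close>
  enters only where a 2-cell has to be produced: identities and the two compositions.\<close>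

lemma two_category: "two_category C"
proof (rule two_category.intro, goal_cases)
  case (12 f)
  then have f: "f \<in> cells1 C (dom1 C f) (cod1 C f)" by (simp add: cells1_def)
  show ?case unfolding cells2_iff[OF f]
    using f fib_2cell_id[OF proj_functor[OF cells1_Cell0(1)[OF f]] proj_functor[OF cells1_Cell0(2)[OF f]]
      fib_1cell[OF f]] compat_id2[OF 12]
    by (simp add: id2_eq)
next
  case (13 \<alpha> f g \<beta> h)
  then have f: "f \<in> cells1 C (dom1 C f) (cod1 C f)"
    by (auto simp add: cells1_def cells2_def Cell2_iff dom2_eq)
  note g = cells2_tgt[OF f 13(1)]
  note h = cells2_tgt[OF g 13(2)]
  show ?case unfolding cells2_iff[OF f]
    using 13[unfolded cells2_iff[OF f] cells2_iff[OF g]] h compat_vcmp[OF f 13]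
      fib_2cell_vcomp[OF proj_functor[OF cells1_Cell0(1)[OF f]] proj_functor[OF cells1_Cell0(2)[OF f]]
         fib_1cell[OF f] fib_1cell[OF g] fib_1cell[OF h]]
    by (simp add: vcmp_eq)
next
  case (14 \<alpha> f g)
  then have f: "f \<in> cells1 C (dom1 C f) (cod1 C f)"
    by (auto simp add: cells1_def cells2_def Cell2_iff dom2_eq)
  show ?case using cells2D[OF 14] vcomp_idn_left[OF base_betw[OF f] base_nt_betw[OF f 14]]
    vcomp_idn_left[OF total_betw[OF f] total_nt_betw[OF f 14]]
    by (auto intro!: fib2_eqI simp: vcmp_eq id2_eq dom2_eq cod2_eq)
next
  case (15 \<alpha> f g)
  then have f: "f \<in> cells1 C (dom1 C f) (cod1 C f)"
    by (auto simp add: cells1_def cells2_def Cell2_iff dom2_eq)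
  show ?case using cells2D[OF 15] vcomp_idn_right[OF base_betw[OF f] base_nt_betw[OF f 15]]
    vcomp_idn_right[OF total_betw[OF f] total_nt_betw[OF f 15]]
    by (auto intro!: fib2_eqI simp: vcmp_eq id2_eq dom2_eq cod2_eq)
next
  case (16 \<alpha> f g \<beta> h \<gamma> k)
  then have f: "f \<in> cells1 C (dom1 C f) (cod1 C f)"
    by (auto simp add: cells1_def cells2_def Cell2_iff dom2_eq)
  note g = cells2_tgt[OF f 16(1)]
  note h = cells2_tgt[OF g 16(2)]
  show ?case using vcomp_assoc[OF base_betw[OF f] base_nt_betw[OF f 16(1)] base_nt_betw[OF g 16(2)]
      base_nt_betw[OF h 16(3)]]
    vcomp_assoc[OF total_betw[OF f] total_nt_betw[OF f 16(1)] total_nt_betw[OF g 16(2)]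
        total_nt_betw[OF h 16(3)]]
    by (auto intro!: fib2_eqI simp: vcmp_eq)
next
  case (17 f a b f' c \<alpha> g \<beta> g')
  note g = cells2_tgt[OF 17(1,3)] and g' = cells2_tgt[OF 17(2,4)]
  note ff = cmp1_cell[OF 17(1,2)] and gg = cmp1_cell[OF g g']
  show ?case unfolding cells2_iff[OF ff]
    using 17(3,4)[unfolded cells2_iff[OF 17(1)] cells2_iff[OF 17(2)]] gg compat_hcmp[OF 17]
      fib_2cell_hcomp[OF proj_functor[OF cells1_Cell0(1)[OF 17(1)]]
          proj_functor[OF cells1_Cell0(2)[OF 17(1)]]
         proj_functor[OF cells1_Cell0(2)[OF 17(2)]]
         fib_1cell[OF 17(1)] fib_1cell[OF g] fib_1cell[OF 17(2)] fib_1cell[OF g']]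
    by (simp add: hcmp_eq base_cmp1 total_cmp1)
next
  case (18 f a b \<alpha> g)
  note g = cells2_tgt[OF 18]
  show ?case using cells2D[OF 18(2)] hcomp_idf_left[OF base_betw[OF 18(1)] base_nt_betw[OF 18]]
    hcomp_idf_left[OF total_betw[OF 18(1)] total_nt_betw[OF 18]]
    by (auto intro!: fib2_eqI simp: hcmp_eq id2_eq dom2_eq cod2_eq cmp1_id_left[OF 18(1)]
      cmp1_id_left[OF g] base_id1 total_id1)
next
  case (19 f a b \<alpha> g)
  note g = cells2_tgt[OF 19]
  show ?case using cells2D[OF 19(2)] hcomp_idf_right[OF base_betw[OF 19(1)] base_nt_betw[OF 19]]
    hcomp_idf_right[OF total_betw[OF 19(1)] total_nt_betw[OF 19]]
    by (auto intro!: fib2_eqI simp: hcmp_eq id2_eq dom2_eq cod2_eq cmp1_id_right[OF 19(1)]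
      cmp1_id_right[OF g] base_id1 total_id1)
next
  case (20 f a b f' c f'' d \<alpha> g \<beta> g' \<gamma> g'')
  note g = cells2_tgt[OF 20(1,4)] and g' = cells2_tgt[OF 20(2,5)] and g'' = cells2_tgt[OF 20(3,6)]
  show ?case using cells2D[OF 20(4)] cells2D[OF 20(5)] cells2D[OF 20(6)] cmp1_assoc[OF 20(1,2,3)]
      cmp1_assoc[OF g g' g'']
    hcomp_assoc[OF base_betw[OF 20(1)] base_betw[OF 20(2)] base_betw[OF 20(3)]
        base_nt_betw[OF 20(1,4)] base_nt_betw[OF 20(2,5)] base_nt_betw[OF 20(3,6)]]
    hcomp_assoc[OF total_betw[OF 20(1)] total_betw[OF 20(2)] total_betw[OF 20(3)]
        total_nt_betw[OF 20(1,4)] total_nt_betw[OF 20(2,5)] total_nt_betw[OF 20(3,6)]]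
    by (auto intro!: fib2_eqI simp: hcmp_eq dom2_eq cod2_eq)
next
  case (21 f a b g c)
  show ?case using hcomp_idn[OF base_betw[OF 21(1)] base_betw[OF 21(2)]]
      hcomp_idn[OF total_betw[OF 21(1)] total_betw[OF 21(2)]]
    by (auto intro!: fib2_eqI simp: hcmp_eq id2_eq base_cmp1 total_cmp1)
next
  case (22 f a b f' c \<alpha> g \<beta> h \<alpha>' g' \<beta>' h')
  note g = cells2_tgt[OF 22(1,3)] and g' = cells2_tgt[OF 22(2,5)]
  show ?case using
    hcomp_interchange[OF base_betw[OF 22(1)] base_betw[OF 22(2)]
        base_nt_betw[OF 22(1,3)] base_nt_betw[OF g 22(4)] base_nt_betw[OF 22(2,5)]
            base_nt_betw[OF g' 22(6)]]
    hcomp_interchange[OF total_betw[OF 22(1)] total_betw[OF 22(2)]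
        total_nt_betw[OF 22(1,3)] total_nt_betw[OF g 22(4)] total_nt_betw[OF 22(2,5)]
            total_nt_betw[OF g' 22(6)]]
    by (auto intro!: fib2_eqI simp: hcmp_eq vcmp_eq)
qed (use dom1_closed cod1_closed id1_cell cmp1_cell cmp1_id_left cmp1_id_right cmp1_assoc in
   \<open>auto simp: Cell2_iff dom2_eq cod2_eq\<close>)

end

text \<open>\<open>F\<close> keeps the underlying fibration data of every cell, so it preserves the
  operations on 2-cells as soon as it preserves those on 1-cells. The one genuine condition on
  2-cells is the transport of compatibility.\<close>

lemma two_functor_over_Fib:
  fixes total total' compat compat'
  assumes C: "over_Fib C fib base total compat" and D: "over_Fib D fib' base' total' compat'"
    and on0: "\<And>a. a \<in> Cell0 C \<Longrightarrow> on0 F a \<in> Cell0 D"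
    and on1: "\<And>f a b. f \<in> cells1 C a b \<Longrightarrow> on1 F f \<in> cells1 D (on0 F a) (on0 F b)"
    and id1: "\<And>a. a \<in> Cell0 C \<Longrightarrow> on1 F (id1 C a) = id1 D (on0 F a)"
    and cmp1: "\<And>f g a b c. \<lbrakk>f \<in> cells1 C a b; g \<in> cells1 C b c\<rbrakk> \<Longrightarrow> on1 F (g \<odot>\<^bsub>C\<^esub> f) = on1 F g \<odot>\<^bsub>D\<^esub> on1 F f"
    and on2: "\<And>t. on2 F t = \<lparr>csrc2 = on1 F (csrc2 t), ctgt2 = on1 F (ctgt2 t), base_nt
        = base_nt t, total_nt = total_nt t\<rparr>"
    and fib: "\<And>a. fib' (on0 F a) = fib a" and base: "\<And>f. base' (on1 F f) = base f"
        and total: "\<And>f. total' (on1 F f) = total f"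
    and compat: "\<And>t. t \<in> Cell2 C \<Longrightarrow> compat' (on2 F t)"
  shows "two_functor C D F"
proof -
  interpret C: over_Fib C fib base total compat by fact
  interpret D: over_Fib D fib' base' total' compat' by fact
  interpret C2: two_category C by (rule C.two_category)
  interpret D2: two_category D by (rule D.two_category)
  have on2_cell: "on2 F \<alpha> \<in> cells2 D (on1 F f) (on1 F g)" if a: "\<alpha> \<in> cells2 C f g" for f g \<alpha>
  proof -
    have f: "f \<in> cells1 C (dom1 C f) (cod1 C f)"
      using cells2D[OF a] C2.dom2_closed[of \<alpha>] by (auto simp: cells1_def)
    note g = C.cells2_tgt[OF f a]
    show ?thesis
      using a on1[OF f] on1[OF g] compat[OF cells2D(1)[OF a]]
      by (simp add: C.cells2_iff[OF f] D.cells2_iff[OF on1[OF f]] on2 fib base total)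
  qed
  show ?thesis
    by (rule two_functor.intro[OF C2.two_category_axioms D2.two_category_axioms on0 on1 on2_cell id1
      cmp1])
      (auto simp: on2 C.id2_eq D.id2_eq C.vcmp_eq D.vcmp_eq C.hcmp_eq D.hcmp_eq base total fib2_vcmp_def
        fib2_hcmp_def
        cells2_def C.dom2_eq C.cod2_eq cmp1 dest: C.cells2_tgt intro!: cmp1)
qed

section \<open>Arrow categories\<close>

lemma arrow_cat_simps [simp]: "Ob (arrow_cat C) = Ar C" "Ar (arrow_cat C) = squares C"
  "s \<in> squares C \<Longrightarrow> src (arrow_cat C) s = sq_src s" "s \<in> squares C \<Longrightarrow> tgt (arrow_cat C) s = sq_tgt s"
  "f \<in> Ar C \<Longrightarrow> ide (arrow_cat C) f = Square f f (ide C (src C f)) (ide C (tgt C f))"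
  "\<lbrakk>s \<in> squares C; t \<in> squares C; sq_src t = sq_tgt s\<rbrakk> \<Longrightarrow> t \<cdot>\<^bsub>arrow_cat C\<^esub> s =
     Square (sq_src s) (sq_tgt t) (sq_dom t \<cdot>\<^bsub>C\<^esub> sq_dom s) (sq_cod t \<cdot>\<^bsub>C\<^esub> sq_cod s)"
  by (simp_all add: arrow_cat_def)

lemma hom_arrow_cat: "s \<in> hom (arrow_cat C) f g \<longleftrightarrow> s \<in> squares C \<and> sq_src s = f \<and> sq_tgt s = g"
  by (auto simp: hom_def)

lemma category_arrow_cat:
  fixes C (structure)
  assumes "category C" shows "category (arrow_cat C)"
proof -
  interpret category C by fact
  have comp: "t \<cdot>\<^bsub>arrow_cat C\<^esub> s \<in> squares C" if "s \<in> squares C" "t \<in> squares C" "sq_src t = sq_tgt s"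
      for s t
  proof -
    have st: "sq_src s \<in> Ar C" "sq_dom s \<in> Ar C" "src C (sq_dom s) = src C (sq_src s)"
      "tgt C (sq_dom s) = src C (sq_tgt s)" "sq_cod s \<in> Ar C" "src C (sq_cod s) = tgt C (sq_src s)"
      "tgt C (sq_cod s) = tgt C (sq_tgt s)" "sq_tgt s \<cdot> sq_dom s = sq_cod s \<cdot> sq_src s" "sq_tgt s \<in> Ar C"
      "sq_tgt t \<in> Ar C" "sq_dom t \<in> Ar C" "src C (sq_dom t) = src C (sq_tgt s)"
      "tgt C (sq_dom t) = src C (sq_tgt t)" "sq_cod t \<in> Ar C" "src C (sq_cod t) = tgt C (sq_tgt s)"
      "tgt C (sq_cod t) = tgt C (sq_tgt t)" "sq_tgt t \<cdot> sq_dom t = sq_cod t \<cdot> sq_tgt s"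
      using that by (auto simp: squares_def hom_def)
    \<comment> \<open>Pasting of the two squares along their common side
      \<open>sq_tgt s\<close>.\<close>
    have "sq_tgt t \<cdot> (sq_dom t \<cdot> sq_dom s) = (sq_tgt t \<cdot> sq_dom t) \<cdot> sq_dom s"
      by (simp add: st(1-7,9-16) chase)
    also have "\<dots> = sq_cod t \<cdot> (sq_tgt s \<cdot> sq_dom s)"
      using st by (simp add: chase)
    also have "\<dots> = (sq_cod t \<cdot> sq_cod s) \<cdot> sq_src s"
      using st by (simp add: chase)
    finally show ?thesis using that st by (simp add: squares_def hom_def chase)
  qed
  show ?thesis
  proof (rule category.intro, goal_cases)
    case (3 f)
    then show ?case by (simp add: squares_def hom_def chase)
  next
    case (4 s f g t h)
    then show ?case using comp[of s t] by (simp add: hom_arrow_cat)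
  next
    case (5 s f g)
    then show ?case by (auto simp: hom_arrow_cat squares_def hom_def chase square.expand)
  next
    case (6 s f g)
    then show ?case by (auto simp: hom_arrow_cat squares_def hom_def chase square.expand)
  next
    case (7 s f g t h u k)
    then show ?case using comp[of s t] comp[of t u]
      by (auto simp: hom_arrow_cat) (auto simp: squares_def hom_def chase)
  qed (auto simp: arrow_cat_def squares_def)
qed

lemma far_square:
  assumes F: "F : C \<rightarrow>\<^sub>F D" and s: "s \<in> squares C"
  shows "map_square (far F) s \<in> squares D"
proof -
  have s': "sq_src s \<in> Ar C" "sq_dom s \<in> Ar C" "src C (sq_dom s) = src C (sq_src s)"
      "tgt C (sq_dom s) = src C (sq_tgt s)" "sq_cod s \<in> Ar C" "src C (sq_cod s) = tgt C (sq_src s)"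
      "tgt C (sq_cod s) = tgt C (sq_tgt s)" "sq_tgt s \<cdot>\<^bsub>C\<^esub> sq_dom s = sq_cod s \<cdot>\<^bsub>C\<^esub> sq_src s"
          "sq_tgt s \<in> Ar C"
      using s by (auto simp: squares_def hom_def)
  have "far F (sq_tgt s) \<cdot>\<^bsub>D\<^esub> far F (sq_dom s) = far F (sq_cod s) \<cdot>\<^bsub>D\<^esub> far F (sq_src s)"
    using arg_cong[OF s'(8), of "far F"] s'(1-7,9) by (simp add: functor_chase[OF F])
  then show ?thesis using s' by (simp add: squares_def hom_def functor_chase[OF F] square.map_sel)
qed

lemma arrow_functor_simps [simp]: "Dom (F\<^bold>\<two>) = arrow_cat (Dom F)" "Cod (F\<^bold>\<two>) = arrow_cat (Cod F)"
  "f \<in> Ar (Dom F) \<Longrightarrow> fob (F\<^bold>\<two>) f = far F f" "s \<in> squares (Dom F) \<Longrightarrow> far (F\<^bold>\<two>) s = map_square (far F) s"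
  by (simp_all add: arrow_functor_def)

lemma arrow_functor_betw:
  assumes F: "F : C \<rightarrow>\<^sub>F D" shows "F\<^bold>\<two> : arrow_cat C \<rightarrow>\<^sub>F arrow_cat D"
proof -
  note [simp] = functor_betwD[OF F]
  interpret C: category C by simp
  interpret D: category D by simp
  interpret aC: category "arrow_cat C" by (rule category_arrow_cat) simp
  show ?thesis
  proof (rule functor_betwI)
    fix s t f g h assume *: "s \<in> hom (arrow_cat C) f g" "t \<in> hom (arrow_cat C) g h"
    then have "t \<cdot>\<^bsub>arrow_cat C\<^esub> s \<in> squares C" using aC.cmp_hom[OF *] by (simp add: hom_arrow_cat)
    then show "far (F\<^bold>\<two>) (t \<cdot>\<^bsub>arrow_cat C\<^esub> s) = far (F\<^bold>\<two>) t \<cdot>\<^bsub>arrow_cat D\<^esub> far (F\<^bold>\<two>) s"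
      using * far_square[OF F, of s] far_square[OF F, of t]
      by (auto simp: hom_arrow_cat square.map_sel)
        (auto simp: squares_def hom_def functor_chase[OF F])
  qed (use far_square[OF F] aC.ide_Ar in \<open>auto simp: hom_arrow_cat square.map_sel category_arrow_cat
      functor_chase[OF F]
     C.chase arrow_functor_def\<close>)
qed

lemma cod_functor_betw:
  assumes "category C" shows "cod_functor C : arrow_cat C \<rightarrow>\<^sub>F C"
proof -
  interpret category C by fact
  interpret aC: category "arrow_cat C" by (rule category_arrow_cat[OF assms])
  show ?thesis
  proof (rule functor_betwI)
    fix s t f g h assume *: "s \<in> hom (arrow_cat C) f g" "t \<in> hom (arrow_cat C) g h"
    then show "far (cod_functor C) (t \<cdot>\<^bsub>arrow_cat C\<^esub> s) = far (cod_functor C) t \<cdot>\<^bsub>C\<^esub> far (cod_functor C) s"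
      using aC.cmp_hom[OF *] by (simp add: hom_arrow_cat cod_functor_def)
  qed (use aC.ide_Ar in \<open>auto simp: cod_functor_def category_arrow_cat assms chase hom_arrow_cat\<close>,
        auto simp: squares_def hom_def chase)
qed

lemma arrow_functor_idf:
  assumes "category C" shows "(idf C)\<^bold>\<two> = idf (arrow_cat C)"
proof (rule functor_eqI[OF arrow_functor_betw[OF idf_betw[OF assms]] idf_betw[OF category_arrow_cat[OF
    assms]]])
  show "far ((idf C)\<^bold>\<two>) f = far (idf (arrow_cat C)) f" if "f \<in> Ar (arrow_cat C)" for f
    using that by (auto simp: square.expand square.map_sel squares_def hom_def)
qed (auto simp: assms category_arrow_cat)

lemma arrow_functor_fcomp:
  assumes F: "F : C \<rightarrow>\<^sub>F D" and G: "G : D \<rightarrow>\<^sub>F E"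
  shows "(G \<circ>\<^sub>F F)\<^bold>\<two> = G\<^bold>\<two> \<circ>\<^sub>F F\<^bold>\<two>"
proof (rule functor_eqI[OF arrow_functor_betw[OF fcomp_betw[OF F G]] fcomp_betw[OF arrow_functor_betw[OF
    F] arrow_functor_betw[OF G]]])
  note [simp] = functor_betwD[OF F] functor_betwD[OF G]
  show "far ((G \<circ>\<^sub>F F)\<^bold>\<two>) s = far (G\<^bold>\<two> \<circ>\<^sub>F F\<^bold>\<two>) s" if "s \<in> Ar (arrow_cat C)" for s
    using that far_square[OF F, of s] by (cases s) (auto simp: squares_def hom_def)
qed (auto simp: functor_betwD[OF F] functor_betwD[OF G] functor_chase[OF F])

lemma arrow_nt_simps [simp]: "nsrc (arrow_nt \<psi>) = (nsrc \<psi>)\<^bold>\<two>" "ntgt (arrow_nt \<psi>) = (ntgt \<psi>)\<^bold>\<two>"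
  "f \<in> Ar (Dom (nsrc \<psi>)) \<Longrightarrow> cpt (arrow_nt \<psi>) f = Square (far (nsrc \<psi>) f) (far (ntgt \<psi>) f)
         (cpt \<psi> (src (Dom (nsrc \<psi>)) f)) (cpt \<psi> (tgt (Dom (nsrc \<psi>)) f))"
  by (simp_all add: arrow_nt_def)

section \<open>Cartesian arrows\<close>

context cloven_fibration
begin

lemma proj_functor: "is_functor (proj P)"
  using fibration by (simp add: grothendieck_fibration_def)

lemmas proj = proj_betw[OF proj_functor]

abbreviation "tot \<equiv> total_cat P"
abbreviation "bas \<equiv> base_cat P"
abbreviation "prj \<equiv> proj P"

sublocale E: category tot using functor_betwD[OF proj] by simp
sublocale B: category bas using functor_betwD[OF proj] by simp

end

lemma cartesian_Ar: "cartesian p f \<Longrightarrow> f \<in> Ar (Dom p)"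
  by (simp add: cartesian_def)

lemma cartesian_ex1:
  fixes E (structure)
  assumes p: "p : E \<rightarrow>\<^sub>F B" and f: "cartesian p f" "f \<in> hom E a b" and g: "g \<in> hom E c b"
    and w: "w \<in> hom B (fob p c) (fob p a)" "far p f \<cdot>\<^bsub>B\<^esub> w = far p g"
  shows "\<exists>!h. h \<in> hom E c a \<and> far p h = w \<and> f \<cdot> h = g"
proof -
  have g': "g \<in> Ar E" "src E g = c" "tgt E g = b" and f': "src E f = a" "tgt E f = b"
    using f(2) g by (auto simp: hom_def)
  have "\<forall>w\<in>hom B (fob p (src E g)) (fob p (src E f)). tgt E g = tgt E f \<and> far p f \<cdot>\<^bsub>B\<^esub> w = far p g \<longrightarrow>
        (\<exists>!h. h \<in> hom E (src E g) (src E f) \<and> far p h = w \<and> f \<cdot> h = g)"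
    using f(1) g'(1) unfolding cartesian_def functor_betwD[OF p] by blast
  then show ?thesis using w g' f' by simp
qed

text \<open>The uniqueness half of cartesianness. It is the standard way to compare arrows into the
  source of a counit component: look at their images in the base and at their composites with the
  counit.\<close>

lemma cartesian_cancel:
  fixes E (structure)
  assumes p: "p : E \<rightarrow>\<^sub>F B" and f: "cartesian p f" "f \<in> hom E a b"
    and h: "h \<in> hom E c a" "k \<in> hom E c a" "far p h = far p k" "f \<cdot> h = f \<cdot> k"
  shows "h = k"
proof -
  interpret E: category E using functor_betwD[OF p] by simp
  have 1: "far p f \<cdot>\<^bsub>B\<^esub> far p k = far p (f \<cdot> k)"
    using f h far_cmp[OF p, of k f] by (simp add: hom_def)
  show ?thesis
    using cartesian_ex1[OF p f E.cmp_hom[OF h(2) f(2)] far_hom[OF p h(2)] 1] h by auto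
qed

text \<open>The inverse in the base lifts along \<open>g\<close> to an arrow \<open>k\<close> in the
  other direction; both round trips lie over identities and cancel against the cartesian
  \<open>f\<close> and \<open>g\<close>. Applied to \<open>theta\<close>, this makes invertibility a
  matter of the base.\<close>

lemma is_iso_cartesian:
  fixes E (structure)
  assumes p: "p : E \<rightarrow>\<^sub>F B" and f: "cartesian p f" "f \<in> hom E a b" and g: "cartesian p g" "g \<in> hom E c b"
    and h: "h \<in> hom E c a" "f \<cdot> h = g" and i: "is_iso B (far p h)"
  shows "is_iso E h"
proof -
  interpret E: category E using functor_betwD[OF p] by simp
  interpret B: category B using functor_betwD[OF p] by simp
  obtain w where w: "w \<in> hom B (fob p a) (fob p c)" "w \<cdot>\<^bsub>B\<^esub> far p h = ide B (fob p c)"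
    "far p h \<cdot>\<^bsub>B\<^esub> w = ide B (fob p a)"
    using i h far_hom[OF p h(1)] by (auto simp: is_iso_def hom_def)
  have gh: "far p g = far p f \<cdot>\<^bsub>B\<^esub> far p h"
    using h f far_cmp[OF p, of h f] by (simp add: hom_def)
  have "far p g \<cdot>\<^bsub>B\<^esub> w = far p f \<cdot>\<^bsub>B\<^esub> far p h \<cdot>\<^bsub>B\<^esub> w"
    unfolding gh using far_hom[OF p h(1)] far_hom[OF p f(2)] w(1) by (auto simp: hom_def B.assoc)
  also have "\<dots> = far p f"
    using far_hom[OF p f(2)] by (simp add: w hom_def B.chase)
  finally obtain k where k: "k \<in> hom E a c" "far p k = w" "g \<cdot> k = f"
    using cartesian_ex1[OF p g f(2) w(1)] by auto
  note * = f(2) g(2) h(1) k(1) functor_chase[OF p]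
  note ac = E.hom_Ob[OF f(2)] E.hom_Ob[OF g(2)]
  have "k \<cdot> h = ide E c"
  proof (rule cartesian_cancel[OF p g E.cmp_hom[OF h(1) k(1)] E.ide_hom[OF ac(3)]])
    show "far p (k \<cdot> h) = far p (ide E c)"
      using * w(2) k(2) ac by (simp add: hom_def)
    have "g \<cdot> k \<cdot> h = (g \<cdot> k) \<cdot> h"
      using * by (simp add: hom_def E.assoc)
    also have "\<dots> = g \<cdot> ide E c" unfolding k(3) h(2) using * ac by (simp add: hom_def E.chase)
    finally show "g \<cdot> k \<cdot> h = g \<cdot> ide E c" .
  qed
  moreover have "h \<cdot> k = ide E a"
  proof (rule cartesian_cancel[OF p f E.cmp_hom[OF k(1) h(1)] E.ide_hom[OF ac(1)]])
    show "far p (h \<cdot> k) = far p (ide E a)"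
      using * w(3) k(2) ac by (simp add: hom_def)
    have "f \<cdot> h \<cdot> k = (f \<cdot> h) \<cdot> k"
      using * by (simp add: hom_def E.assoc)
    also have "\<dots> = f \<cdot> ide E a" unfolding k(3) h(2) using * ac by (simp add: hom_def E.chase)
    finally show "f \<cdot> h \<cdot> k = f \<cdot> ide E a" .
  qed
  ultimately show ?thesis using h(1) k(1) by (auto simp: is_iso_def hom_def)
qed

section \<open>Comprehension categories\<close>

context comprehension_category
begin

sublocale cloven_fibration "cfib Q" by (rule cloven)

abbreviation "ext_ob e \<equiv> src bas (fob (chi Q) e)"
abbreviation "ext_ar f \<equiv> sq_dom (far (chi Q) f)"

lemma chi: "chi Q : tot \<rightarrow>\<^sub>F arrow_cat bas"
  by (simp add: functor_betw_def functor_chi Dom_chi Cod_chi)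

lemma fob_chi: "e \<in> Ob tot \<Longrightarrow> fob (chi Q) e \<in> hom bas (ext_ob e) (fob prj e)"
  using fob_Ob[OF chi, of e] arg_cong[OF cod_chi, of "\<lambda>F. fob F e"]
  by (simp add: Dom_chi cod_functor_def hom_def)

lemma far_chi_squares: "f \<in> hom tot a b \<Longrightarrow> far (chi Q) f \<in> squares bas"
  using far_hom[OF chi, of f a b] by (simp add: hom_arrow_cat)

lemma far_chi:
  assumes "f \<in> hom tot a b"
  shows "sq_src (far (chi Q) f) = fob (chi Q) a" "sq_tgt (far (chi Q) f) = fob (chi Q) b"
    "sq_cod (far (chi Q) f) = far prj f"
  using far_hom[OF chi assms] arg_cong[OF cod_chi, of "\<lambda>F. far F f"] assms
  by (simp_all add: Dom_chi cod_functor_def hom_def) auto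

lemma ext_ar: "f \<in> hom tot a b \<Longrightarrow> ext_ar f \<in> hom bas (ext_ob a) (ext_ob b)"
  and chi_square: "f \<in> hom tot a b \<Longrightarrow>
    fob (chi Q) b \<cdot>\<^bsub>bas\<^esub> ext_ar f = far prj f \<cdot>\<^bsub>bas\<^esub> fob (chi Q) a"
  using far_chi_squares[of f a b] far_chi[of f a b] by (auto simp: squares_def)

lemma ext_ar_cmp: "\<lbrakk>f \<in> hom tot a b; g \<in> hom tot b c\<rbrakk> \<Longrightarrow> ext_ar (g \<cdot>\<^bsub>tot\<^esub> f) = ext_ar g \<cdot>\<^bsub>bas\<^esub> ext_ar f"
  using far_chi_squares[of f a b] far_chi_squares[of g b c] far_chi[of f a b] far_chi[of g b c]
  by (simp add: far_cmp[OF chi] hom_def)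

end

lemma comprehension_categoryI:
  assumes "cloven_fibration (cfib Q)" "chi Q : total_cat (cfib Q) \<rightarrow>\<^sub>F arrow_cat (base_cat (cfib Q))"
    "\<And>e. e \<in> Ob (total_cat (cfib Q)) \<Longrightarrow> tgt (base_cat (cfib Q)) (fob (chi Q) e) = fob (proj (cfib Q)) e"
    "\<And>f. f \<in> Ar (total_cat (cfib Q)) \<Longrightarrow> sq_cod (far (chi Q) f) = far (proj (cfib Q)) f"
    "\<And>f. cartesian (proj (cfib Q)) f \<Longrightarrow> is_pullback (base_cat (cfib Q)) (far (chi Q) f)"
  shows "comprehension_category Q"
proof -
  interpret cloven_fibration "cfib Q" by fact
  note [simp] = functor_betwD(2,3)[OF assms(2)]
  have *: "fob (chi Q) e \<in> Ar (base_cat (cfib Q))" if "e \<in> Ob (total_cat (cfib Q))" for e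
    using fob_Ob[OF assms(2) that] by simp
  have **: "far (chi Q) f \<in> squares (base_cat (cfib Q))" if "f \<in> Ar (total_cat (cfib Q))" for f
    using far_Ar[OF assms(2) that] by simp
  have "cod_functor (base_cat (cfib Q)) \<circ>\<^sub>F chi Q = proj (cfib Q)"
    using assms(3,4) * **
    by (intro functor_eqI[OF fcomp_betw[OF assms(2) cod_functor_betw[OF B.category_axioms]] proj])
      (simp_all add: cod_functor_def)
  then show ?thesis
    by (intro comprehension_category.intro) (use assms in \<open>auto simp: functor_betw_def\<close>)
qed

context lax_comp_morphism
begin

sublocale S: comprehension_category "csrc m" by (rule src_comprehension)
sublocale T: comprehension_category "ctgt m" by (rule tgt_comprehension)

lemmas base = fib_1cellD(1)[OF fib_1cell]
lemmas total = fib_1cellD(2)[OF fib_1cell]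
lemmas proj_total = fib_1cellD(4,5)[OF fib_1cell]
lemmas total_cartesian = fib_1cellD(6)[OF fib_1cell]

lemma zeta_src: "(cbase m)\<^bold>\<two> \<circ>\<^sub>F chi (csrc m) : S.tot \<rightarrow>\<^sub>F arrow_cat T.bas"
  by (rule fcomp_betw[OF S.chi arrow_functor_betw[OF base]])

lemma zeta_ext: "cpt (zeta m) \<in> extensional (Ob S.tot)"
  by (rule cpt_ext[OF zeta_nt zeta_src])

abbreviation "zt e \<equiv> sq_dom (cpt (zeta m) e)"

text \<open>Three of the four parts of each component are forced, the codomain part by
  \<open>cod_zeta\<close>; all the information is in \<open>zt\<close>.\<close>

lemma zeta_comps:
  assumes e: "e \<in> Ob S.tot"
  shows "sq_src (cpt (zeta m) e) = far (cbase m) (fob (chi (csrc m)) e)"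
    "sq_tgt (cpt (zeta m) e) = fob (chi (ctgt m)) (fob (ctotal m) e)"
    "sq_cod (cpt (zeta m) e) = ide T.bas (fob (cbase m) (fob S.prj e))"
    "cpt (zeta m) e \<in> squares T.bas"
proof -
  note [simp] = functor_betwD(2,3)[OF base] functor_betwD(2,3)[OF total] nt_betwD[OF zeta_nt] S.Dom_chi
  have [simp]: "fob (chi (csrc m)) e \<in> Ar S.bas" using S.fob_chi[OF e] by (simp add: hom_def)
  show *: "sq_src (cpt (zeta m) e) = far (cbase m) (fob (chi (csrc m)) e)"
    "sq_tgt (cpt (zeta m) e) = fob (chi (ctgt m)) (fob (ctotal m) e)"
    "cpt (zeta m) e \<in> squares T.bas"
    using cpt_hom[OF zeta_nt zeta_src e] e by (auto simp: hom_arrow_cat)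
  show "sq_cod (cpt (zeta m) e) = ide T.bas (fob (cbase m) (fob S.prj e))"
    using arg_cong[OF cod_zeta, of "\<lambda>\<alpha>. cpt \<alpha> e"] e * by (simp add: cod_functor_def)
qed

lemma zt: "e \<in> Ob S.tot \<Longrightarrow> zt e \<in> hom T.bas (fob (cbase m) (S.ext_ob e)) (T.ext_ob (fob (ctotal m) e))"
  and zt_chi: "e \<in> Ob S.tot \<Longrightarrow> fob (chi (ctgt m)) (fob (ctotal m) e) \<cdot>\<^bsub>T.bas\<^esub> zt e
      = far (cbase m) (fob (chi (csrc m)) e)"
proof -
  assume e: "e \<in> Ob S.tot"
  have *: "fob (chi (csrc m)) e \<in> Ar S.bas" "tgt S.bas (fob (chi (csrc m)) e) = fob S.prj e"
    using S.fob_chi[OF e] by (auto simp: hom_def)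
  show "zt e \<in> hom T.bas (fob (cbase m) (S.ext_ob e)) (T.ext_ob (fob (ctotal m) e))"
    "fob (chi (ctgt m)) (fob (ctotal m) e) \<cdot>\<^bsub>T.bas\<^esub> zt e = far (cbase m) (fob (chi (csrc m)) e)"
    using zeta_comps[OF e] * by (auto simp: squares_def src_far[OF base] T.B.chase far_Ar[OF base]
      tgt_far[OF base])
qed

lemma zt_natural:
  assumes f: "f \<in> hom S.tot a b"
  shows "T.ext_ar (far (ctotal m) f) \<cdot>\<^bsub>T.bas\<^esub> zt a = zt b \<cdot>\<^bsub>T.bas\<^esub> far (cbase m) (S.ext_ar f)"
proof -
  note [simp] = functor_betwD(2,3)[OF base] functor_betwD(2,3)[OF total] nt_betwD[OF zeta_nt] S.Dom_chi
  note ab = S.E.hom_Ob[OF f]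
  have "f \<in> Ar S.tot" using f by (simp add: hom_def)
  note [simp] = this
  have [simp]: "far (chi (csrc m)) f \<in> squares S.bas" using S.far_chi_squares[OF f] .
  note Hf = far_hom[OF total f]
  note F = far_square[OF base S.far_chi_squares[OF f]]
  show ?thesis
    using naturality[OF zeta_nt zeta_src f] zeta_comps[OF ab(1)] zeta_comps[OF ab(2)] F
      T.far_chi_squares[OF Hf] T.far_chi[OF Hf]
    by (simp add: square.map_sel S.far_chi[OF f])
qed

end

lemma lax_comp_morphismI:
  assumes Q: "comprehension_category (csrc m)" and Q': "comprehension_category (ctgt m)"
    and m: "fib_1cell (cfib (csrc m)) (cfib (ctgt m)) (cbase m) (ctotal m)"
    and zeta: "zeta m : (cbase m)\<^bold>\<two> \<circ>\<^sub>F chi (csrc m) \<Rightarrow>\<^sub>N chi (ctgt m) \<circ>\<^sub>F ctotal m"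
    and cod: "\<And>e. e \<in> Ob (total_cat (cfib (csrc m))) \<Longrightarrow> sq_cod (cpt (zeta m) e) =
      ide (base_cat (cfib (ctgt m))) (fob (cbase m) (fob (proj (cfib (csrc m))) e))"
  shows "lax_comp_morphism m"
proof -
  interpret S: comprehension_category "csrc m" by fact
  interpret T: comprehension_category "ctgt m" by fact
  note base = fib_1cellD(1)[OF m] and total = fib_1cellD(2)[OF m]
  note src = fcomp_betw[OF S.chi arrow_functor_betw[OF base]]
  note [simp] = functor_betwD(2,3)[OF base] functor_betwD(2,3)[OF total] S.Dom_chi T.Dom_chi T.Cod_chi
    nt_betwD[OF zeta]
  have "cod_functor T.bas \<rhd> zeta m = idn (cbase m \<circ>\<^sub>F S.prj)"
  proof (rule nt_eqI[where S = "Ob S.tot"])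
    show "ntgt (cod_functor T.bas \<rhd> zeta m) = ntgt (idn (cbase m \<circ>\<^sub>F S.prj))"
      using fcomp_assoc[OF total T.chi, of "cod_functor T.bas"] fib_1cellD(3)[OF m]
        by (simp add: T.cod_chi)
    \<comment> \<open>The codomain functor is natural in the category, which identifies the source
      functors of the two transformations.\<close>
    have cB: "cod_functor T.bas \<circ>\<^sub>F (cbase m)\<^bold>\<two> = cbase m \<circ>\<^sub>F cod_functor S.bas"
      using S.B.tgt_closed far_square[OF base]
      by (auto simp: fcomp_def cod_functor_def arrow_functor_def compose_def fun_eq_iff square.map_sel
        functor_chase[OF base])
    have "cod_functor T.bas \<circ>\<^sub>F (cbase m)\<^bold>\<two> \<circ>\<^sub>F chi (csrc m) = cbase m \<circ>\<^sub>F (cod_functor S.bas \<circ>\<^sub>F chi (csrc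
        m))"
      using fcomp_assoc[OF S.chi arrow_functor_betw[OF base], of "cod_functor T.bas"]
        fcomp_assoc[OF S.chi cod_functor_betw[OF S.B.category_axioms], of "cbase m"]
      by (simp add: cB)
    then show "nsrc (cod_functor T.bas \<rhd> zeta m) = nsrc (idn (cbase m \<circ>\<^sub>F S.prj))"
      by (simp add: S.cod_chi)
  qed (use cpt_hom[OF zeta src] cod in \<open>auto simp: whisk_left_def idn_def cod_functor_def hom_arrow_cat\<close>)
  then show ?thesis
    by (intro lax_comp_morphism.intro) (use Q Q' m zeta in auto)
qed

section \<open>Lax squares of functors\<close>

text \<open>
  The domain part of a structure cell \<open>\<zeta>\<close> is a family \<open>z : F S \<Rightarrow> S' H\<close>, where \<open>F\<close> is the base
  functor and \<open>S\<close> the domain part of \<open>\<chi>\<close>.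
\<close>

lemma lax_square_vcomp:
  fixes A' (structure)
  assumes S: "S : E \<rightarrow>\<^sub>F A" and S': "S' : E' \<rightarrow>\<^sub>F A'"
    and H: "H : E \<rightarrow>\<^sub>F E'" and F: "F : A \<rightarrow>\<^sub>F A'"
    and \<phi>: "\<phi> : H \<Rightarrow>\<^sub>N H\<^sub>1" and \<phi>': "\<phi>' : H\<^sub>1 \<Rightarrow>\<^sub>N H\<^sub>2" and \<psi>: "\<psi> : F \<Rightarrow>\<^sub>N F\<^sub>1" and \<psi>': "\<psi>' : F\<^sub>1 \<Rightarrow>\<^sub>N F\<^sub>2"
    and e: "e \<in> Ob E"
    and z: "z \<in> hom A' (fob F (fob S e)) (fob S' (fob H e))"
    and z1: "z\<^sub>1 \<in> hom A' (fob F\<^sub>1 (fob S e)) (fob S' (fob H\<^sub>1 e))"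
    and z2: "z\<^sub>2 \<in> hom A' (fob F\<^sub>2 (fob S e)) (fob S' (fob H\<^sub>2 e))"
    and c1: "far S' (cpt \<phi> e) \<cdot> z = z\<^sub>1 \<cdot> cpt \<psi> (fob S e)"
    and c2: "far S' (cpt \<phi>' e) \<cdot> z\<^sub>1 = z\<^sub>2 \<cdot> cpt \<psi>' (fob S e)"
  shows "far S' (cpt (\<phi>' \<bullet>\<^sub>N \<phi>) e) \<cdot> z = z\<^sub>2 \<cdot> cpt (\<psi>' \<bullet>\<^sub>N \<psi>) (fob S e)"
proof -
  interpret A': category A' using functor_betwD[OF S'] by simp
  note H1 = nt_tgt_betw[OF \<phi> H] and F1 = nt_tgt_betw[OF \<psi> F]
  note [simp] = functor_betwD(2,3)[OF H] functor_betwD(2,3)[OF F] nt_betwD[OF \<phi>] nt_betwD[OF \<psi>]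
  have Se: "fob S e \<in> Ob A" using fob_Ob[OF S e] .
  note homs = z z1 z2 far_hom[OF S' cpt_hom[OF \<phi> H e]] far_hom[OF S' cpt_hom[OF \<phi>' H1 e]]
    cpt_hom[OF \<psi> F Se] cpt_hom[OF \<psi>' F1 Se]
  have "far S' (cpt (\<phi>' \<bullet>\<^sub>N \<phi>) e) \<cdot> z = (far S' (cpt \<phi>' e) \<cdot> far S' (cpt \<phi> e)) \<cdot> z"
    using e by (simp add: far_cmp[OF S'] cpt_chase[OF \<phi> H] cpt_chase[OF \<phi>' H1])
  also have "\<dots> = far S' (cpt \<phi>' e) \<cdot> (far S' (cpt \<phi> e) \<cdot> z)"
    using homs by (simp add: hom_def A'.assoc)
  also have "\<dots> = (far S' (cpt \<phi>' e) \<cdot> z\<^sub>1) \<cdot> cpt \<psi> (fob S e)"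
    unfolding c1 using homs by (simp add: hom_def A'.assoc)
  also have "\<dots> = z\<^sub>2 \<cdot> (cpt \<psi>' (fob S e) \<cdot> cpt \<psi> (fob S e))"
    unfolding c2 using homs by (simp add: hom_def A'.assoc)
  finally show ?thesis using Se by simp
qed

text \<open>The structure map of a composite is \<open>z'\<close> at \<open>fob H e\<close> after
  the image of \<open>z e\<close> under \<open>F'\<close>. Besides \<open>c\<close> and
  \<open>c'\<close>, two exchanges are needed: naturality of \<open>z'\<close> at the component of
  \<open>\<phi>\<close>, and naturality of \<open>\<psi>'\<close> at
  \<open>z\<^sub>1 e\<close>.\<close>

lemma lax_square_hcomp:
  fixes A'' (structure)
  assumes S: "S : E \<rightarrow>\<^sub>F A" and S': "S' : E' \<rightarrow>\<^sub>F A'" and S'': "S'' : E'' \<rightarrow>\<^sub>F A''"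
    and H: "H : E \<rightarrow>\<^sub>F E'" and H': "H' : E' \<rightarrow>\<^sub>F E''" and F: "F : A \<rightarrow>\<^sub>F A'" and F': "F' : A' \<rightarrow>\<^sub>F A''"
    and \<phi>: "\<phi> : H \<Rightarrow>\<^sub>N H\<^sub>1" and \<phi>': "\<phi>' : H' \<Rightarrow>\<^sub>N H\<^sub>1'" and \<psi>: "\<psi> : F \<Rightarrow>\<^sub>N F\<^sub>1" and \<psi>': "\<psi>' : F' \<Rightarrow>\<^sub>N F\<^sub>1'"
    and z: "\<And>e. e \<in> Ob E \<Longrightarrow> z e \<in> hom A' (fob F (fob S e)) (fob S' (fob H e))"
    and z1: "\<And>e. e \<in> Ob E \<Longrightarrow> z\<^sub>1 e \<in> hom A' (fob F\<^sub>1 (fob S e)) (fob S' (fob H\<^sub>1 e))"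
    and z': "\<And>e. e \<in> Ob E' \<Longrightarrow> z' e \<in> hom A'' (fob F' (fob S' e)) (fob S'' (fob H' e))"
    and z1': "\<And>e. e \<in> Ob E' \<Longrightarrow> z\<^sub>1' e \<in> hom A'' (fob F\<^sub>1' (fob S' e)) (fob S'' (fob H\<^sub>1' e))"
    and z'_nat: "\<And>f a b. f \<in> hom E' a b \<Longrightarrow> far S'' (far H' f) \<cdot> z' a = z' b \<cdot> far F' (far S' f)"
    and c: "\<And>e. e \<in> Ob E \<Longrightarrow> far S' (cpt \<phi> e) \<cdot>\<^bsub>A'\<^esub> z e = z\<^sub>1 e \<cdot>\<^bsub>A'\<^esub> cpt \<psi> (fob S e)"
    and c': "\<And>e. e \<in> Ob E' \<Longrightarrow> far S'' (cpt \<phi>' e) \<cdot> z' e = z\<^sub>1' e \<cdot> cpt \<psi>' (fob S' e)"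
    and e: "e \<in> Ob E"
  shows "far S'' (cpt (\<phi>' \<star>\<^sub>N \<phi>) e) \<cdot> (z' (fob H e) \<cdot> far F' (z e)) =
    (z\<^sub>1' (fob H\<^sub>1 e) \<cdot> far F\<^sub>1' (z\<^sub>1 e)) \<cdot> cpt (\<psi>' \<star>\<^sub>N \<psi>) (fob S e)"
proof -
  interpret A'': category A'' using functor_betwD[OF S''] by simp
  note H1 = nt_tgt_betw[OF \<phi> H] and F1 = nt_tgt_betw[OF \<psi> F]
    and H1' = nt_tgt_betw[OF \<phi>' H'] and F1' = nt_tgt_betw[OF \<psi>' F']
  have Se: "fob S e \<in> Ob A" using fob_Ob[OF S e] .
  have He: "fob H e \<in> Ob E'" using fob_Ob[OF H e] .
  have H1e: "fob H\<^sub>1 e \<in> Ob E'" using fob_Ob[OF H1 e] .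
  have SH1e: "fob S' (fob H\<^sub>1 e) \<in> Ob A'" using fob_Ob[OF S' H1e] .
  have FSe: "fob F\<^sub>1 (fob S e) \<in> Ob A'" using fob_Ob[OF F1 Se] .
  note phi = cpt_hom[OF \<phi> H e] and phi' = cpt_hom[OF \<phi>' H' H1e]
    and psi = cpt_hom[OF \<psi> F Se] and psi' = cpt_hom[OF \<psi>' F' SH1e] and psi1' = cpt_hom[OF \<psi>' F' FSe]
  note homs = far_hom[OF S'' phi'] far_hom[OF S'' far_hom[OF H' phi]] z'[OF He] z'[OF H1e]
    far_hom[OF F' z[OF e]]
    far_hom[OF F' z1[OF e]] far_hom[OF F1' z1[OF e]] far_hom[OF F' far_hom[OF S' phi]] z1'[OF H1e]
    psi' psi1' far_hom[OF F' psi]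
  have "far S'' (cpt (\<phi>' \<star>\<^sub>N \<phi>) e) \<cdot> (z' (fob H e) \<cdot> far F' (z e)) =
    (far S'' (cpt \<phi>' (fob H\<^sub>1 e)) \<cdot> far S'' (far H' (cpt \<phi> e))) \<cdot> (z' (fob H e) \<cdot> far F' (z e))"
    using phi' far_hom[OF H' phi] by (simp add: hcomp_cpt[OF H H' \<phi> \<phi>' e] far_cmp[OF S''] hom_def)
  also have "\<dots> = far S'' (cpt \<phi>' (fob H\<^sub>1 e)) \<cdot> (far S'' (far H' (cpt \<phi> e)) \<cdot> z' (fob H e))
      \<cdot> far F' (z e)"
    using homs by (simp add: hom_def A''.chase)
  also have "\<dots> = (far S'' (cpt \<phi>' (fob H\<^sub>1 e)) \<cdot> z' (fob H\<^sub>1 e)) \<cdot> (far F' (far S' (cpt \<phi> e))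
      \<cdot> far F' (z e))"
    unfolding z'_nat[OF phi] using homs by (simp add: hom_def A''.chase)
  also have "far F' (far S' (cpt \<phi> e)) \<cdot> far F' (z e) = far F' (far S' (cpt \<phi> e) \<cdot>\<^bsub>A'\<^esub> z e)"
    using far_hom[OF S' phi] z[OF e] by (simp add: hom_def far_cmp[OF F'])
  also have "\<dots> = far F' (z\<^sub>1 e) \<cdot> far F' (cpt \<psi> (fob S e))"
    unfolding c[OF e] using z1[OF e] psi by (simp add: hom_def far_cmp[OF F'])
  also have "(far S'' (cpt \<phi>' (fob H\<^sub>1 e)) \<cdot> z' (fob H\<^sub>1 e)) \<cdot> (far F' (z\<^sub>1 e) \<cdot> far F' (cpt \<psi> (fob S e))) =
    z\<^sub>1' (fob H\<^sub>1 e) \<cdot> (cpt \<psi>' (fob S' (fob H\<^sub>1 e)) \<cdot> far F' (z\<^sub>1 e)) \<cdot> far F' (cpt \<psi> (fob S e))"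
    unfolding c'[OF H1e] using homs by (simp add: hom_def A''.chase)
  also have "\<dots> = (z\<^sub>1' (fob H\<^sub>1 e) \<cdot> far F\<^sub>1' (z\<^sub>1 e)) \<cdot> (cpt \<psi>' (fob F\<^sub>1 (fob S e))
      \<cdot> far F' (cpt \<psi> (fob S e)))"
    unfolding naturality[OF \<psi>' F' z1[OF e], symmetric] using homs by (simp add: hom_def A''.chase)
  finally show ?thesis by (simp add: hcomp_cpt[OF F F' \<psi> \<psi>' Se])
qed

section \<open>The 2-category of comprehension categories\<close>

text \<open>This is the domain functor after \<open>chi\<close>, that is, context extension. For
  \<open>Y0 W\<close> it is the projection after \<open>wK W\<close>. It replaces squares by arrows
  of the base, to which the pasting lemmas apply.\<close>

definition ext_functor :: "('e, 'f, 'o, 'a) compcat \<Rightarrow> ('e, 'f, 'o, 'a) func" where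
  "ext_functor Q = \<lparr>Dom = total_cat (cfib Q), Cod = base_cat (cfib Q),
     fob = (\<lambda>e\<in>Ob (total_cat (cfib Q)). src (base_cat (cfib Q)) (fob (chi Q) e)),
     far = (\<lambda>f\<in>Ar (total_cat (cfib Q)). sq_dom (far (chi Q) f))\<rparr>"

lemma ext_functor_simps [simp]:
  "e \<in> Ob (total_cat (cfib Q)) \<Longrightarrow> fob (ext_functor Q) e = src (base_cat (cfib Q)) (fob (chi Q) e)"
  "f \<in> Ar (total_cat (cfib Q)) \<Longrightarrow> far (ext_functor Q) f = sq_dom (far (chi Q) f)"
  by (simp_all add: ext_functor_def)

context comprehension_category
begin

lemma ext_ar_ide:
  assumes "e \<in> Ob tot" shows "ext_ar (ide tot e) = ide bas (ext_ob e)"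
  using fob_chi[OF assms] assms by (simp add: far_ide[OF chi] hom_def)

lemma ext_functor: "ext_functor Q : tot \<rightarrow>\<^sub>F bas"
proof (rule functor_betwI[OF E.category_axioms B.category_axioms])
  fix f g a b c assume *: "f \<in> hom tot a b" "g \<in> hom tot b c"
  then show "far (ext_functor Q) (g \<cdot>\<^bsub>tot\<^esub> f) = far (ext_functor Q) g \<cdot>\<^bsub>bas\<^esub> far (ext_functor Q) f"
    using ext_ar_cmp[OF *] by (simp add: hom_def E.chase)
qed (use fob_chi ext_ar ext_ar_ide B.hom_Ob E.ide_Ar in \<open>auto simp: ext_functor_def hom_def\<close>)

end

lemma compmor_simps [simp]: "csrc (compmor_comp n m) = csrc m" "ctgt (compmor_comp n m) = ctgt n"
  "cbase (compmor_comp n m) = cbase n \<circ>\<^sub>F cbase m" "ctotal (compmor_comp n m) = ctotal n \<circ>\<^sub>F ctotal m"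
  "csrc (compmor_id Q) = Q" "ctgt (compmor_id Q) = Q"
  "cbase (compmor_id Q) = idf (base_cat (cfib Q))" "ctotal (compmor_id Q) = idf (total_cat (cfib Q))"
  by (simp_all add: compmor_comp_def compmor_id_def)

text \<open>By \<open>zeta_comps\<close> the other parts of a component of \<open>zeta\<close> are
  determined by the remaining fields. Laws of 1-cells thus become equations between arrows of the
  base.\<close>

lemma lax_comp_eqI:
  assumes m: "lax_comp_morphism m" and n: "lax_comp_morphism n"
    and eq: "csrc m = csrc n" "ctgt m = ctgt n" "cbase m = cbase n" "ctotal m = ctotal n"
    and z: "\<And>e. e \<in> Ob (total_cat (cfib (csrc n))) \<Longrightarrow> sq_dom (cpt (zeta m) e) = sq_dom (cpt (zeta n) e)"
  shows "m = n"
proof -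
  interpret m: lax_comp_morphism m by fact
  interpret n: lax_comp_morphism n by fact
  have "zeta m = zeta n"
  proof (rule nt_eqI[where S = "Ob (total_cat (cfib (csrc n)))"])
    show "cpt (zeta m) e = cpt (zeta n) e" if "e \<in> Ob (total_cat (cfib (csrc n)))" for e
      using m.zeta_comps[of e] n.zeta_comps[of e] that z[OF that] eq by (auto intro!: square.expand)
  qed (use m.zeta_ext n.zeta_ext nt_betwD[OF m.zeta_nt] nt_betwD[OF n.zeta_nt] eq in auto)
  then show ?thesis using eq by simp
qed

lemma compmor_id_zeta:
  assumes Q: "comprehension_category Q" and e: "e \<in> Ob (total_cat (cfib Q))"
  shows "cpt (zeta (compmor_id Q)) e = Square (fob (chi Q) e) (fob (chi Q) e)
    (ide (base_cat (cfib Q)) (src (base_cat (cfib Q)) (fob (chi Q) e)))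
      (ide (base_cat (cfib Q)) (fob (proj (cfib Q)) e))"
proof -
  interpret comprehension_category Q by fact
  show ?thesis using fob_chi[OF e] e by (simp add: compmor_id_def idn_def Dom_chi Cod_chi hom_def)
qed

lemma compmor_id_lax:
  assumes Q: "comprehension_category Q" shows "lax_comp_morphism (compmor_id Q)"
proof -
  interpret comprehension_category Q by fact
  have "zeta (compmor_id Q) : (idf bas)\<^bold>\<two> \<circ>\<^sub>F chi Q \<Rightarrow>\<^sub>N chi Q \<circ>\<^sub>F idf tot"
    using idn_betw[OF chi]
    by (simp add: compmor_id_def arrow_functor_idf[OF B.category_axioms] fcomp_idf_left[OF chi]
      fcomp_idf_right[OF chi])
  then show ?thesis
    by (intro lax_comp_morphismI)
      (use Q fib_1cell_id[OF proj_functor] fob_Ob[OF proj] in \<open>simp_all add: compmor_id_zeta[OF Q]\<close>)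
qed

lemma
  assumes m: "lax_comp_morphism m" and n: "lax_comp_morphism n" and mn: "ctgt m = csrc n"
  shows compmor_comp_lax: "lax_comp_morphism (compmor_comp n m)"
    and compmor_comp_zt: "e \<in> Ob (total_cat (cfib (csrc m))) \<Longrightarrow> sq_dom (cpt (zeta (compmor_comp n m)) e) =
      sq_dom (cpt (zeta n) (fob (ctotal m) e)) \<cdot>\<^bsub>base_cat (cfib (ctgt n))\<^esub> far (cbase n)
          (sq_dom (cpt (zeta m) e))"
proof -
  interpret m: lax_comp_morphism m by fact
  interpret n: lax_comp_morphism n by fact
  note [simp] = functor_betwD(2,3)[OF m.total] functor_betwD(2,3)[OF m.base]
    functor_betwD(2,3)[OF n.total] functor_betwD(2,3)[OF n.base] m.S.Dom_chi nt_betwD[OF m.zeta_nt]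
        nt_betwD[OF n.zeta_nt]
  note nbase = n.base[folded mn] and ntotal = n.total[folded mn]
  note nbase2 = arrow_functor_betw[OF nbase]
  \<comment> \<open>The codomain part is computed along with the domain part because
    \<open>lax_comp_morphismI\<close> asks for it to be an identity.\<close>
  have cpt: "sq_dom (cpt (zeta (compmor_comp n m)) e) = n.zt (fob (ctotal m) e)
      \<cdot>\<^bsub>n.T.bas\<^esub> far (cbase n) (m.zt e) \<and>
      sq_cod (cpt (zeta (compmor_comp n m)) e) = ide n.T.bas
          (fob (cbase n) (fob (cbase m) (fob m.S.prj e)))"
    if e: "e \<in> Ob m.S.tot" for e
  proof -
    have sq: "map_square (far (cbase n)) (cpt (zeta m) e) \<in> squares n.T.bas"
      by (rule far_square[OF nbase m.zeta_comps(4)[OF e]])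
    note He = fob_Ob[OF m.total e, unfolded mn] and pe = fob_Ob[OF m.base fob_Ob[OF m.S.proj e]]
    show ?thesis
      using e m.zeta_comps[OF e] n.zeta_comps[OF He] sq mn far_ide[OF nbase pe] fob_Ob[OF nbase pe]
        m.proj_total(1)[OF e]
      by (simp add: compmor_comp_def square.map_sel n.T.B.chase)
  qed
  then show "sq_dom (cpt (zeta (compmor_comp n m)) e) =
      sq_dom (cpt (zeta n) (fob (ctotal m) e)) \<cdot>\<^bsub>base_cat (cfib (ctgt n))\<^esub> far (cbase n)
          (sq_dom (cpt (zeta m) e))"
    if "e \<in> Ob (total_cat (cfib (csrc m)))" using that by simp
  \<comment> \<open>The middle functors of the two whiskerings agree only after reassociation, and
    on the source side the arrow functor of a composite has to be split.\<close>
  have "(cbase n)\<^bold>\<two> \<rhd> zeta m : (cbase n \<circ>\<^sub>F cbase m)\<^bold>\<two> \<circ>\<^sub>F chi (csrc m)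
      \<Rightarrow>\<^sub>N ((cbase n)\<^bold>\<two> \<circ>\<^sub>F chi (csrc n)) \<circ>\<^sub>F ctotal m"
    using whisk_left_betw[OF m.zeta_src nbase2 m.zeta_nt] fcomp_assoc[OF m.S.chi
      arrow_functor_betw[OF m.base], of "(cbase n)\<^bold>\<two>"]
      fcomp_assoc[OF m.total m.T.chi, of "(cbase n)\<^bold>\<two>"]
    by (simp add: arrow_functor_fcomp[OF m.base nbase] mn)
  moreover have "zeta n \<lhd> ctotal m : ((cbase n)\<^bold>\<two> \<circ>\<^sub>F chi (csrc n)) \<circ>\<^sub>F ctotal m
      \<Rightarrow>\<^sub>N chi (ctgt n) \<circ>\<^sub>F ctotal n \<circ>\<^sub>F ctotal m"
    using whisk_right_betw[OF n.zeta_src m.total[unfolded mn] n.zeta_nt]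
      fcomp_assoc[OF m.total ntotal, of "chi (ctgt n)"] by (simp add: mn)
  ultimately have "zeta (compmor_comp n m) : (cbase n \<circ>\<^sub>F cbase m)\<^bold>\<two> \<circ>\<^sub>F chi (csrc m)
      \<Rightarrow>\<^sub>N chi (ctgt n) \<circ>\<^sub>F ctotal n \<circ>\<^sub>F ctotal m"
    unfolding compmor_comp_def compmor.simps
    by (rule vcomp_betw[OF fcomp_betw[OF m.S.chi arrow_functor_betw[OF fcomp_betw[OF m.base nbase]]]])
  then show "lax_comp_morphism (compmor_comp n m)"
    using fib_1cell_comp[OF m.fib_1cell n.fib_1cell[folded mn] m.S.proj_functor m.T.proj_functor] cpt
      fob_Ob[OF m.S.proj]
    by (intro lax_comp_morphismI) (simp_all add: m.src_comprehension n.tgt_comprehension)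
qed

text \<open>The codomain parts of the two sides are the projection of \<open>\<phi>\<close> and
  \<open>\<psi>\<close> at the projected object, which agree because the pair is a 2-cell of
  \<open>Fib\<close>. Only the domain parts are left to compare.\<close>

lemma zeta_compat_iff:
  assumes m: "lax_comp_morphism m" and n: "lax_comp_morphism n"
      and mn: "csrc n = csrc m" "ctgt n = ctgt m"
    and t: "fib_2cell (cfib (csrc m)) (cfib (ctgt m)) (cbase m) (ctotal m) (cbase n) (ctotal n) \<psi> \<phi>"
  shows "(chi (ctgt m) \<rhd> \<phi>) \<bullet>\<^sub>N zeta m = zeta n \<bullet>\<^sub>N (arrow_nt \<psi> \<lhd> chi (csrc m)) \<longleftrightarrow>
    (\<forall>e\<in>Ob (total_cat (cfib (csrc m))).
      far (ext_functor (ctgt m)) (cpt \<phi> e) \<cdot>\<^bsub>base_cat (cfib (ctgt m))\<^esub> sq_dom (cpt (zeta m) e) =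
      sq_dom (cpt (zeta n) e) \<cdot>\<^bsub>base_cat (cfib (ctgt m))\<^esub> cpt \<psi> (fob (ext_functor (csrc m)) e))"
    (is "?l = ?r \<longleftrightarrow> (\<forall>e\<in>_. ?c e)")
proof -
  interpret m: lax_comp_morphism m by fact
  interpret n: lax_comp_morphism n by fact
  note mb = m.base and mt = m.total and nb = n.base[unfolded mn] and nt = n.total[unfolded mn]
  note t' = t[unfolded fib_2cell_iff[OF m.S.proj_functor m.fib_1cell n.fib_1cell[unfolded mn]]]
  have psi: "\<psi> : cbase m \<Rightarrow>\<^sub>N cbase n" and phi: "\<phi> : ctotal m \<Rightarrow>\<^sub>N ctotal n" using t' by auto
  note [simp] = functor_betwD(2,3)[OF mb] functor_betwD(2,3)[OF mt]
    functor_betwD(2,3)[OF nb] functor_betwD(2,3)[OF nt] m.S.Dom_chi nt_betwD[OF m.zeta_nt]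
        nt_betwD[OF n.zeta_nt]
    nt_betwD[OF psi] nt_betwD[OF phi]
  have pt: "cpt ?l e = cpt ?r e \<longleftrightarrow> ?c e" if e: "e \<in> Ob m.S.tot" for e
  proof -
    note phe = cpt_hom[OF phi mt e]
    have fc: "fob (chi (csrc m)) e \<in> Ar m.S.bas" "tgt m.S.bas (fob (chi (csrc m)) e) = fob m.S.prj e"
      "fob m.S.prj e \<in> Ob m.S.bas"  "m.S.ext_ob e \<in> Ob m.S.bas"
      using m.S.fob_chi[OF e] fob_Ob[OF m.S.proj e] m.S.B.src_closed by (auto simp: hom_def)
    note nz = n.zeta_comps[unfolded mn, OF e]
    \<comment> \<open>Commutativity is naturality of \<open>\<psi>\<close> at the arrow that
      \<open>chi\<close> assigns to \<open>e\<close>.\<close>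
    have sq: "cpt (arrow_nt \<psi>) (fob (chi (csrc m)) e) \<in> squares m.T.bas"
      using fc cpt_hom[OF psi mb fc(3)] cpt_hom[OF psi mb fc(4)] naturality[OF psi mb hom_self[OF fc(1)]]
      by (simp add: squares_def functor_chase[OF mb] functor_chase[OF nb])
    show ?thesis
      using e fc m.zeta_comps[OF e] nz sq m.T.far_chi_squares[OF phe] m.T.far_chi[OF phe]
        cpt_hom[OF psi mb fc(3)] phe t' by (simp add: mn) (simp add: hom_def m.T.B.chase)
  qed
  show ?thesis
  proof
    assume "?l = ?r" then show "\<forall>e\<in>Ob m.S.tot. ?c e" using pt by simp
  next
    assume *: "\<forall>e\<in>Ob m.S.tot. ?c e"
    show "?l = ?r"
      by (rule nt_eqI[where S = "Ob m.S.tot"]) (use * pt in \<open>simp_all add: mn vcomp_def\<close>)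
  qed
qed

definition comp_compat :: "(('e, 'f, 'o, 'a) compmor, 'e, 'f, 'o, 'a) fib2 \<Rightarrow> bool" where
  "comp_compat t \<longleftrightarrow> (\<forall>e\<in>Ob (total_cat (cfib (csrc (csrc2 t)))).
      far (ext_functor (ctgt (csrc2 t))) (cpt (total_nt t) e) \<cdot>\<^bsub>base_cat (cfib (ctgt (csrc2 t)))\<^esub> sq_dom
          (cpt (zeta (csrc2 t)) e) =
      sq_dom (cpt (zeta (ctgt2 t)) e) \<cdot>\<^bsub>base_cat (cfib (ctgt (csrc2 t)))\<^esub> cpt (base_nt t)
          (fob (ext_functor (csrc (csrc2 t))) e))"

lemma comp_2cell_iff: "comp_2cell t \<longleftrightarrow> lax_comp_morphism (csrc2 t) \<and> lax_comp_morphism (ctgt2 t) \<and>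
   csrc (ctgt2 t) = csrc (csrc2 t) \<and> ctgt (ctgt2 t) = ctgt (csrc2 t) \<and>
   fib_2cell (cfib (csrc (csrc2 t))) (cfib (ctgt (csrc2 t)))
          (cbase (csrc2 t)) (ctotal (csrc2 t)) (cbase (ctgt2 t)) (ctotal (ctgt2 t))
          (base_nt t) (total_nt t) \<and> comp_compat t"
  using zeta_compat_iff[of "csrc2 t" "ctgt2 t" "base_nt t" "total_nt t"]
  unfolding comp_2cell_def comp_compat_def by blast

section \<open>Comprehension categories as a 2-category over \<open>Fib\<close>\<close>

lemma CompCat_simps [simp]: "Cell0 CompCat = {Q. comprehension_category Q}"
    "Cell1 CompCat = {m. lax_comp_morphism m}"
  "Cell2 CompCat = {t. comp_2cell t}" "dom1 CompCat = csrc" "cod1 CompCat = ctgt" "dom2 CompCat = csrc2"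
      "cod2 CompCat = ctgt2"
  "id1 CompCat = compmor_id" "cmp1 CompCat = compmor_comp" "vcmp CompCat = fib2_vcmp"
      "hcmp CompCat = fib2_hcmp compmor_comp"
  "id2 CompCat = (\<lambda>m. \<lparr>csrc2 = m, ctgt2 = m, base_nt = idn (cbase m), total_nt = idn (ctotal m)\<rparr>)"
  by (simp_all add: CompCat_def)

lemma cells1_CompCat: "m \<in> cells1 CompCat Q Q' \<longleftrightarrow> lax_comp_morphism m \<and> csrc m = Q \<and> ctgt m = Q'"
  by (auto simp: cells1_def)

lemma cells2_CompCat: "t \<in> cells2 CompCat m n \<longleftrightarrow> comp_2cell t \<and> csrc2 t = m \<and> ctgt2 t = n"
  by (auto simp: cells2_def)

lemma fib2_2cell_betw:
  assumes "fib_2cell P P' B H C K \<psi> \<phi>" shows "\<psi> : B \<Rightarrow>\<^sub>N C" "\<phi> : H \<Rightarrow>\<^sub>N K"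
  using assms by (simp_all add: fib_2cell_def)

text \<open>Laws of 1-cells are compared through \<open>zt\<close>. Closure of the 2-cell condition
  under both compositions is pasting of lax squares over the functors
  \<open>ext_functor\<close>.\<close>

interpretation CompCat: over_Fib CompCat cfib cbase ctotal comp_compat
proof (rule over_Fib.intro, goal_cases)
  case (1 f) then show ?case by (simp add: lax_comp_morphism.src_comprehension)
next
  case (2 f) then show ?case by (simp add: lax_comp_morphism.tgt_comprehension)
next
  case (3 a) then show ?case by (simp add: cells1_CompCat compmor_id_lax)
next
  case (4 f a b g c) then show ?case by (auto simp: cells1_CompCat compmor_comp_lax)
next
  case (5 f a b)
  then have f: "lax_comp_morphism f" "csrc f = a" "ctgt f = b" by (auto simp: cells1_CompCat)
  interpret f: lax_comp_morphism f by (rule f)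
  note [simp] = fcomp_idf_left[OF f.base] fcomp_idf_left[OF f.total]
  have i: "lax_comp_morphism (compmor_id (ctgt f))" by (rule compmor_id_lax[OF f.tgt_comprehension])
  have "compmor_comp (compmor_id (ctgt f)) f = f"
  proof (rule lax_comp_eqI[OF compmor_comp_lax[OF f(1) i] f(1)])
    fix e assume e: "e \<in> Ob f.S.tot"
    note He = fob_Ob[OF f.total e]
    show "sq_dom (cpt (zeta (compmor_comp (compmor_id (ctgt f)) f)) e) = f.zt e"
      using e f.zt[OF e]
      by (simp add: compmor_comp_zt[OF f(1) i] compmor_id_zeta[OF f.tgt_comprehension He] hom_def
        f.T.B.chase)
  qed simp_all
  then show ?case by (simp add: f)
next
  case (6 f a b)
  then have f: "lax_comp_morphism f" "csrc f = a" "ctgt f = b" by (auto simp: cells1_CompCat)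
  interpret f: lax_comp_morphism f by (rule f)
  note [simp] = fcomp_idf_right[OF f.base] fcomp_idf_right[OF f.total]
  have i: "lax_comp_morphism (compmor_id (csrc f))" by (rule compmor_id_lax[OF f.src_comprehension])
  have "compmor_comp f (compmor_id (csrc f)) = f"
  proof (rule lax_comp_eqI[OF compmor_comp_lax[OF i f(1)] f(1)])
    fix e assume e: "e \<in> Ob f.S.tot"
    have "f.S.ext_ob e \<in> Ob f.S.bas" using fob_Ob[OF f.S.ext_functor e] e by simp
    then show "sq_dom (cpt (zeta (compmor_comp f (compmor_id (csrc f)))) e) = f.zt e"
      using e f.zt[OF e]
      by (simp add: compmor_comp_zt[OF i f(1)] compmor_id_zeta[OF f.src_comprehension e]
        far_ide[OF f.base] hom_def f.T.B.chase)
  qed simp_all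
  then show ?case by (simp add: f)
next
  case (7 f a b g c h d)
  then have l: "lax_comp_morphism f" "lax_comp_morphism g" "lax_comp_morphism h" "ctgt f = csrc g"
      "ctgt g = csrc h" by (auto simp: cells1_CompCat)
  interpret f: lax_comp_morphism f by (rule l)
  interpret g: lax_comp_morphism g by (rule l)
  interpret h: lax_comp_morphism h by (rule l)
  note fg = compmor_comp_lax[OF l(1,2,4)] and gh = compmor_comp_lax[OF l(2,3,5)]
  note gb = g.base[folded l(4)] and gt = g.total[folded l(4)] and hb = h.base[folded l(5)]
    and ht = h.total[folded l(5)]
  have "compmor_comp (compmor_comp h g) f = compmor_comp h (compmor_comp g f)"
  proof (rule lax_comp_eqI)
    show *: "lax_comp_morphism (compmor_comp (compmor_comp h g) f)"
      by (rule compmor_comp_lax[OF l(1) gh]) (simp add: l)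
    show **: "lax_comp_morphism (compmor_comp h (compmor_comp g f))"
      by (rule compmor_comp_lax[OF fg l(3)]) (simp add: l)
    show "cbase (compmor_comp (compmor_comp h g) f) = cbase (compmor_comp h (compmor_comp g f))"
      "ctotal (compmor_comp (compmor_comp h g) f) = ctotal (compmor_comp h (compmor_comp g f))"
      using fcomp_assoc[OF f.base gb] fcomp_assoc[OF f.total gt] by simp_all
    fix e assume "e \<in> Ob (total_cat (cfib (csrc (compmor_comp h (compmor_comp g f)))))"
    then have e: "e \<in> Ob f.S.tot" by simp
    note He = fob_Ob[OF f.total e]
    note He' = He[unfolded l(4)]
    note H2e = fob_Ob[OF g.total He', unfolded l(5)]
    have fe: "f.zt e \<in> Ar g.S.bas" "tgt g.S.bas (f.zt e) = g.S.ext_ob (fob (ctotal f) e)"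
      using f.zt[OF e] by (simp_all add: hom_def l)
    \<comment> \<open>Both bracketings reduce to the structure maps of \<open>f\<close>,
      \<open>g\<close> and \<open>h\<close> at the successive images of \<open>e\<close>; the
      difference is absorbed by \<open>cbase h\<close> preserving composition and by
      associativity.\<close>
    show "sq_dom (cpt (zeta (compmor_comp (compmor_comp h g) f)) e)
        = sq_dom (cpt (zeta (compmor_comp h (compmor_comp g f))) e)"
      using e He He' H2e fe g.zt[OF He'] h.zt[OF H2e] functor_betwD(2,3)[OF f.total]
        functor_betwD(2,3)[OF g.base]
      by (simp add: compmor_comp_zt[OF l(1) gh] compmor_comp_zt[OF fg l(3)] compmor_comp_zt[OF l(1,2,4)]
        compmor_comp_zt[OF l(2,3,5)] l(4,5) hom_def functor_chase[OF h.base]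
            functor_chase[OF g.base[unfolded l(5)]] h.T.B.chase)
  qed simp_all
  then show ?case by simp
next
  case (8 a) then show ?case by (simp add: cloven_fibration.proj_functor comprehension_category.cloven)
next
  case (9 f a b) then show ?case by (auto simp: cells1_CompCat lax_comp_morphism.fib_1cell)
next
  case (19 t) show ?case by (simp add: comp_2cell_iff)
next
  case (20 f)
  then interpret f: lax_comp_morphism f by simp
  note [simp] = functor_betwD(2,3)[OF f.base] functor_betwD(2,3)[OF f.total]
  have "far (ext_functor (ctgt f)) (cpt (idn (ctotal f)) e) \<cdot>\<^bsub>f.T.bas\<^esub> f.zt e = f.zt e
      \<cdot>\<^bsub>f.T.bas\<^esub> cpt (idn (cbase f)) (fob (ext_functor (csrc f)) e)"
    if e: "e \<in> Ob f.S.tot" for e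
    using f.zt[OF e] fob_Ob[OF f.total e] fob_Ob[OF f.S.ext_functor e] e
    by (simp add: far_ide[OF f.T.ext_functor] f.T.ext_ar_ide hom_def f.T.B.chase)
  then show ?case by (simp add: comp_compat_def)
next
  case (21 f a b \<alpha> g \<beta> h)
  then have c: "comp_2cell \<alpha>" "comp_2cell \<beta>" "csrc2 \<alpha> = f" "ctgt2 \<alpha> = g" "csrc2 \<beta> = g" "ctgt2 \<beta> = h"
      "lax_comp_morphism f" "csrc f = a" "ctgt f = b"
    by (auto simp: cells1_CompCat cells2_CompCat)
  have d: "lax_comp_morphism g" "lax_comp_morphism h" "csrc g = a" "csrc h = a" "ctgt g = b" "ctgt h = b"
    using c(1,2)[unfolded comp_2cell_iff] c by auto
  interpret f: lax_comp_morphism f by (rule c)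
  interpret g: lax_comp_morphism g by (rule d)
  interpret h: lax_comp_morphism h by (rule d)
  note s = c(1)[unfolded comp_2cell_iff c(3-) d(3-), simplified]
    and t = c(2)[unfolded comp_2cell_iff c(3-) d(3-), simplified]
  note [simp] = c(3-9) d(3-6)
  show ?case unfolding comp_compat_def
  proof (rule ballI, goal_cases)
    case (1 e)
    then have e: "e \<in> Ob f.S.tot" by (simp add: fib2_vcmp_def)
    have s2: "fib_2cell (cfib a) (cfib b) (cbase f) (ctotal f) (cbase g) (ctotal g) (base_nt \<alpha>) (total_nt
        \<alpha>)"
      and t2: "fib_2cell (cfib a) (cfib b) (cbase g) (ctotal g) (cbase h) (ctotal h) (base_nt \<beta>)
          (total_nt \<beta>)"
      using s t by auto
    show ?case
      using lax_square_vcomp[OF f.S.ext_functor f.T.ext_functor f.total f.base fib2_2cell_betw(2)[OF s2]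
          fib2_2cell_betw(2)[OF t2] fib2_2cell_betw(1)[OF s2] fib2_2cell_betw(1)[OF t2] e, of "f.zt e"
              "g.zt e" "h.zt e"]
        s t e f.zt[OF e] g.zt[of e] h.zt[of e] fob_Ob[OF f.total e] fob_Ob[OF g.total, of e]
            fob_Ob[OF h.total, of e]
      by (simp add: comp_compat_def fib2_vcmp_def)
  qed
next
  case (22 f a b f' c \<alpha> g \<beta> g')
  then have c: "comp_2cell \<alpha>" "comp_2cell \<beta>" "csrc2 \<alpha> = f" "ctgt2 \<alpha> = g" "csrc2 \<beta> = f'" "ctgt2 \<beta> = g'"
    "lax_comp_morphism f" "csrc f = a" "ctgt f = b" "lax_comp_morphism f'" "csrc f' = b" "ctgt f' = c"
    by (auto simp: cells1_CompCat cells2_CompCat)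
  have d: "lax_comp_morphism g" "lax_comp_morphism g'" "csrc g = a" "csrc g' = b" "ctgt g = b"
      "ctgt g' = c"
    using c(1,2)[unfolded comp_2cell_iff] c by auto
  interpret f: lax_comp_morphism f by (rule c)
  interpret f': lax_comp_morphism f' by (rule c)
  interpret g: lax_comp_morphism g by (rule d)
  interpret g': lax_comp_morphism g' by (rule d)
  note s = c(1)[unfolded comp_2cell_iff c(3-) d(3-), simplified]
    and t = c(2)[unfolded comp_2cell_iff c(3-) d(3-), simplified]
  have s2: "fib_2cell (cfib a) (cfib b) (cbase f) (ctotal f) (cbase g) (ctotal g) (base_nt \<alpha>) (total_nt
      \<alpha>)"
    and t2: "fib_2cell (cfib b) (cfib c) (cbase f') (ctotal f') (cbase g') (ctotal g') (base_nt \<beta>)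
        (total_nt \<beta>)"
    using s t c d by auto
  note ff = compmor_comp_zt[OF c(7,10), unfolded c(8-) d(3-), OF refl]
  note gg = compmor_comp_zt[OF d(1,2), unfolded c(8-) d(3-), OF refl]
  note cd = c(8,9,11,12) d(3-6)
  show ?case unfolding comp_compat_def
  proof (rule ballI, goal_cases)
    case (1 e)
    then have e: "e \<in> Ob f.S.tot" by (simp add: fib2_hcmp_def c)
    then have e': "e \<in> Ob (total_cat (cfib a))" by (simp add: cd)
    note X = f.S.ext_functor[unfolded cd] f'.S.ext_functor[unfolded cd] f'.T.ext_functor[unfolded cd]
    show ?case
      using lax_square_hcomp[OF X f.total[unfolded cd] f'.total[unfolded cd] f.base[unfolded cd]
        f'.base[unfolded cd]
         fib2_2cell_betw(2)[OF s2] fib2_2cell_betw(2)[OF t2] fib2_2cell_betw(1)[OF s2]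
             fib2_2cell_betw(1)[OF t2],
         of "\<lambda>e. sq_dom (cpt (zeta f) e)" "\<lambda>e. sq_dom (cpt (zeta g) e)" "\<lambda>e. sq_dom (cpt (zeta f') e)"
             "\<lambda>e. sq_dom (cpt (zeta g') e)", OF _ _ _ _ _ _ _ e']
        f.zt[unfolded cd] f'.zt[unfolded cd] g.zt[unfolded cd] g'.zt[unfolded cd]
            f'.zt_natural[unfolded cd]
        s t e' fob_Ob[OF f.total[unfolded cd]] fob_Ob[OF f'.total[unfolded cd]]
        fob_Ob[OF g.total[unfolded cd]] fob_Ob[OF g'.total[unfolded cd]]
            far_hom[OF f'.total[unfolded cd]]
      by (simp add: comp_compat_def fib2_hcmp_def c d ff gg cd hom_def)
  qed
qed (simp_all)

interpretation CC: two_category CompCat by (rule CompCat.two_category)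

section \<open>Weakening and contraction comonads\<close>

text \<open>The data of a w-comonad without its comultiplication. The separation allows
  \<open>joint_monic\<close> and \<open>comult_ex1\<close> to be applied to the functor and counit
  built by \<open>X\<close>, before a comonad is available.\<close>

locale w_counit =
  fixes p :: "('e, 'f, 'o, 'a) func" and E :: "('e, 'f) cat" (structure) and B :: "('o, 'a) cat"
    and K :: "('e, 'f, 'e, 'f) func" and eps :: "'e \<Rightarrow> 'f"
  assumes p: "p : E \<rightarrow>\<^sub>F B" and K: "K : E \<rightarrow>\<^sub>F E"
    and eps: "e \<in> Ob E \<Longrightarrow> eps e \<in> hom E (fob K e) e"
    and eps_natural: "f \<in> hom E a b \<Longrightarrow> f \<cdot> eps a = eps b \<cdot> far K f"
    and eps_cartesian: "e \<in> Ob E \<Longrightarrow> cartesian p (eps e)"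
    and eps_pullback: "\<lbrakk>cartesian p f; f \<in> hom E a b\<rbrakk> \<Longrightarrow>
      is_pullback B (Square (far p (eps a)) (far p (eps b)) (far p (far K f)) (far p f))"
begin

sublocale E: category E using functor_betwD[OF p] by simp
sublocale B: category B using functor_betwD[OF p] by simp

lemmas K_Ob = fob_Ob[OF K]
lemmas K_hom = far_hom[OF K]

lemma eps_square_pullback:
  assumes e: "e \<in> Ob E"
    and x: "x \<in> hom B u (fob p (fob K e))" and y: "y \<in> hom B u (fob p (fob K e))"
    and xy: "far p (eps e) \<cdot>\<^bsub>B\<^esub> x = far p (eps e) \<cdot>\<^bsub>B\<^esub> y"
  shows "\<exists>!t. t \<in> hom B u (fob p (fob K (fob K e))) \<and>
    far p (far K (eps e)) \<cdot>\<^bsub>B\<^esub> t = x \<and> far p (eps (fob K e)) \<cdot>\<^bsub>B\<^esub> t = y"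
proof -
  note h = far_hom[OF p eps[OF e]] far_hom[OF p eps[OF K_Ob[OF e]]]
  have "src B x = src B y \<and>
        tgt B x = src B (far p (eps e)) \<and> tgt B y = tgt B (far p (eps (fob K e))) \<and>
        far p (eps e) \<cdot>\<^bsub>B\<^esub> x = far p (eps e) \<cdot>\<^bsub>B\<^esub> y \<longrightarrow>
        (\<exists>!t. t \<in> hom B (src B x) (src B (far p (eps (fob K e)))) \<and>
              far p (far K (eps e)) \<cdot>\<^bsub>B\<^esub> t = x \<and> far p (eps (fob K e)) \<cdot>\<^bsub>B\<^esub> t = y)"
    if "x \<in> Ar B" "y \<in> Ar B"
    using eps_pullback[OF eps_cartesian[OF e] eps[OF e]] that unfolding is_pullback_def square.sel
      by blast
  then show ?thesis using x y xy h by (simp add: hom_def)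
qed

text \<open>
  The images under \<open>p\<close> agree because they map into a pullback, and then \<open>eps\<close> is cartesian. Every
  law involving a comultiplication is checked against this.
\<close>

lemma joint_monic:
  assumes e: "e \<in> Ob E" and h: "h \<in> hom E c (fob K (fob K e))" and k: "k \<in> hom E c (fob K (fob K e))"
    and 1: "eps (fob K e) \<cdot> h = eps (fob K e) \<cdot> k"
    and 2: "far K (eps e) \<cdot> h = far K (eps e) \<cdot> k"
  shows "h = k"
proof -
  note Ke = K_Ob[OF e]
  note Keps = K_hom[OF eps[OF e]] and epsK = eps[OF Ke]
  let ?x = "far p (far K (eps e) \<cdot> h)" and ?y = "far p (eps (fob K e) \<cdot> h)"
  have x: "?x \<in> hom B (fob p c) (fob p (fob K e))" by (rule far_hom[OF p E.cmp_hom[OF h Keps]])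
  have y: "?y \<in> hom B (fob p c) (fob p (fob K e))" by (rule far_hom[OF p E.cmp_hom[OF h epsK]])
  \<comment> \<open>Naturality of \<open>eps\<close> at its own component makes \<open>?x\<close>
    and \<open>?y\<close> a cone over the pullback; by the premises \<open>1\<close> and
    \<open>2\<close>, \<open>h\<close> and \<open>k\<close> both induce this cone.\<close>
  have "far p (eps e) \<cdot>\<^bsub>B\<^esub> ?x = far p ((eps e \<cdot> far K (eps e)) \<cdot> h)"
    using eps[OF e] Keps h by (simp add: hom_def functor_chase[OF p] E.chase B.chase)
  also have "\<dots> = far p (eps e) \<cdot>\<^bsub>B\<^esub> ?y"
    unfolding eps_natural[OF eps[OF e], symmetric]
    using eps[OF e] epsK h by (simp add: hom_def functor_chase[OF p] E.chase B.chase)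
  finally have xy: "far p (eps e) \<cdot>\<^bsub>B\<^esub> ?x = far p (eps e) \<cdot>\<^bsub>B\<^esub> ?y" .
  have l: "far p (far K (eps e)) \<cdot>\<^bsub>B\<^esub> far p l = far p (far K (eps e) \<cdot> l)"
    "far p (eps (fob K e)) \<cdot>\<^bsub>B\<^esub> far p l = far p (eps (fob K e) \<cdot> l)" if "l \<in> hom E c (fob K (fob K e))"
        for l
    using that Keps epsK by (simp_all add: hom_def far_cmp[OF p])
  have "far p h = far p k"
    using eps_square_pullback[OF e x y xy] far_hom[OF p h] far_hom[OF p k] l[OF h] l[OF k] 1 2 by auto
  then show ?thesis
    by (rule cartesian_cancel[OF p eps_cartesian[OF Ke] epsK h k _ 1])
qed

text \<open>A pair of identities is a cone over the pullback; the induced base arrow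
  \<open>t\<close> lifts along the cartesian \<open>eps (fob K e)\<close> to \<open>n\<close>, which
  settles the first law. The second holds over the base by the choice of \<open>t\<close>, and after
  composing with \<open>eps e\<close> by naturality of \<open>eps\<close>. Uniqueness is
  \<open>joint_monic\<close>.\<close>

lemma comult_ex1:
  assumes e: "e \<in> Ob E"
  shows "\<exists>!n. n \<in> hom E (fob K e) (fob K (fob K e)) \<and> eps (fob K e) \<cdot> n = ide E (fob K e) \<and>
    far K (eps e) \<cdot> n = ide E (fob K e)"
proof -
  note Ke = K_Ob[OF e]
  note Keps = K_hom[OF eps[OF e]] and epsK = eps[OF Ke]
  have pKe: "ide B (fob p (fob K e)) \<in> hom B (fob p (fob K e)) (fob p (fob K e))"
    by (rule B.ide_hom[OF fob_Ob[OF p Ke]])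
  obtain t where t: "t \<in> hom B (fob p (fob K e)) (fob p (fob K (fob K e)))"
    "far p (far K (eps e)) \<cdot>\<^bsub>B\<^esub> t = ide B (fob p (fob K e))" "far p (eps (fob K e)) \<cdot>\<^bsub>B\<^esub> t
        = ide B (fob p (fob K e))"
    using eps_square_pullback[OF e pKe pKe] by auto
  have "far p (eps (fob K e)) \<cdot>\<^bsub>B\<^esub> t = far p (ide E (fob K e))"
    by (simp add: t far_ide[OF p Ke])
  then obtain n where n: "n \<in> hom E (fob K e) (fob K (fob K e))" "far p n = t"
      "eps (fob K e) \<cdot> n = ide E (fob K e)"
    using cartesian_ex1[OF p eps_cartesian[OF Ke] epsK E.ide_hom[OF Ke] t(1)] by auto
  have "far K (eps e) \<cdot> n = ide E (fob K e)"
  proof (rule cartesian_cancel[OF p eps_cartesian[OF e] eps[OF e] E.cmp_hom[OF n(1) Keps] E.ide_hom[OF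
      Ke]])
    show "far p (far K (eps e) \<cdot> n) = far p (ide E (fob K e))"
      using n(1) Keps by (simp add: hom_def far_cmp[OF p] n(2) t(2) far_ide[OF p Ke])
    have "eps e \<cdot> far K (eps e) \<cdot> n = (eps e \<cdot> far K (eps e)) \<cdot> n"
      using n(1) Keps eps[OF e] by (simp add: hom_def E.assoc)
    also have "\<dots> = eps e \<cdot> eps (fob K e) \<cdot> n"
      unfolding eps_natural[OF eps[OF e], symmetric] using n(1) epsK eps[OF e]
        by (simp add: hom_def E.assoc)
    finally show "eps e \<cdot> far K (eps e) \<cdot> n = eps e \<cdot> ide E (fob K e)"
      by (simp add: n(3))
  qed
  with n show ?thesis
    using joint_monic[OF e] by (intro ex1I[of _ n]) auto
qed

text \<open>Naturality of the comultiplication and coassociativity are equations between arrows into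
  an object \<open>fob K (fob K b)\<close>. Both sides agree after each of the two projections, by
  the counit laws and naturality of \<open>eps\<close>.\<close>

lemma is_comonadI:
  assumes W: "cmK W = K" "nsrc (cm\<epsilon> W) = K" "ntgt (cm\<epsilon> W) = idf E" "nsrc (cm\<nu> W) = K"
      "ntgt (cm\<nu> W) = K \<circ>\<^sub>F K"
    "cpt (cm\<epsilon> W) \<in> extensional (Ob E)" "cpt (cm\<nu> W) \<in> extensional (Ob E)"
    and We: "\<And>e. e \<in> Ob E \<Longrightarrow> cpt (cm\<epsilon> W) e = eps e"
    and nu: "\<And>e. e \<in> Ob E \<Longrightarrow> cpt (cm\<nu> W) e \<in> hom E (fob K e) (fob K (fob K e))"
    and nu1: "\<And>e. e \<in> Ob E \<Longrightarrow> eps (fob K e) \<cdot> cpt (cm\<nu> W) e = ide E (fob K e)"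
    and nu2: "\<And>e. e \<in> Ob E \<Longrightarrow> far K (eps e) \<cdot> cpt (cm\<nu> W) e = ide E (fob K e)"
  shows "is_comonad E W"
proof (rule is_comonad.intro)
  let ?\<nu> = "cpt (cm\<nu> W)"
  note [simp] = W functor_betwD[OF K] idf_betw[OF E.category_axioms]
  have KK: "K \<circ>\<^sub>F K : E \<rightarrow>\<^sub>F E" by (rule fcomp_betw[OF K K])
  show "is_functor (cmK W)" "Dom (cmK W) = E" "Cod (cmK W) = E" by simp_all
  show "cm\<epsilon> W : cmK W \<Rightarrow>\<^sub>N idf E"
    by (simp, rule nt_betwI[OF K idf_betw[OF E.category_axioms]])
      (use eps eps_natural in \<open>auto simp: We hom_def\<close>)
  show nt: "cm\<nu> W : cmK W \<Rightarrow>\<^sub>N cmK W \<circ>\<^sub>F cmK W"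
  proof (simp, rule nt_betwI[OF K KK])
    fix e assume "e \<in> Ob E" then show "?\<nu> e \<in> hom E (fob K e) (fob (K \<circ>\<^sub>F K) e)" using nu by simp
  next
    fix f a b assume f: "f \<in> hom E a b" and a: "a \<in> Ob E" and b: "b \<in> Ob E"
    then have [simp]: "f \<in> Ar E" by (simp add: hom_def)
    note Kf = K_hom[OF f] and KKf = K_hom[OF K_hom[OF f]]
    note homs = f Kf KKf nu[OF a] nu[OF b] eps[OF a] eps[OF b] eps[OF K_Ob[OF a]] eps[OF K_Ob[OF b]]
      K_hom[OF eps[OF b]] K_hom[OF eps[OF a]]
    have "far K (far K f) \<cdot> ?\<nu> a = ?\<nu> b \<cdot> far K f"
    proof (rule joint_monic[OF b E.cmp_hom[OF nu[OF a] KKf] E.cmp_hom[OF Kf nu[OF b]]])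
      have "eps (fob K b) \<cdot> far K (far K f) \<cdot> ?\<nu> a = (eps (fob K b) \<cdot> far K (far K f)) \<cdot> ?\<nu> a"
        using homs by (simp add: hom_def E.assoc)
      also have "\<dots> = far K f \<cdot> (eps (fob K a) \<cdot> ?\<nu> a)"
        unfolding eps_natural[OF Kf, symmetric] using homs by (simp add: hom_def E.assoc)
      also have "\<dots> = (eps (fob K b) \<cdot> ?\<nu> b) \<cdot> far K f"
        unfolding nu1[OF a] nu1[OF b] using homs by (simp add: hom_def E.chase)
      finally show "eps (fob K b) \<cdot> far K (far K f) \<cdot> ?\<nu> a = eps (fob K b) \<cdot> ?\<nu> b \<cdot> far K f"
        using homs by (simp add: hom_def E.assoc)
      have "far K (eps b) \<cdot> far K (far K f) \<cdot> ?\<nu> a = far K (eps b \<cdot> far K f) \<cdot> ?\<nu> a"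
        using homs by (simp add: hom_def E.chase far_cmp[OF K])
      also have "\<dots> = far K f \<cdot> (far K (eps a) \<cdot> ?\<nu> a)"
        unfolding eps_natural[OF f, symmetric] using homs by (simp add: hom_def E.assoc far_cmp[OF K])
      also have "\<dots> = (far K (eps b) \<cdot> ?\<nu> b) \<cdot> far K f"
        unfolding nu2[OF a] nu2[OF b] using homs by (simp add: hom_def E.chase)
      finally show "far K (eps b) \<cdot> far K (far K f) \<cdot> ?\<nu> a = far K (eps b) \<cdot> ?\<nu> b \<cdot> far K f"
        using homs by (simp add: hom_def E.assoc)
    qed
    then show "far (K \<circ>\<^sub>F K) f \<cdot> ?\<nu> a = ?\<nu> b \<cdot> far K f" by simp
  qed (simp_all)
  show "(cm\<epsilon> W \<lhd> cmK W) \<bullet>\<^sub>N cm\<nu> W = idn (cmK W)"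
    by (rule nt_eqI[where S = "Ob E"]) (auto simp: vcomp_def idn_def We K_Ob nu1 fcomp_idf_left[OF K])
  show "(cmK W \<rhd> cm\<epsilon> W) \<bullet>\<^sub>N cm\<nu> W = idn (cmK W)"
    by (rule nt_eqI[where S = "Ob E"]) (auto simp: vcomp_def idn_def We K_Ob nu2 fcomp_idf_right[OF K])
  show "(cm\<nu> W \<lhd> cmK W) \<bullet>\<^sub>N cm\<nu> W = (cmK W \<rhd> cm\<nu> W) \<bullet>\<^sub>N cm\<nu> W"
  proof (rule nt_eqI[where S = "Ob E"])
    fix e assume e: "e \<in> Ob E"
    note Ke = K_Ob[OF e]
    note homs = nu[OF e] nu[OF Ke] K_hom[OF nu[OF e]] eps[OF e] eps[OF Ke] eps[OF K_Ob[OF Ke]]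
      K_hom[OF eps[OF Ke]]
    have "?\<nu> (fob K e) \<cdot> ?\<nu> e = far K (?\<nu> e) \<cdot> ?\<nu> e"
    proof (rule joint_monic[OF Ke E.cmp_hom[OF nu[OF e] nu[OF Ke]] E.cmp_hom[OF nu[OF e] K_hom[OF nu[OF
        e]]]])
      have "eps (fob K (fob K e)) \<cdot> ?\<nu> (fob K e) \<cdot> ?\<nu> e = (eps (fob K (fob K e)) \<cdot> ?\<nu> (fob K e)) \<cdot> ?\<nu> e"
        using homs by (simp add: hom_def E.assoc)
      also have "\<dots> = ?\<nu> e \<cdot> (eps (fob K e) \<cdot> ?\<nu> e)"
        unfolding nu1[OF Ke] nu1[OF e] using homs by (simp add: hom_def E.chase)
      also have "\<dots> = (eps (fob K (fob K e)) \<cdot> far K (?\<nu> e)) \<cdot> ?\<nu> e"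
        unfolding eps_natural[OF nu[OF e], symmetric] using homs by (simp add: hom_def E.assoc)
      finally show "eps (fob K (fob K e)) \<cdot> ?\<nu> (fob K e) \<cdot> ?\<nu> e = eps (fob K (fob K e)) \<cdot> far K (?\<nu> e)
          \<cdot> ?\<nu> e"
        using homs by (simp add: hom_def E.assoc)
      have "far K (eps (fob K e)) \<cdot> ?\<nu> (fob K e) \<cdot> ?\<nu> e = (far K (eps (fob K e)) \<cdot> ?\<nu> (fob K e)) \<cdot> ?\<nu> e"
        using homs by (simp add: hom_def E.assoc)
      also have "\<dots> = far K (eps (fob K e) \<cdot> ?\<nu> e) \<cdot> ?\<nu> e"
        unfolding nu2[OF Ke] nu1[OF e] by (simp add: far_ide[OF K Ke])
      finally show "far K (eps (fob K e)) \<cdot> ?\<nu> (fob K e) \<cdot> ?\<nu> e = far K (eps (fob K e)) \<cdot> far K (?\<nu> e)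
          \<cdot> ?\<nu> e"
        using homs by (simp add: hom_def E.assoc far_cmp[OF K])
    qed
    then show "cpt ((cm\<nu> W \<lhd> cmK W) \<bullet>\<^sub>N cm\<nu> W) e = cpt ((cmK W \<rhd> cm\<nu> W) \<bullet>\<^sub>N cm\<nu> W) e"
      using e by (simp)
  qed (auto simp: vcomp_def fcomp_assoc[OF K K])
qed

text \<open>The equation is tested with \<open>joint_monic\<close> at \<open>fob H e\<close>, for
  single arrows \<open>\<mu>\<close> and \<open>\<nu>\<close> that satisfy the counit laws. The
  first projection uses naturality of \<open>eps\<close> at \<open>\<theta> e\<close> and the counit
  triangle at \<open>fob J e\<close>; the second uses the triangle at \<open>e\<close> and
  naturality of \<open>\<theta>\<close> at \<open>del e\<close>.\<close>

lemma comult_lax: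
  assumes S: "w_counit q D A J del" and H: "H : D \<rightarrow>\<^sub>F E" and e: "e \<in> Ob D"
    and \<theta>: "\<And>e. e \<in> Ob D \<Longrightarrow> \<theta> e \<in> hom E (fob H (fob J e)) (fob K (fob H e))"
    and nat: "\<And>f a b. f \<in> hom D a b \<Longrightarrow> far K (far H f) \<cdot> \<theta> a = \<theta> b \<cdot> far H (far J f)"
    and \<theta>_eps: "\<And>e. e \<in> Ob D \<Longrightarrow> eps (fob H e) \<cdot> \<theta> e = far H (del e)"
    and \<mu>: "\<mu> \<in> hom D (fob J e) (fob J (fob J e))"
      "del (fob J e) \<cdot>\<^bsub>D\<^esub> \<mu> = ide D (fob J e)" "far J (del e) \<cdot>\<^bsub>D\<^esub> \<mu> = ide D (fob J e)"
    and \<nu>: "\<nu> \<in> hom E (fob K (fob H e)) (fob K (fob K (fob H e)))"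
      "eps (fob K (fob H e)) \<cdot> \<nu> = ide E (fob K (fob H e))" "far K (eps (fob H e)) \<cdot> \<nu>
          = ide E (fob K (fob H e))"
  shows "\<nu> \<cdot> \<theta> e = far K (\<theta> e) \<cdot> \<theta> (fob J e) \<cdot> far H \<mu>" (is "_ = ?rhs")
proof -
  interpret S: w_counit q D A J del by fact
  note He = fob_Ob[OF H e] and Je = S.K_Ob[OF e]
  note t = \<theta>[OF e] and tJ = \<theta>[OF Je]
  note homs = t tJ K_hom[OF t] far_hom[OF H \<mu>(1)] \<nu>(1) \<mu>(1) eps[OF He] eps[OF K_Ob[OF He]]
    eps[OF fob_Ob[OF H Je]]
    K_hom[OF eps[OF He]] S.eps[OF Je] S.K_hom[OF S.eps[OF e]] K_hom[OF far_hom[OF H S.eps[OF e]]]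
    far_hom[OF H S.K_hom[OF S.eps[OF e]]]
  show ?thesis
  proof (rule joint_monic[OF He E.cmp_hom[OF t \<nu>(1)] E.cmp_hom[OF E.cmp_hom[OF far_hom[OF H \<mu>(1)] tJ]
      K_hom[OF t]]])
    have "eps (fob K (fob H e)) \<cdot> ?rhs = (eps (fob K (fob H e)) \<cdot> far K (\<theta> e)) \<cdot> \<theta> (fob J e) \<cdot> far H \<mu>"
      using homs by (simp add: hom_def E.chase)
    also have "\<dots> = \<theta> e \<cdot> (eps (fob H (fob J e)) \<cdot> \<theta> (fob J e)) \<cdot> far H \<mu>"
      unfolding eps_natural[OF t, symmetric] using homs by (simp add: hom_def E.chase)
    also have "\<dots> = \<theta> e \<cdot> far H (del (fob J e) \<cdot>\<^bsub>D\<^esub> \<mu>)"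
      unfolding \<theta>_eps[OF Je] using homs by (simp add: hom_def far_cmp[OF H])
    also have "\<dots> = (eps (fob K (fob H e)) \<cdot> \<nu>) \<cdot> \<theta> e"
      unfolding \<mu>(2) \<nu>(2) far_ide[OF H Je] using homs by (simp add: hom_def E.chase)
    finally show "eps (fob K (fob H e)) \<cdot> \<nu> \<cdot> \<theta> e = eps (fob K (fob H e)) \<cdot> ?rhs"
      using homs by (simp add: hom_def E.assoc)
    have "far K (eps (fob H e)) \<cdot> ?rhs = far K (eps (fob H e) \<cdot> \<theta> e) \<cdot> \<theta> (fob J e) \<cdot> far H \<mu>"
      using homs by (simp add: hom_def E.chase far_cmp[OF K])
    also have "\<dots> = (far K (far H (del e)) \<cdot> \<theta> (fob J e)) \<cdot> far H \<mu>"
      unfolding \<theta>_eps[OF e] using homs by (simp add: hom_def E.chase)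
    also have "\<dots> = \<theta> e \<cdot> far H (far J (del e) \<cdot>\<^bsub>D\<^esub> \<mu>)"
      unfolding nat[OF S.eps[OF e]] using homs by (simp add: hom_def E.chase far_cmp[OF H])
    also have "\<dots> = (far K (eps (fob H e)) \<cdot> \<nu>) \<cdot> \<theta> e"
      unfolding \<mu>(3) \<nu>(3) far_ide[OF H Je] using homs by (simp add: hom_def E.chase)
    finally show "far K (eps (fob H e)) \<cdot> \<nu> \<cdot> \<theta> e = far K (eps (fob H e)) \<cdot> ?rhs"
      using homs by (simp add: hom_def E.assoc)
  qed
qed

end

section \<open>Counit and comultiplication of a w-comonad\<close>

context w_comonad
begin

sublocale cloven_fibration "wfib W" by (rule cloven)
sublocale is_comonad tot "wcm W" by (rule comonad)

abbreviation "ep \<equiv> cpt (w\<epsilon> W)"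

lemma wK: "wK W : tot \<rightarrow>\<^sub>F tot"
  by (simp add: functor_betw_def functor_K Dom_K Cod_K)

sublocale w_counit prj tot bas "wK W" ep
proof (rule w_counit.intro[OF proj wK], goal_cases)
  case (1 e) then show ?case using cpt_hom[OF counit_nt wK 1] by simp
next
  case (2 f a b)
  then have "f \<in> Ar tot" by (simp add: hom_def)
  then show ?case using naturality[OF counit_nt wK 2] by simp
qed (fact counit_cartesian counit_pullback)+

lemma
  assumes e: "e \<in> Ob tot"
  shows nu: "cpt (w\<nu> W) e \<in> hom tot (fob (wK W) e) (fob (wK W) (fob (wK W) e))"
    and nu1: "ep (fob (wK W) e) \<cdot>\<^bsub>tot\<^esub> cpt (w\<nu> W) e = ide tot (fob (wK W) e)"
    and nu2: "far (wK W) (ep e) \<cdot>\<^bsub>tot\<^esub> cpt (w\<nu> W) e = ide tot (fob (wK W) e)"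
proof -
  note [simp] = functor_betwD(2,3)[OF wK] nt_betwD[OF counit_nt] nt_betwD[OF comult_nt]
  show "cpt (w\<nu> W) e \<in> hom tot (fob (wK W) e) (fob (wK W) (fob (wK W) e))"
    using cpt_hom[OF comult_nt wK e] e by simp
  show "ep (fob (wK W) e) \<cdot>\<^bsub>tot\<^esub> cpt (w\<nu> W) e = ide tot (fob (wK W) e)"
    "far (wK W) (ep e) \<cdot>\<^bsub>tot\<^esub> cpt (w\<nu> W) e = ide tot (fob (wK W) e)"
    using arg_cong[OF counit_left, of "\<lambda>\<alpha>. cpt \<alpha> e"] arg_cong[OF counit_right, of "\<lambda>\<alpha>. cpt \<alpha> e"] e
      by simp_all
qed

end

section \<open>Components of a lax morphism of w-comonads\<close>

context lax_w_morphism
begin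

sublocale S: w_comonad "wsrc m" by (rule src_w_comonad)
sublocale T: w_comonad "wtgt m" by (rule tgt_w_comonad)
sublocale lax_comonad_morphism "wcm (wsrc m)" "wcm (wtgt m)" "wtotal m" "theta m"
  by (rule comonad_morphism)

lemmas base = fib_1cellD(1)[OF fib_1cell]
lemmas total = fib_1cellD(2)[OF fib_1cell]
lemmas proj_total = fib_1cellD(4,5)[OF fib_1cell]
lemmas total_cartesian = fib_1cellD(6)[OF fib_1cell]

abbreviation "th \<equiv> cpt (theta m)"

lemma theta_src: "wtotal m \<circ>\<^sub>F wK (wsrc m) : S.tot \<rightarrow>\<^sub>F T.tot"
  by (rule fcomp_betw[OF S.wK total])

lemma theta_ext: "th \<in> extensional (Ob S.tot)"
  by (rule cpt_ext[OF theta_nt theta_src])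

lemma theta: "e \<in> Ob S.tot \<Longrightarrow> th e \<in> hom T.tot (fob (wtotal m) (fob (wK (wsrc m)) e)) (fob (wK (wtgt m))
    (fob (wtotal m) e))"
  using cpt_hom[OF theta_nt theta_src, of e] functor_betwD(2)[OF total] functor_betwD(2)[OF S.wK] by simp

lemma theta_natural: "f \<in> hom S.tot a b \<Longrightarrow> far (wK (wtgt m)) (far (wtotal m) f) \<cdot>\<^bsub>T.tot\<^esub> th a =
    th b \<cdot>\<^bsub>T.tot\<^esub> far (wtotal m) (far (wK (wsrc m)) f)"
  using naturality[OF theta_nt theta_src, of f a b] functor_betwD(2)[OF total] functor_betwD(2)[OF S.wK]
    by (simp add: hom_def)

lemma theta_eps: "e \<in> Ob S.tot \<Longrightarrow> T.ep (fob (wtotal m) e) \<cdot>\<^bsub>T.tot\<^esub> th e = far (wtotal m) (S.ep e)"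
  using arg_cong[OF theta_counit, of "\<lambda>\<alpha>. cpt \<alpha> e"] functor_betwD(2,3)[OF total]
    functor_betwD(2)[OF S.wK]
    nt_betwD[OF theta_nt] nt_betwD[OF S.counit_nt] by simp

end

text \<open>The comultiplication law is supplied by \<open>comult_lax\<close>. New 1-cells of
  \<open>WCmd\<close> are thus obtained from a natural \<open>theta\<close> that satisfies the
  counit triangle.\<close>

lemma lax_w_morphismI:
  assumes W: "w_comonad (wsrc m)" and W': "w_comonad (wtgt m)"
    and fib: "fib_1cell (wfib (wsrc m)) (wfib (wtgt m)) (wbase m) (wtotal m)"
    and nt: "theta m : wtotal m \<circ>\<^sub>F wK (wsrc m) \<Rightarrow>\<^sub>N wK (wtgt m) \<circ>\<^sub>F wtotal m"
    and eps: "\<And>e. e \<in> Ob (total_cat (wfib (wsrc m))) \<Longrightarrow>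
      cpt (w\<epsilon> (wtgt m)) (fob (wtotal m) e) \<cdot>\<^bsub>total_cat (wfib (wtgt m))\<^esub> cpt (theta m) e = far (wtotal m)
          (cpt (w\<epsilon> (wsrc m)) e)"
  shows "lax_w_morphism m"
proof -
  interpret S: w_comonad "wsrc m" by fact
  interpret T: w_comonad "wtgt m" by fact
  let ?H = "wtotal m" and ?K = "wK (wsrc m)" and ?K' = "wK (wtgt m)"
  note H = fib_1cellD(2)[OF fib]
  note src = fcomp_betw[OF S.wK H]
  note [simp] = functor_betwD(2,3)[OF H] functor_betwD(2,3)[OF S.wK] functor_betwD(2,3)[OF T.wK]
    nt_betwD[OF nt]
    nt_betwD[OF S.counit_nt] nt_betwD[OF T.counit_nt] nt_betwD[OF S.comult_nt] nt_betwD[OF T.comult_nt]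
  have hom: "cpt (theta m) e \<in> hom T.tot (fob ?H (fob ?K e)) (fob ?K' (fob ?H e))" if "e \<in> Ob S.tot"
      for e
    using cpt_hom[OF nt src that] that by simp
  have nat: "far ?K' (far ?H f) \<cdot>\<^bsub>T.tot\<^esub> cpt (theta m) a = cpt (theta m) b \<cdot>\<^bsub>T.tot\<^esub> far ?H (far ?K f)"
    if "f \<in> hom S.tot a b" for f a b
    using naturality[OF nt src that] that by (simp add: hom_def)
  have "(w\<epsilon> (wtgt m) \<lhd> ?H) \<bullet>\<^sub>N theta m = ?H \<rhd> w\<epsilon> (wsrc m)"
    by (rule nt_eqI[where S = "Ob S.tot"])
      (auto simp: vcomp_def whisk_left_def eps fcomp_idf_left[OF H] fcomp_idf_right[OF H])
  moreover have "(w\<nu> (wtgt m) \<lhd> ?H) \<bullet>\<^sub>N theta m = (?K' \<rhd> theta m) \<bullet>\<^sub>N (theta m \<lhd> ?K) \<bullet>\<^sub>N (?H \<rhd> w\<nu> (wsrc m))"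
  proof (rule nt_eqI[where S = "Ob S.tot"])
    fix e assume e: "e \<in> Ob S.tot"
    note He = fob_Ob[OF H e]
    show "cpt ((w\<nu> (wtgt m) \<lhd> ?H) \<bullet>\<^sub>N theta m) e = cpt ((?K' \<rhd> theta m) \<bullet>\<^sub>N (theta m \<lhd> ?K)
        \<bullet>\<^sub>N (?H \<rhd> w\<nu> (wsrc m))) e"
      using e T.comult_lax[OF S.w_counit_axioms H e hom nat eps S.nu[OF e] S.nu1[OF e] S.nu2[OF e]
        T.nu[OF He] T.nu1[OF He] T.nu2[OF He]]
      by simp
  qed (auto simp: vcomp_def fcomp_assoc[OF H T.wK])
  ultimately have "lax_comonad_morphism (wcm (wsrc m)) (wcm (wtgt m)) (wtotal m) (theta m)"
    using nt by (intro lax_comonad_morphism.intro)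
  then show ?thesis using W W' fib by (intro lax_w_morphism.intro)
qed

section \<open>The 2-category of w-comonads\<close>

lemma wmor_simps [simp]: "wsrc (wmor_comp n m) = wsrc m" "wtgt (wmor_comp n m) = wtgt n"
  "wbase (wmor_comp n m) = wbase n \<circ>\<^sub>F wbase m" "wtotal (wmor_comp n m) = wtotal n \<circ>\<^sub>F wtotal m"
  "wsrc (wmor_id W) = W" "wtgt (wmor_id W) = W"
  "wbase (wmor_id W) = idf (base_cat (wfib W))" "wtotal (wmor_id W) = idf (total_cat (wfib W))"
  by (simp_all add: wmor_comp_def wmor_id_def)

lemma lax_w_eqI:
  assumes m: "lax_w_morphism m" and n: "lax_w_morphism n"
    and eq: "wsrc m = wsrc n" "wtgt m = wtgt n" "wbase m = wbase n" "wtotal m = wtotal n"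
    and z: "\<And>e. e \<in> Ob (total_cat (wfib (wsrc n))) \<Longrightarrow> cpt (theta m) e = cpt (theta n) e"
  shows "m = n"
proof -
  interpret m: lax_w_morphism m by fact
  interpret n: lax_w_morphism n by fact
  have "theta m = theta n"
    by (rule nt_eqI[where S = "Ob (total_cat (wfib (wsrc n)))"])
      (use z m.theta_ext n.theta_ext nt_betwD[OF m.theta_nt] nt_betwD[OF n.theta_nt] eq in auto)
  then show ?thesis using eq by simp
qed

lemma wmor_id_theta:
  assumes W: "w_comonad W" and e: "e \<in> Ob (total_cat (wfib W))"
  shows "cpt (theta (wmor_id W)) e = ide (total_cat (wfib W)) (fob (wK W) e)"
  using e functor_betwD(2,3)[OF w_comonad.wK[OF W]] by (simp add: wmor_id_def)

lemma wmor_id_lax: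
  assumes W: "w_comonad W" shows "lax_w_morphism (wmor_id W)"
proof -
  interpret w_comonad W by fact
  have "theta (wmor_id W) : idf tot \<circ>\<^sub>F wK W \<Rightarrow>\<^sub>N wK W \<circ>\<^sub>F idf tot"
    using idn_betw[OF wK] by (simp add: wmor_id_def fcomp_idf_left[OF wK] fcomp_idf_right[OF wK])
  then show ?thesis
    using W fib_1cell_id[OF proj_functor] eps
    by (intro lax_w_morphismI) (auto simp: wmor_id_theta[OF W] hom_def E.chase)
qed

lemma
  assumes m: "lax_w_morphism m" and n: "lax_w_morphism n" and mn: "wtgt m = wsrc n"
  shows wmor_comp_lax: "lax_w_morphism (wmor_comp n m)"
    and wmor_comp_theta: "e \<in> Ob (total_cat (wfib (wsrc m))) \<Longrightarrow> cpt (theta (wmor_comp n m)) e =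
      cpt (theta n) (fob (wtotal m) e) \<cdot>\<^bsub>total_cat (wfib (wtgt n))\<^esub> far (wtotal n) (cpt (theta m) e)"
proof -
  interpret m: lax_w_morphism m by fact
  interpret n: lax_w_morphism n by fact
  note [simp] = functor_betwD(2,3)[OF m.total] functor_betwD(2,3)[OF n.total]
    functor_betwD(2,3)[OF m.S.wK]
    nt_betwD[OF m.theta_nt] nt_betwD[OF n.theta_nt]
  note ntotal = n.total[folded mn]
  show cpt: "cpt (theta (wmor_comp n m)) e =
      cpt (theta n) (fob (wtotal m) e) \<cdot>\<^bsub>n.T.tot\<^esub> far (wtotal n) (cpt (theta m) e)" if "e \<in> Ob
          m.S.tot" for e
    using that by (simp add: wmor_comp_def)
  have "wtotal n \<rhd> theta m : (wtotal n \<circ>\<^sub>F wtotal m) \<circ>\<^sub>F wK (wsrc m)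
      \<Rightarrow>\<^sub>N (wtotal n \<circ>\<^sub>F wK (wsrc n)) \<circ>\<^sub>F wtotal m"
    using whisk_left_betw[OF m.theta_src ntotal m.theta_nt] fcomp_assoc[OF m.S.wK m.total, of "wtotal n"]
      fcomp_assoc[OF m.total m.T.wK, of "wtotal n"] by (simp add: mn)
  moreover have "theta n \<lhd> wtotal m : (wtotal n \<circ>\<^sub>F wK (wsrc n)) \<circ>\<^sub>F wtotal m
      \<Rightarrow>\<^sub>N wK (wtgt n) \<circ>\<^sub>F wtotal n \<circ>\<^sub>F wtotal m"
    using whisk_right_betw[OF n.theta_src m.total[unfolded mn] n.theta_nt]
      fcomp_assoc[OF m.total ntotal, of "wK (wtgt n)"]
    by (simp add: mn)
  ultimately have nt: "theta (wmor_comp n m) : (wtotal n \<circ>\<^sub>F wtotal m) \<circ>\<^sub>F wK (wsrc m)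
      \<Rightarrow>\<^sub>N wK (wtgt n) \<circ>\<^sub>F wtotal n \<circ>\<^sub>F wtotal m"
    unfolding wmor_comp_def wmor.simps by (rule vcomp_betw[OF fcomp_betw[OF m.S.wK fcomp_betw[OF m.total
      ntotal]]])
  have eps: "n.T.ep (fob (wtotal n) (fob (wtotal m) e)) \<cdot>\<^bsub>n.T.tot\<^esub> cpt (theta (wmor_comp n m)) e =
      far (wtotal n) (far (wtotal m) (m.S.ep e))" if e: "e \<in> Ob m.S.tot" for e
  proof -
    note He = fob_Ob[OF m.total e]
    have He': "fob (wtotal m) e \<in> Ob n.S.tot" using He by (simp add: mn)
    \<comment> \<open>The triangle of \<open>n\<close> at the image of \<open>e\<close> is pasted to
      the image under \<open>wtotal n\<close> of the triangle of \<open>m\<close> at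
      \<open>e\<close>.\<close>
    have "n.T.ep (fob (wtotal n) (fob (wtotal m) e)) \<cdot>\<^bsub>n.T.tot\<^esub> cpt (theta (wmor_comp n m)) e =
        (n.T.ep (fob (wtotal n) (fob (wtotal m) e)) \<cdot>\<^bsub>n.T.tot\<^esub> n.th (fob (wtotal m) e)) \<cdot>\<^bsub>n.T.tot\<^esub> far
          (wtotal n) (m.th e)"
      using n.T.eps[OF fob_Ob[OF ntotal He]] n.theta[OF He'] far_hom[OF ntotal m.theta[OF e]]
      by (simp add: cpt[OF e] hom_def n.T.E.chase mn)
    also have "\<dots> = far (wtotal n) (m.T.ep (fob (wtotal m) e) \<cdot>\<^bsub>m.T.tot\<^esub> m.th e)"
      using m.T.eps[OF He] m.theta[OF e] n.theta_eps[OF He'] far_cmp[OF ntotal] by (simp add: hom_def mn)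
    finally show ?thesis by (simp add: m.theta_eps[OF e])
  qed
  show "lax_w_morphism (wmor_comp n m)"
    using nt eps m.S.eps fib_1cell_comp[OF m.fib_1cell n.fib_1cell[folded mn] m.S.proj_functor
      m.T.proj_functor]
    by (intro lax_w_morphismI) (simp_all add: m.S.w_comonad_axioms n.T.w_comonad_axioms hom_def)
qed

section \<open>The 2-functor Y\<close>

lemma Y_simps [simp]: "cfib (Y0 W) = wfib W" "chi (Y0 W) = Y_chi W"
  "csrc (Y1 m) = Y0 (wsrc m)" "ctgt (Y1 m) = Y0 (wtgt m)" "cbase (Y1 m) = wbase m"
      "ctotal (Y1 m) = wtotal m"
  by (simp_all add: Y0_def Y1_def Let_def)

lemma Y_chi_simps [simp]:
  "Dom (Y_chi W) = total_cat (wfib W)" "Cod (Y_chi W) = arrow_cat (base_cat (wfib W))"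
  "e \<in> Ob (total_cat (wfib W)) \<Longrightarrow> fob (Y_chi W) e = far (proj (wfib W)) (cpt (w\<epsilon> W) e)"
  "f \<in> Ar (total_cat (wfib W)) \<Longrightarrow> far (Y_chi W) f = Square (far (proj (wfib W)) (cpt (w\<epsilon> W) (src
      (total_cat (wfib W)) f)))
      (far (proj (wfib W)) (cpt (w\<epsilon> W) (tgt (total_cat (wfib W)) f)))
        (far (proj (wfib W)) (far (wK W) f)) (far (proj (wfib W)) f)"
  by (simp_all add: Y_chi_def Let_def)

lemma Y1_zeta_simps [simp]: "nsrc (zeta (Y1 m)) = (wbase m)\<^bold>\<two> \<circ>\<^sub>F Y_chi (wsrc m)"
    "ntgt (zeta (Y1 m)) = Y_chi (wtgt m) \<circ>\<^sub>F wtotal m"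
  "e \<in> Ob (total_cat (wfib (wsrc m))) \<Longrightarrow> cpt (zeta (Y1 m)) e = Square (far (wbase m) (far (proj (wfib
      (wsrc m))) (cpt (w\<epsilon> (wsrc m)) e)))
                        (far (proj (wfib (wtgt m))) (cpt (w\<epsilon> (wtgt m)) (fob (wtotal m) e)))
                        (far (proj (wfib (wtgt m))) (cpt (theta m) e))
                        (ide (base_cat (wfib (wtgt m))) (fob (proj (wfib (wtgt m))) (fob (wtotal m) e)))"
  by (simp_all add: Y1_def Let_def)

context w_comonad
begin

lemma Y_square:
  assumes f: "f \<in> hom (tot) a b"
  shows "far (Y_chi W) f \<in> squares (bas)"
proof -
  note ab = E.hom_Ob[OF f]
  note homs = f eps[OF ab(1)] eps[OF ab(2)] K_hom[OF f]
  have "far (prj) (ep b \<cdot>\<^bsub>tot\<^esub> far (wK W) f) = far (prj) (f \<cdot>\<^bsub>tot\<^esub> ep a)"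
    by (simp add: eps_natural[OF f])
  then show ?thesis using homs by (simp add: squares_def hom_def functor_chase[OF proj])
qed

lemma Y_chi: "Y_chi W : tot \<rightarrow>\<^sub>F arrow_cat (bas)"
proof (rule functor_betwI[OF E.category_axioms category_arrow_cat[OF B.category_axioms]])
  fix a assume a: "a \<in> Ob (tot)"
  show "fob (Y_chi W) a \<in> Ob (arrow_cat (bas))"
    using a eps[OF a] by (simp add: hom_def far_Ar[OF proj])
  show "far (Y_chi W) (ide (tot) a) = ide (arrow_cat (bas)) (fob (Y_chi W) a)"
    using a eps[OF a] K_Ob[OF a] by (simp add: hom_def functor_chase[OF proj] functor_chase[OF wK]
      E.chase)
next
  fix f a b assume f: "f \<in> hom (tot) a b"
  then show "far (Y_chi W) f \<in> hom (arrow_cat (bas)) (fob (Y_chi W) a) (fob (Y_chi W) b)"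
    using Y_square[OF f] E.hom_Ob[OF f] by (simp add: hom_arrow_cat) (simp add: hom_def)
next
  fix f g a b c assume f: "f \<in> hom (tot) a b" and g: "g \<in> hom (tot) b c"
  note sq = Y_square[OF f] Y_square[OF g]
  have Ar: "f \<in> Ar (tot)" "src (tot) f = a" "tgt (tot) f = b"
    "g \<in> Ar (tot)" "src (tot) g = b" "tgt (tot) g = c"
    using f g by (auto simp: hom_def)
  show "far (Y_chi W) (g \<cdot>\<^bsub>tot\<^esub> f) = far (Y_chi W) g \<cdot>\<^bsub>arrow_cat (bas)\<^esub> far (Y_chi W) f"
    using sq Ar by (simp add: functor_chase[OF proj] functor_chase[OF wK] E.chase)
qed (simp_all add: Y_chi_def Let_def)

text \<open>The comprehension square of \<open>f\<close> is the projected naturality square of the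
  counit, so the pullback condition is the axiom \<open>counit_pullback\<close>.\<close>

lemma Y0: "comprehension_category (Y0 W)"
proof (rule comprehension_categoryI, goal_cases)
  case (3 e) then show ?case using eps[of e] by (simp add: hom_def tgt_far[OF proj])
next
  case (5 f)
  then have "f \<in> Ar (tot)" using cartesian_Ar by fastforce
  then show ?case using 5 counit_pullback[of f, OF _ hom_self] by simp
qed (use cloven Y_chi in simp_all)

end

lemma Y1_lax:
  assumes "lax_w_morphism m" shows "lax_comp_morphism (Y1 m)"
proof -
  interpret lax_w_morphism m by fact
  note [simp] = functor_betwD(2,3)[OF base] functor_betwD(2,3)[OF total]
  have sq: "cpt (zeta (Y1 m)) e \<in> squares T.bas" if e: "e \<in> Ob S.tot" for e
  proof -
    note He = fob_Ob[OF total e]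
    \<comment> \<open>The counit triangle of \<open>th\<close>, projected to the base, is the
      commutativity of the square.\<close>
    have "far T.prj (T.ep (fob (wtotal m) e) \<cdot>\<^bsub>T.tot\<^esub> th e) = far (wbase m) (far S.prj (S.ep e))"
      using S.eps[OF e] proj_total(2) by (simp add: theta_eps[OF e] hom_def)
    then show ?thesis
      using e S.eps[OF e] T.eps[OF He] theta[OF e] proj_total(1)[OF e] proj_total(1)[OF S.K_Ob[OF e]]
      by (simp add: squares_def hom_def functor_chase[OF T.proj] functor_chase[OF S.proj]
        functor_chase[OF base] T.B.chase)
  qed
  have "zeta (Y1 m) : (wbase m)\<^bold>\<two> \<circ>\<^sub>F Y_chi (wsrc m) \<Rightarrow>\<^sub>N Y_chi (wtgt m) \<circ>\<^sub>F wtotal m"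
  proof (rule nt_betwI[OF fcomp_betw[OF S.Y_chi arrow_functor_betw[OF base]] fcomp_betw[OF total
      T.Y_chi]])
    fix e assume e: "e \<in> Ob S.tot"
    then show "cpt (zeta (Y1 m)) e \<in> hom (arrow_cat T.bas) (fob ((wbase m)\<^bold>\<two> \<circ>\<^sub>F Y_chi (wsrc m)) e) (fob
        (Y_chi (wtgt m) \<circ>\<^sub>F wtotal m) e)"
      using sq[OF e] fob_Ob[OF total e] S.eps[OF e]
        by (simp add: hom_arrow_cat) (simp add: hom_def far_Ar[OF S.proj])
  next
    fix f a b assume f: "f \<in> hom S.tot a b" and a: "a \<in> Ob S.tot" and b: "b \<in> Ob S.tot"
    note Hf = far_hom[OF total f]
    have Ar: "f \<in> Ar S.tot" "src S.tot f = a" "tgt S.tot f = b" "far (wtotal m) f \<in> Ar T.tot"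
        "far (wK (wsrc m)) f \<in> Ar S.tot"
      using f Hf S.K_hom[OF f] by (auto simp: hom_def)
    \<comment> \<open>Likewise, naturality of \<open>theta\<close> is projected to give the domain
      part of naturality of \<open>zeta\<close>.\<close>
    have "far T.prj (far (wK (wtgt m)) (far (wtotal m) f) \<cdot>\<^bsub>T.tot\<^esub> th a) = far T.prj (th b
        \<cdot>\<^bsub>T.tot\<^esub> far (wtotal m) (far (wK (wsrc m)) f))"
      by (simp add: theta_natural[OF f])
    then have "far T.prj (far (wK (wtgt m)) (far (wtotal m) f)) \<cdot>\<^bsub>T.bas\<^esub> far T.prj (th a) =
        far T.prj (th b) \<cdot>\<^bsub>T.bas\<^esub> far (wbase m) (far S.prj (far (wK (wsrc m)) f))"
      using theta[OF a] theta[OF b] T.K_hom[OF Hf] far_hom[OF total S.K_hom[OF f]]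
        proj_total(2)[OF Ar(5)]
      by (simp add: hom_def far_cmp[OF T.proj])
    then show "far (Y_chi (wtgt m) \<circ>\<^sub>F wtotal m) f \<cdot>\<^bsub>arrow_cat T.bas\<^esub> cpt (zeta (Y1 m)) a =
        cpt (zeta (Y1 m)) b \<cdot>\<^bsub>arrow_cat T.bas\<^esub> far ((wbase m)\<^bold>\<two> \<circ>\<^sub>F Y_chi (wsrc m)) f"
      using sq[OF a] sq[OF b] a b Ar T.Y_square[OF Hf] S.Y_square[OF f]
        far_square[OF base S.Y_square[OF f]] far_hom[OF T.proj Hf]
        fob_Ob[OF total a] fob_Ob[OF total b] Hf
      by (simp add: src_far[OF total] tgt_far[OF total] proj_total(2)) (simp add: hom_def T.B.chase)
  qed (simp_all add: Y1_def Let_def)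
  then show ?thesis
    using S.Y0 T.Y0 fib_1cell proj_total(1) by (intro lax_comp_morphismI) simp_all
qed

lemma Y1_id:
  assumes "w_comonad W" shows "Y1 (wmor_id W) = compmor_id (Y0 W)"
proof -
  interpret w_comonad W by fact
  show ?thesis
  proof (rule lax_comp_eqI[OF Y1_lax[OF wmor_id_lax[OF assms]] compmor_id_lax[OF Y0]])
    fix e assume "e \<in> Ob (total_cat (cfib (csrc (compmor_id (Y0 W)))))"
    then have e: "e \<in> Ob (tot)" by simp
    then show "sq_dom (cpt (zeta (Y1 (wmor_id W))) e) = sq_dom (cpt (zeta (compmor_id (Y0 W))) e)"
      using compmor_id_zeta[OF Y0, of e] wmor_id_theta[OF assms e] eps[OF e] K_Ob[OF e]
      by (simp add: hom_def functor_chase[OF proj])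
  qed simp_all
qed

text \<open>Projecting the composite \<open>theta\<close> turns \<open>wtotal n\<close> into
  \<open>wbase n\<close>, since 1-cells of \<open>Fib\<close> commute with the projections.\<close>

lemma Y1_comp:
  assumes m: "lax_w_morphism m" and n: "lax_w_morphism n" and mn: "wtgt m = wsrc n"
  shows "Y1 (wmor_comp n m) = compmor_comp (Y1 n) (Y1 m)"
proof -
  interpret m: lax_w_morphism m by fact
  interpret n: lax_w_morphism n by fact
  have mn': "ctgt (Y1 m) = csrc (Y1 n)" using mn by simp
  show ?thesis
  proof (rule lax_comp_eqI[OF Y1_lax[OF wmor_comp_lax[OF assms]] compmor_comp_lax[OF Y1_lax[OF m]
      Y1_lax[OF n] mn']])
    fix e assume "e \<in> Ob (total_cat (cfib (csrc (compmor_comp (Y1 n) (Y1 m)))))"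
    then have e: "e \<in> Ob m.S.tot" by simp
    have He: "fob (wtotal m) e \<in> Ob n.S.tot" using fob_Ob[OF m.total e] by (simp add: mn)
    have t: "cpt (theta m) e \<in> Ar n.S.tot"
      "tgt n.S.tot (cpt (theta m) e) = fob (wK (wsrc n)) (fob (wtotal m) e)" using m.theta[OF e]
        by (auto simp: hom_def mn)
    show "sq_dom (cpt (zeta (Y1 (wmor_comp n m))) e) = sq_dom (cpt (zeta (compmor_comp (Y1 n) (Y1 m)))
        e)"
      using e He t n.theta[OF He]
      by (simp add: wmor_comp_theta[OF assms] compmor_comp_zt[OF Y1_lax[OF m] Y1_lax[OF n] mn']
        n.proj_total(2) hom_def
        functor_chase[OF n.T.proj] functor_chase[OF n.total] mn)
  qed simp_all
qed

text \<open>Arrows into the source of a counit component are fixed by their projection and their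
  composite with the counit, and for \<open>theta\<close> the latter is prescribed. The endpoints
  are fixed in advance, because \<open>Y0\<close> forgets which cartesian arrows over the projected
  counit are used.\<close>

lemma Y1_inj:
  assumes m: "lax_w_morphism m" and n: "lax_w_morphism n" and mn: "wsrc m = wsrc n" "wtgt m = wtgt n"
    and eq: "Y1 m = Y1 n"
  shows "m = n"
proof -
  interpret m: lax_w_morphism m by fact
  interpret n: lax_w_morphism n by fact
  have bt: "wbase m = wbase n" "wtotal m = wtotal n"
    using arg_cong[OF eq, of cbase] arg_cong[OF eq, of ctotal] by simp_all
  show ?thesis
  proof (rule lax_w_eqI[OF m n mn bt])
    fix e assume e: "e \<in> Ob n.S.tot"
    then have e': "e \<in> Ob m.S.tot" by (simp add: mn)
    note He = fob_Ob[OF n.total e]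
    show "m.th e = n.th e"
    proof (rule cartesian_cancel[OF n.T.proj n.T.eps_cartesian[OF He] n.T.eps[OF He] _ n.theta[OF e]])
      show "m.th e \<in> hom n.T.tot (fob (wtotal n) (fob (wK (wsrc n)) e)) (fob (wK (wtgt n)) (fob (wtotal
          n) e))"
        using m.theta[OF e'] by (simp add: mn bt)
      show "far (n.T.prj) (m.th e) = far (n.T.prj) (n.th e)"
        using arg_cong[OF eq, of "\<lambda>m. sq_dom (cpt (zeta m) e)"] e e' by (simp add: mn)
      show "n.T.ep (fob (wtotal n) e) \<cdot>\<^bsub>n.T.tot\<^esub> m.th e = n.T.ep (fob (wtotal n) e) \<cdot>\<^bsub>n.T.tot\<^esub> n.th e"
        using m.theta_eps[OF e'] n.theta_eps[OF e] by (simp add: mn bt)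
    qed
  qed
qed

text \<open>The formula of \<open>X1\<close> with freely prescribed w-comonads at both ends. Between
  images of \<open>X0\<close> it is \<open>X1\<close>; applied to an identity it gives the
  comparison of two w-comonads with the same image under \<open>Y0\<close>.\<close>

definition Y1_inv :: "('e, 'f, 'o, 'a) wcmd \<Rightarrow> ('e, 'f, 'o, 'a) wcmd \<Rightarrow> ('e, 'f, 'o, 'a) compmor
    \<Rightarrow> ('e, 'f, 'o, 'a) wmor" where
  "Y1_inv W W' m = \<lparr>wsrc = W, wtgt = W', wbase = cbase m, wtotal = ctotal m,
     theta = \<lparr>nsrc = ctotal m \<circ>\<^sub>F wK W, ntgt = wK W' \<circ>\<^sub>F ctotal m,
       cpt = (\<lambda>e\<in>Ob (total_cat (wfib W)). THE h.
         h \<in> hom (total_cat (wfib W')) (fob (ctotal m) (fob (wK W) e)) (fob (wK W') (fob (ctotal m) e)) \<and>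
         far (proj (wfib W')) h = sq_dom (cpt (zeta m) e) \<and>
         cpt (w\<epsilon> W') (fob (ctotal m) e) \<cdot>\<^bsub>total_cat (wfib W')\<^esub> h = far (ctotal m) (cpt (w\<epsilon> W) e))\<rparr>\<rparr>"

lemma Y1_inv_simps [simp]: "wsrc (Y1_inv W W' m) = W" "wtgt (Y1_inv W W' m) = W'"
  "wbase (Y1_inv W W' m) = cbase m" "wtotal (Y1_inv W W' m) = ctotal m"
  by (simp_all add: Y1_inv_def)

text \<open>Each component of \<open>theta\<close> is the lift of \<open>zt\<close> along the
  cartesian counit of \<open>W'\<close>. Naturality is checked by cancelling this counit, and
  \<open>lax_w_morphismI\<close> takes care of the comultiplication.\<close>

lemma
  assumes W: "w_comonad W" and W': "w_comonad W'" and m: "lax_comp_morphism m"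
      and st: "csrc m = Y0 W" "ctgt m = Y0 W'"
  shows Y1_inv_lax: "lax_w_morphism (Y1_inv W W' m)" and Y1_Y1_inv: "Y1 (Y1_inv W W' m) = m"
proof -
  interpret W: w_comonad W by fact
  interpret W': w_comonad W' by fact
  interpret m: lax_comp_morphism m by fact
  let ?H = "ctotal m" and ?C = "cbase m"
  let ?\<theta> = "cpt (theta (Y1_inv W W' m))"
  note fib = m.fib_1cell[unfolded st Y_simps]
  note H = fib_1cellD(2)[OF fib] and C = fib_1cellD(1)[OF fib] and pH = fib_1cellD(4,5)[OF fib]
  have *: "?\<theta> e \<in> hom W'.tot (fob ?H (fob (wK W) e)) (fob (wK W') (fob ?H e)) \<and> far W'.prj (?\<theta> e)
      = m.zt e \<and>
    W'.ep (fob ?H e) \<cdot>\<^bsub>W'.tot\<^esub> ?\<theta> e = far ?H (W.ep e)" if e: "e \<in> Ob W.tot" for e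
  proof -
    have e': "e \<in> Ob m.S.tot" using e by (simp add: st)
    note He = fob_Ob[OF H e] and Ke = W.K_Ob[OF e]
    have eAr: "W.ep e \<in> Ar W.tot" "src W.tot (W.ep e) = fob (wK W) e" using W.eps[OF e]
      by (simp_all add: hom_def)
    have eAr': "W'.ep (fob ?H e) \<in> Ar W'.tot" "src W'.tot (W'.ep (fob ?H e)) = fob (wK W') (fob ?H e)"
      using W'.eps[OF He] by (simp_all add: hom_def)
    have z: "m.zt e \<in> hom (W'.bas) (fob W'.prj (fob ?H (fob (wK W) e))) (fob W'.prj (fob (wK W') (fob ?H
        e)))"
      using m.zt[OF e'] e He eAr eAr' pH(1)[OF Ke]
        by (simp add: st src_far[OF W.proj] src_far[OF W'.proj])
    \<comment> \<open>This factorisation in the base is the commutativity of the square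
      \<open>zeta\<close> at \<open>e\<close>; its lift is the wanted component.\<close>
    have "far W'.prj (W'.ep (fob ?H e)) \<cdot>\<^bsub>W'.bas\<^esub> m.zt e = far W'.prj (far ?H (W.ep e))"
      using m.zt_chi[OF e'] e He eAr by (simp add: st pH(2))
    then show ?thesis
      using theI'[OF cartesian_ex1[OF W'.proj W'.eps_cartesian[OF He] W'.eps[OF He] far_hom[OF H W.eps[OF
        e]] z]] e
      by (simp add: Y1_inv_def)
  qed
  show l: "lax_w_morphism (Y1_inv W W' m)"
  proof (rule lax_w_morphismI)
    show "theta (Y1_inv W W' m) : wtotal (Y1_inv W W' m) \<circ>\<^sub>F wK (wsrc (Y1_inv W W' m)) \<Rightarrow>\<^sub>N
       wK (wtgt (Y1_inv W W' m)) \<circ>\<^sub>F wtotal (Y1_inv W W' m)"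
    proof (simp, rule nt_betwI[OF fcomp_betw[OF W.wK H] fcomp_betw[OF H W'.wK]])
      fix f a b assume f: "f \<in> hom W.tot a b"
      then have f': "f \<in> hom m.S.tot a b" by (simp add: st)
      note ab = W.E.hom_Ob[OF f] and Hf = far_hom[OF H f] and KHf = W'.K_hom[OF far_hom[OF H f]]
        and HKf = far_hom[OF H W.K_hom[OF f]]
      note Ha = fob_Ob[OF H ab(1)] and Hb = fob_Ob[OF H ab(2)]
      have a: "?\<theta> a \<in> hom W'.tot (fob ?H (fob (wK W) a)) (fob (wK W') (fob ?H a))"
          "far W'.prj (?\<theta> a) = m.zt a"
        "W'.ep (fob ?H a) \<cdot>\<^bsub>W'.tot\<^esub> ?\<theta> a = far ?H (W.ep a)" using *[OF ab(1)] by auto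
      have b: "?\<theta> b \<in> hom W'.tot (fob ?H (fob (wK W) b)) (fob (wK W') (fob ?H b))"
          "far W'.prj (?\<theta> b) = m.zt b"
        "W'.ep (fob ?H b) \<cdot>\<^bsub>W'.tot\<^esub> ?\<theta> b = far ?H (W.ep b)" using *[OF ab(2)] by auto
      note homs = f Hf KHf HKf W.eps[OF ab(1)] W.eps[OF ab(2)] W.K_hom[OF f] W'.eps[OF Ha] W'.eps[OF Hb]
        a(1) b(1)
         far_hom[OF H W.eps[OF ab(1)]] far_hom[OF H W.eps[OF ab(2)]]
      have "far (wK W') (far ?H f) \<cdot>\<^bsub>W'.tot\<^esub> ?\<theta> a = ?\<theta> b \<cdot>\<^bsub>W'.tot\<^esub> far ?H (far (wK W) f)"
      proof (rule cartesian_cancel[OF W'.proj W'.eps_cartesian[OF Hb] W'.eps[OF Hb] W'.E.cmp_hom[OF a(1)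
          KHf] W'.E.cmp_hom[OF HKf b(1)]])
        \<comment> \<open>Over the base the equation is the naturality of \<open>zt\<close>; the
          calculation after it compares the composites with the counit.\<close>
        have "far W'.prj (far (wK W') (far ?H f)) \<cdot>\<^bsub>W'.bas\<^esub> m.zt a = m.zt b
            \<cdot>\<^bsub>W'.bas\<^esub> far ?C (far W.prj (far (wK W) f))"
          using m.zt_natural[OF f'] f Hf by (simp add: st hom_def)
        then show "far W'.prj (far (wK W') (far ?H f) \<cdot>\<^bsub>W'.tot\<^esub> ?\<theta> a) = far W'.prj (?\<theta> b
            \<cdot>\<^bsub>W'.tot\<^esub> far ?H (far (wK W) f))"
          using homs by (simp add: hom_def far_cmp[OF W'.proj] a(2) b(2) pH(2))
        have "W'.ep (fob ?H b) \<cdot>\<^bsub>W'.tot\<^esub> far (wK W') (far ?H f) \<cdot>\<^bsub>W'.tot\<^esub> ?\<theta> a = (W'.ep (fob ?H b)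
            \<cdot>\<^bsub>W'.tot\<^esub> far (wK W') (far ?H f)) \<cdot>\<^bsub>W'.tot\<^esub> ?\<theta> a"
          using homs by (simp add: hom_def W'.E.assoc)
        also have "\<dots> = far ?H f \<cdot>\<^bsub>W'.tot\<^esub> (W'.ep (fob ?H a) \<cdot>\<^bsub>W'.tot\<^esub> ?\<theta> a)"
          unfolding W'.eps_natural[OF Hf, symmetric] using homs by (simp add: hom_def W'.E.assoc)
        also have "\<dots> = far ?H (f \<cdot>\<^bsub>W.tot\<^esub> W.ep a)"
          unfolding a(3) using homs by (simp add: hom_def far_cmp[OF H])
        also have "\<dots> = (W'.ep (fob ?H b) \<cdot>\<^bsub>W'.tot\<^esub> ?\<theta> b) \<cdot>\<^bsub>W'.tot\<^esub> far ?H (far (wK W) f)"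
          unfolding b(3) W.eps_natural[OF f] using homs by (simp add: hom_def far_cmp[OF H])
        finally show "W'.ep (fob ?H b) \<cdot>\<^bsub>W'.tot\<^esub> far (wK W') (far ?H f) \<cdot>\<^bsub>W'.tot\<^esub> ?\<theta> a =
            W'.ep (fob ?H b) \<cdot>\<^bsub>W'.tot\<^esub> ?\<theta> b \<cdot>\<^bsub>W'.tot\<^esub> far ?H (far (wK W) f)"
          using homs by (simp add: hom_def W'.E.assoc)
      qed
      then show "far (wK W' \<circ>\<^sub>F ?H) f \<cdot>\<^bsub>W'.tot\<^esub> ?\<theta> a = ?\<theta> b \<cdot>\<^bsub>W'.tot\<^esub> far (?H \<circ>\<^sub>F wK W) f"
        using f functor_betwD(2)[OF H] functor_betwD(2)[OF W.wK] by (simp add: hom_def)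
    qed (use * functor_betwD(2)[OF H] functor_betwD(2)[OF W.wK] in \<open>auto simp: Y1_inv_def\<close>)
  qed (use W W' fib * in \<open>simp_all\<close>)
  show "Y1 (Y1_inv W W' m) = m"
  proof (rule lax_comp_eqI[OF Y1_lax[OF l] m])
    fix e assume "e \<in> Ob m.S.tot"
    then have e: "e \<in> Ob W.tot" by (simp add: st)
    show "sq_dom (cpt (zeta (Y1 (Y1_inv W W' m))) e) = m.zt e"
      using e *[OF e] by simp
  qed (simp_all add: st)
qed

section \<open>2-cells of w-comonads and their images under \<open>Y\<close>\<close>

definition w_compat :: "(('e, 'f, 'o, 'a) wmor, 'e, 'f, 'o, 'a) fib2 \<Rightarrow> bool" where
  "w_compat t \<longleftrightarrow> (\<forall>e\<in>Ob (total_cat (wfib (wsrc (csrc2 t)))).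
      far (wK (wtgt (csrc2 t))) (cpt (total_nt t) e) \<cdot>\<^bsub>total_cat (wfib (wtgt (csrc2 t)))\<^esub> cpt
          (theta (csrc2 t)) e =
      cpt (theta (ctgt2 t)) e \<cdot>\<^bsub>total_cat (wfib (wtgt (csrc2 t)))\<^esub> cpt (total_nt t)
          (fob (wK (wsrc (csrc2 t))) e))"

lemma theta_compat_iff:
  assumes m: "lax_w_morphism m" and n: "lax_w_morphism n" and mn: "wsrc n = wsrc m" "wtgt n = wtgt m"
    and phi: "\<phi> : wtotal m \<Rightarrow>\<^sub>N wtotal n"
  shows "(wK (wtgt m) \<rhd> \<phi>) \<bullet>\<^sub>N theta m = theta n \<bullet>\<^sub>N (\<phi> \<lhd> wK (wsrc m)) \<longleftrightarrow>
    (\<forall>e\<in>Ob (total_cat (wfib (wsrc m))).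
      far (wK (wtgt m)) (cpt \<phi> e) \<cdot>\<^bsub>total_cat (wfib (wtgt m))\<^esub> cpt (theta m) e =
      cpt (theta n) e \<cdot>\<^bsub>total_cat (wfib (wtgt m))\<^esub> cpt \<phi> (fob (wK (wsrc m)) e))"
    (is "?l = ?r \<longleftrightarrow> (\<forall>e\<in>_. ?c e)")
proof -
  interpret m: lax_w_morphism m by fact
  interpret n: lax_w_morphism n by fact
  note mt = m.total and nt = n.total[unfolded mn]
  note [simp] = functor_betwD(2,3)[OF mt]  functor_betwD(2,3)[OF nt] nt_betwD[OF m.theta_nt]
    nt_betwD[OF n.theta_nt]
    nt_betwD[OF phi] functor_betwD(2,3)[OF m.S.wK]
  have pt: "cpt ?l e = cpt ?r e \<longleftrightarrow> ?c e" if e: "e \<in> Ob m.S.tot" for e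
    using e by simp
  show ?thesis
  proof
    assume "?l = ?r" then show "\<forall>e\<in>Ob m.S.tot. ?c e" using pt by simp
  next
    assume *: "\<forall>e\<in>Ob m.S.tot. ?c e"
    show "?l = ?r"
      by (rule nt_eqI[where S = "Ob m.S.tot"]) (use * pt in \<open>simp_all add: mn vcomp_def\<close>)
  qed
qed

lemma w_2cell_iff: "w_2cell t \<longleftrightarrow> lax_w_morphism (csrc2 t) \<and> lax_w_morphism (ctgt2 t) \<and>
   wsrc (ctgt2 t) = wsrc (csrc2 t) \<and> wtgt (ctgt2 t) = wtgt (csrc2 t) \<and>
   fib_2cell (wfib (wsrc (csrc2 t))) (wfib (wtgt (csrc2 t)))
          (wbase (csrc2 t)) (wtotal (csrc2 t)) (wbase (ctgt2 t)) (wtotal (ctgt2 t))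
          (base_nt t) (total_nt t) \<and> w_compat t"
  using theta_compat_iff[of "csrc2 t" "ctgt2 t" "total_nt t"] fib2_2cell_betw(2)
  unfolding w_2cell_def w_compat_def by blast

lemma WCmd_simps [simp]: "Cell0 WCmd = {Q. w_comonad Q}" "Cell1 WCmd = {m. lax_w_morphism m}"
  "Cell2 WCmd = {t. w_2cell t}" "dom1 WCmd = wsrc" "cod1 WCmd = wtgt" "dom2 WCmd = csrc2"
      "cod2 WCmd = ctgt2"
  "id1 WCmd = wmor_id" "cmp1 WCmd = wmor_comp" "vcmp WCmd = fib2_vcmp" "hcmp WCmd = fib2_hcmp wmor_comp"
  "id2 WCmd = (\<lambda>m. \<lparr>csrc2 = m, ctgt2 = m, base_nt = idn (wbase m), total_nt = idn (wtotal m)\<rparr>)"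
  by (simp_all add: WCmd_def)

lemma cells1_WCmd: "m \<in> cells1 WCmd Q Q' \<longleftrightarrow> lax_w_morphism m \<and> wsrc m = Q \<and> wtgt m = Q'"
  by (auto simp: cells1_def)

lemma cells2_WCmd: "t \<in> cells2 WCmd m n \<longleftrightarrow> w_2cell t \<and> csrc2 t = m \<and> ctgt2 t = n"
  by (auto simp: cells2_def)

text \<open>The condition on the right is the projection of the one on the left. Nothing is lost by
  projecting: both sides upstairs end at the source of a cartesian counit component and have equal
  composites with it.\<close>

lemma w_compat_iff_Y2:
  assumes m: "lax_w_morphism (csrc2 t)" and n: "lax_w_morphism (ctgt2 t)"
      and mn: "wsrc (ctgt2 t) = wsrc (csrc2 t)" "wtgt (ctgt2 t) = wtgt (csrc2 t)"
    and fib: "fib_2cell (wfib (wsrc (csrc2 t))) (wfib (wtgt (csrc2 t)))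
          (wbase (csrc2 t)) (wtotal (csrc2 t)) (wbase (ctgt2 t)) (wtotal (ctgt2 t)) (base_nt t)
            (total_nt t)"
  shows "w_compat t \<longleftrightarrow> comp_compat (Y2 t)"
proof -
  interpret m: lax_w_morphism "csrc2 t" by fact
  interpret n: lax_w_morphism "ctgt2 t" by fact
  let ?m = "csrc2 t" and ?n = "ctgt2 t" let ?\<phi> = "total_nt t"
  let ?K = "wK (wsrc ?m)" and ?K' = "wK (wtgt ?m)"
  note ntotal = n.total[unfolded mn]
  note fib' = fib[unfolded fib_2cell_iff[OF m.S.proj_functor m.fib_1cell n.fib_1cell[unfolded mn]]]
  then have phi: "?\<phi> : wtotal ?m \<Rightarrow>\<^sub>N wtotal ?n" by simp
  have "far ?K' (cpt ?\<phi> e) \<cdot>\<^bsub>m.T.tot\<^esub> m.th e = n.th e \<cdot>\<^bsub>m.T.tot\<^esub> cpt ?\<phi> (fob ?K e) \<longleftrightarrow>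
    far (ext_functor (Y0 (wtgt ?m))) (cpt ?\<phi> e) \<cdot>\<^bsub>m.T.bas\<^esub> sq_dom (cpt (zeta (Y1 ?m)) e) =
    sq_dom (cpt (zeta (Y1 ?n)) e) \<cdot>\<^bsub>m.T.bas\<^esub> cpt (base_nt t) (fob (ext_functor (Y0 (wsrc ?m))) e)"
    (is "?l = ?r \<longleftrightarrow> ?l' = ?r'") if e: "e \<in> Ob m.S.tot" for e
  proof -
    have e': "e \<in> Ob n.S.tot" using e by (simp add: mn)
    note Ke = m.S.K_Ob[OF e] and He = fob_Ob[OF m.total e] and H2e = fob_Ob[OF ntotal e]
    note ph = cpt_hom[OF phi m.total e] and phK = cpt_hom[OF phi m.total Ke]
    note t1 = m.theta[OF e] and t2 = n.theta[OF e', unfolded mn]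
    have Ar: "cpt ?\<phi> e \<in> Ar m.T.tot" using ph by (simp add: hom_def)
    have eAr: "m.S.ep e \<in> Ar m.S.tot" "src m.S.tot (m.S.ep e) = fob ?K e"
      using m.S.eps[OF e] by (simp_all add: hom_def)
    have l: "far m.T.prj ?l = ?l'"
      using e Ar t1 m.T.K_hom[OF ph] by (simp add: hom_def far_cmp[OF m.T.proj])
    \<comment> \<open>The \<open>Fib\<close> condition at \<open>fob ?K e\<close> trades the
      projection of \<open>?\<phi>\<close> for \<open>base_nt t\<close> at the extension of
      \<open>e\<close>.\<close>
    have r: "far m.T.prj ?r = ?r'"
      using e e' t2 phK Ke fib' eAr by (simp add: mn hom_def far_cmp[OF m.T.proj] src_far[OF m.S.proj])
    show ?thesis
    proof
      assume "?l = ?r" then show "?l' = ?r'" using l r by simp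
    next
      assume lr: "?l' = ?r'"
      show "?l = ?r"
      proof (rule cartesian_cancel[OF m.T.proj m.T.eps_cartesian[OF H2e] m.T.eps[OF H2e]
            m.T.E.cmp_hom[OF t1 m.T.K_hom[OF ph]] m.T.E.cmp_hom[OF phK t2]])
        show "far m.T.prj ?l = far m.T.prj ?r" using l r lr by simp
        note homs = ph phK t1 t2 m.T.K_hom[OF ph] m.T.eps[OF H2e] m.T.eps[OF He]
        \<comment> \<open>After the counit both sides equal \<open>cpt ?\<phi> e\<close> composed
          with \<open>far (wtotal ?m) (m.S.ep e)\<close>, by naturality of the counit and of
          \<open>?\<phi>\<close>.\<close>
        have "m.T.ep (fob (wtotal ?n) e) \<cdot>\<^bsub>m.T.tot\<^esub> ?l = (m.T.ep (fob (wtotal ?n) e)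
            \<cdot>\<^bsub>m.T.tot\<^esub> far ?K' (cpt ?\<phi> e)) \<cdot>\<^bsub>m.T.tot\<^esub> m.th e"
          using homs by (simp add: hom_def m.T.E.assoc)
        also have "\<dots> = cpt ?\<phi> e \<cdot>\<^bsub>m.T.tot\<^esub> (m.T.ep (fob (wtotal ?m) e) \<cdot>\<^bsub>m.T.tot\<^esub> m.th e)"
          unfolding m.T.eps_natural[OF ph, symmetric] using homs by (simp add: hom_def m.T.E.assoc)
        also have "\<dots> = far (wtotal ?n) (m.S.ep e) \<cdot>\<^bsub>m.T.tot\<^esub> cpt ?\<phi> (fob ?K e)"
          unfolding m.theta_eps[OF e] by (rule naturality[OF phi m.total m.S.eps[OF e], symmetric])
        also have "\<dots> = m.T.ep (fob (wtotal ?n) e) \<cdot>\<^bsub>m.T.tot\<^esub> ?r"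
          using homs n.theta_eps[OF e', unfolded mn, symmetric] by (simp add: hom_def m.T.E.assoc)
        finally show "m.T.ep (fob (wtotal ?n) e) \<cdot>\<^bsub>m.T.tot\<^esub> ?l = m.T.ep (fob (wtotal ?n) e) \<cdot>\<^bsub>m.T.tot\<^esub> ?r" .
      qed
    qed
  qed
  then show ?thesis by (simp add: w_compat_def comp_compat_def Y2_def)
qed

lemma w_2cell_iff_Y2:
  assumes "lax_w_morphism (csrc2 t)" "lax_w_morphism (ctgt2 t)" "wsrc (ctgt2 t) = wsrc (csrc2 t)"
      "wtgt (ctgt2 t) = wtgt (csrc2 t)"
  shows "w_2cell t \<longleftrightarrow> comp_2cell (Y2 t)"
  using assms w_compat_iff_Y2[OF assms] Y1_lax by (auto simp: w_2cell_iff comp_2cell_iff Y2_def)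

lemma Y2_cells2:
  assumes "t \<in> cells2 WCmd m n" shows "Y2 t \<in> cells2 CompCat (Y1 m) (Y1 n)"
  using assms w_2cell_iff_Y2[of t] by (auto simp: cells2_WCmd cells2_CompCat w_2cell_iff Y2_def)

lemma Y1_cells1: "m \<in> cells1 WCmd W W' \<Longrightarrow> Y1 m \<in> cells1 CompCat (Y0 W) (Y0 W')"
  by (auto simp: cells1_WCmd cells1_CompCat Y1_lax)

text \<open>\<open>Y\<close> is faithful on 1-cells and reflects 2-cells, so the laws are inherited from \<open>CompCat\<close>.\<close>

interpretation WCmd: over_Fib WCmd wfib wbase wtotal w_compat
proof (rule over_Fib.intro, goal_cases)
  case (1 f) then show ?case by (simp add: lax_w_morphism.src_w_comonad)
next
  case (2 f) then show ?case by (simp add: lax_w_morphism.tgt_w_comonad)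
next
  case (3 a) then show ?case by (simp add: cells1_WCmd wmor_id_lax)
next
  case (4 f a b g c) then show ?case by (auto simp: cells1_WCmd wmor_comp_lax)
next
  case (5 f a b)
  then have f: "lax_w_morphism f" "wsrc f = a" "wtgt f = b" "w_comonad b"
    by (auto simp: cells1_WCmd lax_w_morphism.tgt_w_comonad)
  have l: "lax_w_morphism (wmor_comp (wmor_id b) f)" using f by (simp add: wmor_comp_lax wmor_id_lax)
  \<comment> \<open>Both sides have the same endpoints, so \<open>Y1_inj\<close> allows the law to
    be tested in \<open>CompCat\<close>. The other unit law and associativity go the same
    way.\<close>
  show ?case
    using f CC.cmp1_id_left[OF Y1_cells1[OF 5]] Y1_inj[OF l f(1)]
      by (simp add: Y1_comp Y1_id wmor_id_lax)
next
  case (6 f a b)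
  then have f: "lax_w_morphism f" "wsrc f = a" "wtgt f = b" "w_comonad a"
    by (auto simp: cells1_WCmd lax_w_morphism.src_w_comonad)
  have l: "lax_w_morphism (wmor_comp f (wmor_id a))" using f by (simp add: wmor_comp_lax wmor_id_lax)
  show ?case
    using f CC.cmp1_id_right[OF Y1_cells1[OF 6]] Y1_inj[OF l f(1)]
      by (simp add: Y1_comp Y1_id wmor_id_lax)
next
  case (7 f a b g c h d)
  then have l: "lax_w_morphism f" "lax_w_morphism g" "lax_w_morphism h" "wtgt f = wsrc g"
      "wtgt g = wsrc h" by (auto simp: cells1_WCmd)
  have k: "lax_w_morphism (wmor_comp (wmor_comp h g) f)" "lax_w_morphism (wmor_comp h (wmor_comp g f))"
    using l by (simp_all add: wmor_comp_lax)
  show ?case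
    using l CC.cmp1_assoc[OF Y1_cells1[OF 7(1)] Y1_cells1[OF 7(2)] Y1_cells1[OF 7(3)]] Y1_inj[OF k]
    by (simp add: Y1_comp wmor_comp_lax)
next
  case (8 a) then show ?case by (simp add: cloven_fibration.proj_functor w_comonad.cloven)
next
  case (9 f a b) then show ?case by (auto simp: cells1_WCmd lax_w_morphism.fib_1cell)
next
  case (19 t) show ?case by (simp add: w_2cell_iff)
next
  case (20 f)
  then have f: "lax_w_morphism f" by simp
  \<comment> \<open>\<open>Y2\<close> sends this 2-cell to the identity on \<open>Y1 f\<close>, and
    the condition upstairs follows by reflection. The two compositions are handled in the same
    manner.\<close>
  have "comp_2cell (Y2 (id2 WCmd f))"
    using CC.id2_cell[of "Y1 f"] Y1_lax[OF f] by (simp add: cells2_CompCat Y2_def)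
  then have "w_2cell (id2 WCmd f)" using f w_2cell_iff_Y2[of "id2 WCmd f"] by simp
  then show ?case by (simp add: w_2cell_iff)
next
  case (21 f a b \<alpha> g \<beta> h)
  have "comp_2cell (fib2_vcmp (Y2 \<beta>) (Y2 \<alpha>))"
    using CC.vcmp_cell[OF Y2_cells2[OF 21(2)] Y2_cells2[OF 21(3)]] by (simp add: cells2_CompCat)
  moreover have "fib2_vcmp (Y2 \<beta>) (Y2 \<alpha>) = Y2 (fib2_vcmp \<beta> \<alpha>)" by (simp add: fib2_vcmp_def Y2_def)
  ultimately have "w_2cell (fib2_vcmp \<beta> \<alpha>)"
    using 21 w_2cell_iff_Y2[of "fib2_vcmp \<beta> \<alpha>"] by (auto simp: cells2_WCmd w_2cell_iff fib2_vcmp_def)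
  then show ?case by (simp add: w_2cell_iff)
next
  case (22 f a b f' c \<alpha> g \<beta> g')
  then have t: "w_2cell \<alpha>" "w_2cell \<beta>" "lax_w_morphism f" "lax_w_morphism f'" "lax_w_morphism g"
      "lax_w_morphism g'"
    "csrc2 \<alpha> = f" "ctgt2 \<alpha> = g" "csrc2 \<beta> = f'" "ctgt2 \<beta> = g'"
    "wsrc f = a" "wtgt f = b" "wsrc f' = b" "wtgt f' = c" "wsrc g = a" "wtgt g = b" "wsrc g' = b"
        "wtgt g' = c"
    by (auto simp: cells1_WCmd cells2_WCmd w_2cell_iff)
  have "comp_2cell (fib2_hcmp compmor_comp (Y2 \<beta>) (Y2 \<alpha>))"
    using CC.hcmp_cell[OF Y1_cells1[OF 22(1)] Y1_cells1[OF 22(2)] Y2_cells2[OF 22(3)]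
      Y2_cells2[OF 22(4)]] by (simp add: cells2_CompCat)
  moreover have "fib2_hcmp compmor_comp (Y2 \<beta>) (Y2 \<alpha>) = Y2 (fib2_hcmp wmor_comp \<beta> \<alpha>)"
    using t by (simp add: fib2_hcmp_def Y2_def Y1_comp)
  ultimately have "w_2cell (fib2_hcmp wmor_comp \<beta> \<alpha>)"
    using t w_2cell_iff_Y2[of "fib2_hcmp wmor_comp \<beta> \<alpha>"] by (simp add: fib2_hcmp_def wmor_comp_lax)
  then show ?case by (simp add: w_2cell_iff)
qed (simp_all)

lemma two_functor_Y: "two_functor WCmd CompCat Y_2func"
proof (rule two_functor_over_Fib[OF WCmd.over_Fib_axioms CompCat.over_Fib_axioms], goal_cases)
  case (1 a) then show ?case by (simp add: Y_2func_def w_comonad.Y0)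
next
  case (2 f a b) then show ?case by (auto simp: Y_2func_def cells1_WCmd cells1_CompCat Y1_lax)
next
  case (3 a) then show ?case by (simp add: Y_2func_def Y1_id)
next
  case (4 f a b g c) then show ?case by (auto simp add: Y_2func_def Y1_comp cells1_WCmd)
next
  case (9 t) then show ?case using w_compat_iff_Y2[of t] by (simp add: Y_2func_def w_2cell_iff)
qed (simp_all add: Y_2func_def Y2_def)

section \<open>The 2-functor X\<close>

lemma X_simps [simp]: "wfib (X0 Q) = cfib Q" "cmK (wcm (X0 Q)) = X_functor Q"
  "wsrc (X1 m) = X0 (csrc m)" "wtgt (X1 m) = X0 (ctgt m)" "wbase (X1 m) = cbase m"
      "wtotal (X1 m) = ctotal m"
  by (simp_all add: X0_def X1_def X_comonad_def Let_def)

lemma X_counit_simps [simp]: "nsrc (w\<epsilon> (X0 Q)) = X_functor Q"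
    "ntgt (w\<epsilon> (X0 Q)) = idf (total_cat (cfib Q))"
  "cpt (w\<epsilon> (X0 Q)) \<in> extensional (Ob (total_cat (cfib Q)))"
  "e \<in> Ob (total_cat (cfib Q)) \<Longrightarrow> cpt (w\<epsilon> (X0 Q)) e = X_counit Q e"
  by (simp_all add: X0_def X_comonad_def Let_def)

context comprehension_category
begin

lemma X_counit:
  assumes e: "e \<in> Ob tot"
  shows "cartesian prj (X_counit Q e)" "X_counit Q e \<in> hom tot (fob (X_functor Q) e) e"
    "far prj (X_counit Q e) = fob (chi Q) e" "fob prj (fob (X_functor Q) e) = ext_ob e"
proof -
  have fc: "fob (chi Q) e \<in> Ar bas" "tgt bas (fob (chi Q) e) = fob prj e" using fob_chi[OF e]
    by (auto simp: hom_def)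
  note l = lift[OF e fc]
  show c: "cartesian prj (X_counit Q e)" "far prj (X_counit Q e) = fob (chi Q) e"
    using l by (simp_all add: X_counit_def)
  show h: "X_counit Q e \<in> hom tot (fob (X_functor Q) e) e"
    using l e cartesian_Ar[OF c(1)] by (simp add: X_counit_def X_functor_def Let_def hom_def)
  show "fob prj (fob (X_functor Q) e) = ext_ob e"
    using h src_far[OF proj, of "X_counit Q e"] by (simp add: c(2) hom_def)
qed

text \<open>In the base, \<open>chi_square\<close> factors the projection of \<open>f\<close> after
  the counit at \<open>a\<close> through that of the counit at \<open>b\<close>. The cartesian lift
  therefore exists uniquely, which justifies the definite description in
  \<open>X_functor\<close>.\<close>

lemma X_far:
  assumes f: "f \<in> hom tot a b"
  shows "far (X_functor Q) f \<in> hom tot (fob (X_functor Q) a) (fob (X_functor Q) b)"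
    "far prj (far (X_functor Q) f) = ext_ar f"
    "X_counit Q b \<cdot>\<^bsub>tot\<^esub> far (X_functor Q) f = f \<cdot>\<^bsub>tot\<^esub> X_counit Q a"
proof -
  note ab = E.hom_Ob[OF f]
  note a = X_counit[OF ab(1)] and b = X_counit[OF ab(2)]
  have "far prj (X_counit Q b) \<cdot>\<^bsub>bas\<^esub> ext_ar f = far prj (f \<cdot>\<^bsub>tot\<^esub> X_counit Q a)"
    using chi_square[OF f] f a(2) by (simp add: b(3) a(3) far_cmp[OF proj] hom_def)
  moreover have "ext_ar f \<in> hom bas (fob prj (fob (X_functor Q) a)) (fob prj (fob (X_functor Q) b))"
    using ext_ar[OF f] by (simp add: a(4) b(4))
  ultimately have ex1: "\<exists>!h. h \<in> hom tot (fob (X_functor Q) a) (fob (X_functor Q) b) \<and> far prj h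
      = ext_ar f \<and>
      X_counit Q b \<cdot>\<^bsub>tot\<^esub> h = f \<cdot>\<^bsub>tot\<^esub> X_counit Q a"
    using cartesian_ex1[OF proj b(1,2) E.cmp_hom[OF a(2) f]] by blast
  have "src tot (X_counit Q a) = fob (X_functor Q) a" "src tot (X_counit Q b) = fob (X_functor Q) b"
    using a(2) b(2) by (simp_all add: hom_def)
  then have "far (X_functor Q) f = (THE h. h \<in> hom tot (fob (X_functor Q) a) (fob (X_functor Q) b)
      \<and> far prj h = ext_ar f \<and>
      X_counit Q b \<cdot>\<^bsub>tot\<^esub> h = f \<cdot>\<^bsub>tot\<^esub> X_counit Q a)"
    using f by (simp add: X_functor_def Let_def hom_def)
  with theI'[OF ex1]
  show "far (X_functor Q) f \<in> hom tot (fob (X_functor Q) a) (fob (X_functor Q) b)"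
    "far prj (far (X_functor Q) f) = ext_ar f"
    "X_counit Q b \<cdot>\<^bsub>tot\<^esub> far (X_functor Q) f = f \<cdot>\<^bsub>tot\<^esub> X_counit Q a" by simp_all
qed

text \<open>In each functor law the two sides have the same image in the base and the same composite
  with the counit.\<close>

lemma X_functor: "X_functor Q : tot \<rightarrow>\<^sub>F tot"
proof (rule functor_betwI[OF E.category_axioms E.category_axioms])
  fix a assume a: "a \<in> Ob tot"
  note e = X_counit[OF a] and i = X_far[OF E.ide_hom[OF a]]
  show Ka: "fob (X_functor Q) a \<in> Ob tot" using E.hom_Ob[OF e(2)] by simp
  show "far (X_functor Q) (ide tot a) = ide tot (fob (X_functor Q) a)"
  proof (rule cartesian_cancel[OF proj e(1,2) i(1) E.ide_hom[OF Ka]])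
    show "far prj (far (X_functor Q) (ide tot a)) = far prj (ide tot (fob (X_functor Q) a))"
      by (simp add: i(2) ext_ar_ide[OF a] far_ide[OF proj Ka] e(4))
    show "X_counit Q a \<cdot>\<^bsub>tot\<^esub> far (X_functor Q) (ide tot a) = X_counit Q a
        \<cdot>\<^bsub>tot\<^esub> ide tot (fob (X_functor Q) a)"
      using e(2) a by (simp add: i(3) hom_def E.chase)
  qed
next
  fix f g a b c assume f: "f \<in> hom tot a b" and g: "g \<in> hom tot b c" and c: "c \<in> Ob tot"
      and a: "a \<in> Ob tot" and b: "b \<in> Ob tot"
  note ea = X_counit[OF a] and eb = X_counit[OF b] and ec = X_counit[OF c]
  note F = X_far[OF f] and G = X_far[OF g] and GF = X_far[OF E.cmp_hom[OF f g]]
  note homs = f g ea(2) eb(2) ec(2) F(1) G(1) GF(1)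
  show "far (X_functor Q) (g \<cdot>\<^bsub>tot\<^esub> f) = far (X_functor Q) g \<cdot>\<^bsub>tot\<^esub> far (X_functor Q) f"
  proof (rule cartesian_cancel[OF proj ec(1,2) GF(1) E.cmp_hom[OF F(1) G(1)]])
    show "far prj (far (X_functor Q) (g \<cdot>\<^bsub>tot\<^esub> f)) = far prj (far (X_functor Q) g
        \<cdot>\<^bsub>tot\<^esub> far (X_functor Q) f)"
      using F(1) G(1) ext_ar_cmp[OF f g] by (simp add: hom_def far_cmp[OF proj] F(2) G(2) GF(2))
    have "X_counit Q c \<cdot>\<^bsub>tot\<^esub> far (X_functor Q) g \<cdot>\<^bsub>tot\<^esub> far (X_functor Q) f = (X_counit Q c
        \<cdot>\<^bsub>tot\<^esub> far (X_functor Q) g) \<cdot>\<^bsub>tot\<^esub> far (X_functor Q) f"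
      using homs by (simp add: hom_def E.assoc)
    also have "\<dots> = g \<cdot>\<^bsub>tot\<^esub> (X_counit Q b \<cdot>\<^bsub>tot\<^esub> far (X_functor Q) f)"
      unfolding G(3) using homs by (simp add: hom_def E.assoc)
    also have "\<dots> = X_counit Q c \<cdot>\<^bsub>tot\<^esub> far (X_functor Q) (g \<cdot>\<^bsub>tot\<^esub> f)"
      unfolding F(3) GF(3) using homs by (simp add: hom_def E.assoc)
    finally show "X_counit Q c \<cdot>\<^bsub>tot\<^esub> far (X_functor Q) (g \<cdot>\<^bsub>tot\<^esub> f) = X_counit Q c \<cdot>\<^bsub>tot\<^esub> far (X_functor Q) g
        \<cdot>\<^bsub>tot\<^esub> far (X_functor Q) f"
      by simp
  qed
next
  fix f a b assume "f \<in> hom tot a b"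
  then show "far (X_functor Q) f \<in> hom tot (fob (X_functor Q) a) (fob (X_functor Q) b)" by (rule X_far)
qed (simp_all add: X_functor_def Let_def)

text \<open>The counit lies over \<open>chi\<close> and the action on arrows over
  \<open>ext_ar\<close>, so projecting recovers the original square. The pullback axiom is thereby
  inherited from \<open>Q\<close>, and \<open>Y\<close> after \<open>X\<close> is strictly the
  identity.\<close>

lemma X_square:
  assumes "f \<in> hom tot a b"
  shows "Square (far prj (X_counit Q a)) (far prj (X_counit Q b)) (far prj (far (X_functor Q) f)) (far
      prj f) = far (chi Q) f"
  using assms by (simp add: square.expand far_chi[OF assms] X_far[OF assms]
    X_counit[OF E.hom_Ob(1)[OF assms]] X_counit[OF E.hom_Ob(2)[OF assms]])

lemma X_w_counit: "w_counit prj tot bas (X_functor Q) (X_counit Q)"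
proof (rule w_counit.intro[OF proj X_functor], goal_cases)
  case (1 e) then show ?case by (rule X_counit)
next
  case (2 f a b) then show ?case by (simp add: X_far)
next
  case (3 e) then show ?case by (rule X_counit)
next
  case (4 f a b) then show ?case by (simp add: X_square chi_cartesian)
qed

lemma X0: "w_comonad (X0 Q)"
proof -
  interpret X: w_counit prj tot bas "X_functor Q" "X_counit Q" by (rule X_w_counit)
  \<comment> \<open>The definite description in \<open>X_comonad\<close> is justified by
    \<open>comult_ex1\<close>, applied to the counit alone.\<close>
  have nu: "cpt (w\<nu> (X0 Q)) e \<in> hom tot (fob (X_functor Q) e) (fob (X_functor Q) (fob (X_functor Q) e)) \<and>
    X_counit Q (fob (X_functor Q) e) \<cdot>\<^bsub>tot\<^esub> cpt (w\<nu> (X0 Q)) e = ide tot (fob (X_functor Q) e) \<and>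
    far (X_functor Q) (X_counit Q e) \<cdot>\<^bsub>tot\<^esub> cpt (w\<nu> (X0 Q)) e = ide tot (fob (X_functor Q) e)" if e: "e \<in>
        Ob tot" for e
    using theI'[OF X.comult_ex1[OF e]] e by (simp add: X0_def X_comonad_def Let_def)
  have "is_comonad tot (wcm (X0 Q))"
    by (rule X.is_comonadI) (use nu in \<open>simp_all add: X0_def X_comonad_def Let_def\<close>)
  then show ?thesis
    by (intro w_comonad.intro)
      (use cloven X_counit X_square chi_cartesian E.hom_Ob in auto)
qed

lemma Y0_X0: "Y0 (X0 Q) = Q"
proof -
  interpret X: w_comonad "X0 Q" by (rule X0)
  have "Y_chi (X0 Q) = chi Q"
  proof (rule functor_eqI[OF _ chi])
    show "Y_chi (X0 Q) : tot \<rightarrow>\<^sub>F arrow_cat bas" using X.Y_chi by simp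
    show "fob (Y_chi (X0 Q)) e = fob (chi Q) e" if "e \<in> Ob tot" for e
      using that by (simp add: X_counit)
    show "far (Y_chi (X0 Q)) f = far (chi Q) f" if "f \<in> Ar tot" for f
      using that X_square[OF hom_self[OF that]] by (simp add: E.chase)
  qed
  then show ?thesis by (simp add: Y0_def X0_def)
qed

end

text \<open>Both lift \<open>zeta\<close> along the same chosen counits, so what is known about
  \<open>Y1_inv\<close> carries over to \<open>X1\<close>.\<close>

lemma X1_eq:
  assumes m: "lax_comp_morphism m" shows "X1 m = Y1_inv (X0 (csrc m)) (X0 (ctgt m)) m"
proof -
  interpret lax_comp_morphism m by fact
  \<comment> \<open>\<open>X_counit_simps\<close> evaluates the counit only on objects of the total
    category, hence the membership fact for images under \<open>ctotal m\<close>.\<close>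
  show ?thesis
    using fob_Ob[OF total] by (simp add: X1_def Y1_inv_def Let_def fun_eq_iff restrict_def)
qed

lemma
  assumes m: "lax_comp_morphism m"
  shows X1_lax: "lax_w_morphism (X1 m)" and Y1_X1: "Y1 (X1 m) = m"
proof -
  interpret lax_comp_morphism m by fact
  have st: "csrc m = Y0 (X0 (csrc m))" "ctgt m = Y0 (X0 (ctgt m))" by (simp_all add: S.Y0_X0 T.Y0_X0)
  show "lax_w_morphism (X1 m)" "Y1 (X1 m) = m"
    using Y1_inv_lax[OF S.X0 T.X0 m st] Y1_Y1_inv[OF S.X0 T.X0 m st] by (simp_all add: X1_eq[OF m])
qed

lemma Y2_X2: "comp_2cell t \<Longrightarrow> Y2 (X2 t) = t"
  by (simp add: Y2_def X2_def comp_2cell_iff Y1_X1)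

text \<open>By \<open>Y1_inj\<close> the laws of 1-cells may be tested after \<open>Y1\<close>,
  where \<open>Y1_X1\<close> removes \<open>X1\<close>. Compatibility of 2-cells is likewise read
  off from \<open>Y2_X2\<close>.\<close>

lemma two_functor_X: "two_functor CompCat WCmd X_2func"
proof (rule two_functor_over_Fib[OF CompCat.over_Fib_axioms WCmd.over_Fib_axioms], goal_cases)
  case (1 a) then show ?case by (simp add: X_2func_def comprehension_category.X0)
next
  case (2 f a b) then show ?case by (auto simp: X_2func_def cells1_WCmd cells1_CompCat X1_lax)
next
  case (3 a)
  then interpret comprehension_category a by simp
  have "X1 (compmor_id a) = wmor_id (X0 a)"
    by (rule Y1_inj[OF X1_lax[OF compmor_id_lax] wmor_id_lax[OF X0]])
      (simp_all add: comprehension_category_axioms Y1_X1 compmor_id_lax Y1_id X0 Y0_X0)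
  then show ?case by (simp add: X_2func_def)
next
  case (4 f g a b c)
  then have l: "lax_comp_morphism f" "lax_comp_morphism g" "ctgt f = csrc g"
    by (auto simp: cells1_CompCat)
  have st: "wtgt (X1 f) = wsrc (X1 g)" by (simp add: l)
  have "X1 (compmor_comp g f) = wmor_comp (X1 g) (X1 f)"
    by (rule Y1_inj[OF X1_lax[OF compmor_comp_lax[OF l]] wmor_comp_lax[OF X1_lax[OF l(1)] X1_lax[OF l(2)]
      st]])
      (simp_all add: Y1_X1 compmor_comp_lax l Y1_comp[OF X1_lax[OF l(1)] X1_lax[OF l(2)] st])
  then show ?case by (simp add: X_2func_def)
next
  case (9 t)
  then have t: "comp_2cell t" by simp
  then have "lax_w_morphism (csrc2 (X2 t))" "lax_w_morphism (ctgt2 (X2 t))"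
    by (simp_all add: X2_def comp_2cell_iff X1_lax)
  then show ?case
    using w_compat_iff_Y2[of "X2 t"] t Y2_X2[OF t]
      by (simp add: X_2func_def comp_2cell_iff) (simp add: X2_def)
qed (simp_all add: X_2func_def X2_def)

section \<open>Pseudo morphisms\<close>

text \<open>The inverse square has the inverse of \<open>sq_dom s\<close> as domain part and the
  identity as codomain part; it commutes because \<open>s\<close> does, by composing with that
  inverse.\<close>

lemma is_iso_square:
  assumes C: "category C" and s: "s \<in> squares C" and c: "sq_cod s = ide C b" "b \<in> Ob C"
  shows "is_iso (arrow_cat C) s \<longleftrightarrow> is_iso C (sq_dom s)"
proof -
  interpret C: category C by fact
  have s': "sq_src s \<in> Ar C" "sq_tgt s \<in> Ar C" "sq_dom s \<in> Ar C" "src C (sq_dom s) = src C (sq_src s)"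
    "tgt C (sq_dom s) = src C (sq_tgt s)" "sq_cod s \<in> Ar C" "src C (sq_cod s) = tgt C (sq_src s)"
    "tgt C (sq_cod s) = tgt C (sq_tgt s)" "sq_tgt s \<cdot>\<^bsub>C\<^esub> sq_dom s = sq_cod s \<cdot>\<^bsub>C\<^esub> sq_src s"
    using s by (auto simp: squares_def hom_def)
  show ?thesis
  proof
    assume "is_iso (arrow_cat C) s"
    then obtain t where t: "t \<in> squares C" "sq_src t = sq_tgt s" "sq_tgt t = sq_src s"
      "t \<cdot>\<^bsub>arrow_cat C\<^esub> s = ide (arrow_cat C) (sq_src s)" "s \<cdot>\<^bsub>arrow_cat C\<^esub> t = ide (arrow_cat C) (sq_tgt s)"
      using s by (auto simp: is_iso_def hom_arrow_cat)
    then have "sq_dom t \<in> hom C (src C (sq_tgt s)) (src C (sq_src s))" by (auto simp: squares_def)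
    then show "is_iso C (sq_dom s)"
      using t s s' unfolding is_iso_def by (intro conjI bexI[of _ "sq_dom t"]) simp_all
  next
    assume "is_iso C (sq_dom s)"
    then obtain w where w: "w \<in> Ar C" "src C w = src C (sq_tgt s)" "tgt C w = src C (sq_src s)"
      "w \<cdot>\<^bsub>C\<^esub> sq_dom s = ide C (src C (sq_src s))" "sq_dom s \<cdot>\<^bsub>C\<^esub> w = ide C (src C (sq_tgt s))"
      using s' by (auto simp: is_iso_def hom_def)
    have b: "b = tgt C (sq_src s)" "tgt C (sq_tgt s) = tgt C (sq_src s)"
      using s'(7,8) c C.src_ide[OF c(2)] C.tgt_ide[OF c(2)] by simp_all
    have "sq_src s \<cdot>\<^bsub>C\<^esub> w = (sq_cod s \<cdot>\<^bsub>C\<^esub> sq_src s) \<cdot>\<^bsub>C\<^esub> w"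
      using s' b by (simp add: c C.chase)
    also have "\<dots> = sq_tgt s \<cdot>\<^bsub>C\<^esub> (sq_dom s \<cdot>\<^bsub>C\<^esub> w)"
      unfolding s'(9)[symmetric] using s'(1-8) w(1-3) by (simp add: C.assoc)
    also have "\<dots> = sq_tgt s" using s' by (simp add: w C.chase)
    finally have "Square (sq_tgt s) (sq_src s) w (ide C b) \<in> squares C"
      using s' w b by (simp add: squares_def hom_def C.chase)
    then show "is_iso (arrow_cat C) s"
      using s s' w b c unfolding is_iso_def
      by (intro conjI bexI[of _ "Square (sq_tgt s) (sq_src s) w (ide C b)"])
        (simp_all add: hom_arrow_cat C.chase)
  qed
qed


lemma comp_pseudo_iff:
  assumes m: "lax_comp_morphism m"
  shows "nt_invertible (zeta m) \<longleftrightarrow>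
    (\<forall>e\<in>Ob (total_cat (cfib (csrc m))). is_iso (base_cat (cfib (ctgt m))) (sq_dom (cpt (zeta m) e)))"
proof -
  interpret lax_comp_morphism m by fact
  have "is_iso (arrow_cat T.bas) (cpt (zeta m) e) \<longleftrightarrow> is_iso T.bas (zt e)" if e: "e \<in> Ob S.tot" for e
    by (rule is_iso_square[OF T.B.category_axioms zeta_comps(4,3)[OF e] fob_Ob[OF base fob_Ob[OF S.proj
      e]]])
  then show ?thesis by (simp add: nt_invertible_iff[OF zeta_src zeta_nt])
qed

text \<open>\<open>far (wtotal m) (S.ep e)\<close> is cartesian as the image of a cartesian arrow
  under a 1-cell of \<open>Fib\<close>, so \<open>is_iso_cartesian\<close> lifts invertibility from
  the base. Conversely, the projection preserves isomorphisms.\<close>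

lemma pseudo_Y1_iff:
  assumes m: "lax_w_morphism m"
  shows "nt_invertible (zeta (Y1 m)) \<longleftrightarrow> nt_invertible (theta m)"
proof -
  interpret lax_w_morphism m by fact
  have "is_iso (base_cat (wfib (wtgt m))) (far (proj (wfib (wtgt m))) (cpt (theta m) e))
      \<longleftrightarrow> is_iso T.tot (cpt (theta m) e)"
    if e: "e \<in> Ob S.tot" for e
  proof -
    note He = fob_Ob[OF total e]
    show ?thesis
      using is_iso_cartesian[OF T.proj T.eps_cartesian[OF He] T.eps[OF He]
        total_cartesian[OF S.eps_cartesian[OF e]]
          far_hom[OF total S.eps[OF e]] theta[OF e] theta_eps[OF e]] is_iso_far[OF T.proj]
      by blast
  qed
  then show ?thesis
    by (simp add: comp_pseudo_iff[OF Y1_lax[OF m]] nt_invertible_iff[OF theta_src theta_nt])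
qed

text \<open>On domain parts, closure is that of isomorphisms under composition and under the functor
  \<open>cbase g\<close>.\<close>

lemma two_category_CompCat_ps: "two_category CompCat_ps"
  unfolding CompCat_ps_def
proof (rule two_category_wide_2full[OF CC.two_category_axioms])
  fix a assume "a \<in> Cell0 CompCat"
  then have Q: "comprehension_category a" by simp
  then interpret comprehension_category a .
  have "is_iso bas (ide bas (ext_ob e))" if "e \<in> Ob tot" for e
    using that fob_Ob[OF ext_functor that] by (simp add: is_iso_ide B.category_axioms)
  then show "nt_invertible (zeta (id1 CompCat a))"
    by (simp add: comp_pseudo_iff[OF compmor_id_lax[OF Q]] compmor_id_zeta[OF Q])
next
  fix f g a b c
  assume "f \<in> cells1 CompCat a b" "g \<in> cells1 CompCat b c"
      and i: "nt_invertible (zeta f)" "nt_invertible (zeta g)"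
  then have l: "lax_comp_morphism f" "lax_comp_morphism g" "ctgt f = csrc g"
    by (auto simp: cells1_CompCat)
  interpret f: lax_comp_morphism f by (rule l)
  interpret g: lax_comp_morphism g by (rule l)
  have "is_iso g.T.bas (sq_dom (cpt (zeta (compmor_comp g f)) e))" if e: "e \<in> Ob f.S.tot" for e
  proof -
    have He: "fob (ctotal f) e \<in> Ob g.S.tot" using fob_Ob[OF f.total e] by (simp add: l)
    have iso: "is_iso g.S.bas (f.zt e)" "is_iso g.T.bas (g.zt (fob (ctotal f) e))"
      using i e He by (simp_all add: comp_pseudo_iff[OF l(1)] comp_pseudo_iff[OF l(2)] l(3))
    show ?thesis
      unfolding compmor_comp_zt[OF l e]
      using f.zt[OF e] g.zt[OF He]
      by (intro is_iso_cmp[OF g.T.B.category_axioms is_iso_far[OF g.base iso(1)] iso(2)])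
        (simp add: hom_def tgt_far[OF g.base] l(3))
  qed
  then show "nt_invertible (zeta (g \<odot>\<^bsub>CompCat\<^esub> f))"
    by (simp add: comp_pseudo_iff[OF compmor_comp_lax[OF l]])
qed

text \<open>\<open>Y1\<close> preserves identities and composites, and \<open>pseudo_Y1_iff\<close>
  reflects pseudo morphisms, so closure is imported from \<open>CompCat_ps\<close>.\<close>

lemma two_category_WCmd_ps: "two_category WCmd_ps"
  unfolding WCmd_ps_def
proof (rule two_category_wide_2full[OF WCmd.two_category])
  interpret ps: two_category CompCat_ps by (rule two_category_CompCat_ps)
  {
    fix a :: "('a, 'b, 'c, 'd) wcmd" assume "a \<in> Cell0 WCmd"
    then have W: "w_comonad a" by simp
    have "nt_invertible (zeta (compmor_id (Y0 a)))"
      using ps.id1_cell[of "Y0 a"] w_comonad.Y0[OF W] by (simp add: CompCat_ps_def)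
    then show "nt_invertible (theta (id1 WCmd a))"
      using pseudo_Y1_iff[OF wmor_id_lax[OF W]] by (simp add: Y1_id[OF W])
  next
    fix f g :: "('a, 'b, 'c, 'd) wmor" and a b c
    assume "f \<in> cells1 WCmd a b" "g \<in> cells1 WCmd b c"
        and i: "nt_invertible (theta f)" "nt_invertible (theta g)"
    then have l: "lax_w_morphism f" "lax_w_morphism g" "wtgt f = wsrc g" by (auto simp: cells1_WCmd)
    have "nt_invertible (zeta (compmor_comp (Y1 g) (Y1 f)))"
      using ps.cmp1_cell[of "Y1 f" "csrc (Y1 f)" "ctgt (Y1 f)" "Y1 g" "ctgt (Y1 g)"] i l
      by (simp add: CompCat_ps_def cells1_CompCat Y1_lax pseudo_Y1_iff)
    then show "nt_invertible (theta (g \<odot>\<^bsub>WCmd\<^esub> f))"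
      using pseudo_Y1_iff[OF wmor_comp_lax[OF l]] by (simp add: Y1_comp[OF l])
  }
qed

section \<open>Restriction of \<open>Y\<close> and \<open>X\<close> to pseudo morphisms\<close>

lemma two_functor_Y_ps: "two_functor WCmd_ps CompCat_ps Y_2func"
  unfolding WCmd_ps_def CompCat_ps_def
  by (rule two_functor_wide_2full[OF two_functor_Y two_category_WCmd_ps[unfolded WCmd_ps_def]
    two_category_CompCat_ps[unfolded CompCat_ps_def]])
    (simp add: Y_2func_def pseudo_Y1_iff)

text \<open>Whether \<open>X1 m\<close> is pseudo is decided by \<open>Y1 (X1 m)\<close>, which is
  \<open>m\<close>.\<close>

lemma two_functor_X_ps: "two_functor CompCat_ps WCmd_ps X_2func"
  unfolding WCmd_ps_def CompCat_ps_def
  by (rule two_functor_wide_2full[OF two_functor_X two_category_CompCat_ps[unfolded CompCat_ps_def]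
    two_category_WCmd_ps[unfolded WCmd_ps_def]])
    (simp add: X_2func_def pseudo_Y1_iff[symmetric] X1_lax Y1_X1)

section \<open>The unit\<close>

lemma YX_id: "eq_2func_on CompCat (Y_2func \<circ>\<^sub>2 X_2func) id_2func"
  by (auto simp: eq_2func_on_def comp_2func_def id_2func_def X_2func_def Y_2func_def
    comprehension_category.Y0_X0 Y1_X1 Y2_X2)

text \<open>
  Two w-comonads with the same image under \<open>Y\<close> have counits that are cartesian lifts of the same
  arrows; the comparison is the 1-cell lying over the identity.
\<close>

definition comparison :: "('e, 'f, 'o, 'a) wcmd \<Rightarrow> ('e, 'f, 'o, 'a) wcmd \<Rightarrow> ('e, 'f, 'o, 'a) wmor" where
  "comparison W W' = Y1_inv W W' (compmor_id (Y0 W))"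

lemma
  assumes W: "w_comonad W" and W': "w_comonad W'" and eq: "Y0 W' = Y0 W"
  shows comparison_lax: "lax_w_morphism (comparison W W')"
    and Y1_comparison: "Y1 (comparison W W') = compmor_id (Y0 W)"
  using Y1_inv_lax[OF W W' compmor_id_lax[OF w_comonad.Y0[OF W]]]
    Y1_Y1_inv[OF W W' compmor_id_lax[OF w_comonad.Y0[OF W]]] eq by (simp_all add: comparison_def)

lemma comparison_simps [simp]: "wsrc (comparison W W') = W" "wtgt (comparison W W') = W'"
  "wbase (comparison W W') = idf (base_cat (wfib W))" "wtotal (comparison W W')
      = idf (total_cat (wfib W))"
  by (simp_all add: comparison_def)

text \<open>The image under \<open>Y1\<close> is an identity, hence pseudo, and
  \<open>pseudo_Y1_iff\<close> reflects this.\<close>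

lemma comparison_pseudo:
  assumes W: "w_comonad W" and W': "w_comonad W'" and eq: "Y0 W' = Y0 W"
  shows "nt_invertible (theta (comparison W W'))"
proof -
  interpret ps: two_category CompCat_ps by (rule two_category_CompCat_ps)
  have "nt_invertible (zeta (compmor_id (Y0 W)))"
    using ps.id1_cell[of "Y0 W"] w_comonad.Y0[OF W] by (simp add: CompCat_ps_def)
  then show ?thesis
    using pseudo_Y1_iff[OF comparison_lax[OF assms]] by (simp add: Y1_comparison[OF assms])
qed

lemma comparison_refl: "w_comonad W \<Longrightarrow> comparison W W = wmor_id W"
  by (rule Y1_inj) (simp_all add: comparison_lax wmor_id_lax Y1_comparison Y1_id)

text \<open>Under \<open>Y1\<close> the composite becomes an identity composed with itself, and
  \<open>Y1_inj\<close> brings the equation back.\<close>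

lemma comparison_inverse:
  assumes W: "w_comonad W" and W': "w_comonad W'" and eq: "Y0 W' = Y0 W"
  shows "wmor_comp (comparison W' W) (comparison W W') = wmor_id W"
proof -
  note l = comparison_lax[OF assms] comparison_lax[OF W' W eq[symmetric]]
  note Q = w_comonad.Y0[OF W]
  have "compmor_comp (compmor_id (Y0 W)) (compmor_id (Y0 W)) = compmor_id (Y0 W)"
    using CC.cmp1_id_left[of "compmor_id (Y0 W)" "Y0 W" "Y0 W"] compmor_id_lax[OF Q]
      by (simp add: cells1_CompCat)
  then show ?thesis
    by (intro Y1_inj[OF wmor_comp_lax[OF l] wmor_id_lax[OF W]])
      (simp_all add: Y1_comp[OF l] Y1_comparison[OF assms] Y1_comparison[OF W' W eq[symmetric]]
        Y1_id[OF W] eq)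
qed

text \<open>After \<open>Y1\<close>, both sides are \<open>Y1 m\<close> composed with an identity.
  The case of interest is \<open>n = X1 (Y1 m)\<close>, where this is strict naturality of the
  unit.\<close>

lemma comparison_natural:
  assumes m: "lax_w_morphism m" and n: "lax_w_morphism n" and eq: "Y1 n = Y1 m"
  shows "wmor_comp n (comparison (wsrc m) (wsrc n)) = wmor_comp (comparison (wtgt m) (wtgt n)) m"
proof -
  interpret m: lax_w_morphism m by fact
  interpret n: lax_w_morphism n by fact
  have st: "Y0 (wsrc n) = Y0 (wsrc m)" "Y0 (wtgt n) = Y0 (wtgt m)"
    using arg_cong[OF eq, of csrc] arg_cong[OF eq, of ctgt] by simp_all
  have bt: "wbase n = wbase m" "wtotal n = wtotal m"
    using arg_cong[OF eq, of cbase] arg_cong[OF eq, of ctotal] by simp_all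
  note l = comparison_lax[OF m.src_w_comonad n.src_w_comonad st(1)]
    comparison_lax[OF m.tgt_w_comonad n.tgt_w_comonad st(2)]
  have Ym: "Y1 m \<in> cells1 CompCat (Y0 (wsrc m)) (Y0 (wtgt m))" by (simp add: cells1_CompCat Y1_lax[OF m])
  have "compmor_comp (Y1 m) (compmor_id (Y0 (wsrc m))) = compmor_comp (compmor_id (Y0 (wtgt m))) (Y1 m)"
    using CC.cmp1_id_left[OF Ym] CC.cmp1_id_right[OF Ym] by simp
  then show ?thesis
    by (intro Y1_inj[OF wmor_comp_lax[OF l(1) n] wmor_comp_lax[OF m l(2)]])
      (simp_all add: Y1_comp[OF l(1) n] Y1_comp[OF m l(2)] eq
        Y1_comparison[OF m.src_w_comonad n.src_w_comonad st(1)]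
            Y1_comparison[OF m.tgt_w_comonad n.tgt_w_comonad st(2)])
qed

definition unit_cpt :: "('e, 'f, 'o, 'a) wcmd \<Rightarrow> ('e, 'f, 'o, 'a) wmor" where
  "unit_cpt W = comparison W (X0 (Y0 W))"

lemma XY:
  assumes "w_comonad W" shows "w_comonad (X0 (Y0 W))" "Y0 (X0 (Y0 W)) = Y0 W"
  using w_comonad.Y0[OF assms] by (simp_all add: comprehension_category.X0 comprehension_category.Y0_X0)

lemma unit_natural1:
  assumes m: "lax_w_morphism m"
  shows "wmor_comp (X1 (Y1 m)) (unit_cpt (wsrc m)) = wmor_comp (unit_cpt (wtgt m)) m"
  using comparison_natural[OF m X1_lax[OF Y1_lax[OF m]]] Y1_X1[OF Y1_lax[OF m]]
    by (simp add: unit_cpt_def)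

text \<open>The comparison has identity functors underneath, so whiskering with it leaves both
  natural transformations as they are. The boundaries agree by \<open>unit_natural1\<close>, applied
  to the source and the target of \<open>t\<close>.\<close>

lemma unit_natural2:
  assumes t: "w_2cell t"
  shows "fib2_hcmp wmor_comp (X2 (Y2 t)) (id2 WCmd (unit_cpt (wsrc (csrc2 t)))) =
    fib2_hcmp wmor_comp (id2 WCmd (unit_cpt (wtgt (csrc2 t)))) t"
proof -
  have m: "lax_w_morphism (csrc2 t)" and n: "lax_w_morphism (ctgt2 t)"
      and st: "wsrc (ctgt2 t) = wsrc (csrc2 t)" "wtgt (ctgt2 t) = wtgt (csrc2 t)"
    and f: "base_nt t : wbase (csrc2 t) \<Rightarrow>\<^sub>N wbase (ctgt2 t)" "total_nt t : wtotal (csrc2 t)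
        \<Rightarrow>\<^sub>N wtotal (ctgt2 t)"
    using t fib2_2cell_betw by (auto simp: w_2cell_iff)
  interpret m: lax_w_morphism "csrc2 t" by fact
  show ?thesis
    using unit_natural1[OF m] unit_natural1[OF n]
    by (simp add: fib2_hcmp_def X2_def Y2_def st)
      (simp add: unit_cpt_def hcomp_idf_left[OF m.base f(1)] hcomp_idf_left[OF m.total f(2)]
        hcomp_idf_right[OF m.base f(1)] hcomp_idf_right[OF m.total f(2)])
qed

text \<open>Parametrised by the retained 1-cells, so that the unrestricted and the pseudo case are
  instances with literally the same unit and counit. \<open>S\<close> must contain the comparisons,
  as they are the components of the unit and their inverses.\<close>

lemma adjoint_biequivalence_wide_2full:
  assumes Y: "two_functor (wide_2full WCmd S) (wide_2full CompCat T) Y_2func"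
    and X: "two_functor (wide_2full CompCat T) (wide_2full WCmd S) X_2func"
    and S: "\<And>W W'. \<lbrakk>w_comonad W; w_comonad W'; Y0 W' = Y0 W\<rbrakk> \<Longrightarrow> S (comparison W W')"
  shows "adjoint_biequivalence (wide_2full WCmd S) (wide_2full CompCat T) Y_2func X_2func
   (strict_pn WCmd WCmd (X_2func \<circ>\<^sub>2 Y_2func) unit_cpt) (strict_pn CompCat CompCat id_2func
     (id1 CompCat))"
proof -
  have YX: "eq_2func_on (wide_2full CompCat T) (Y_2func \<circ>\<^sub>2 X_2func) id_2func"
    using YX_id by (auto simp: eq_2func_on_def)
  \<comment> \<open>The inverse of each unit component is the comparison in the opposite direction,
    which lies over the same identity.\<close>
  have "adjoint_biequivalence (wide_2full WCmd S) (wide_2full CompCat T) Y_2func X_2func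
   (strict_pn (wide_2full WCmd S) (wide_2full WCmd S) (X_2func \<circ>\<^sub>2 Y_2func) unit_cpt)
   (strict_pn (wide_2full CompCat T) (wide_2full CompCat T) id_2func (id1 (wide_2full CompCat T)))"
  proof (rule adjoint_biequivalence_strict[where k = "\<lambda>W. comparison (X0 (Y0 W)) W", OF Y X YX],
      goal_cases)
    case (1 a)
    then show ?case by (simp add: cells1_WCmd unit_cpt_def comparison_lax S XY X_2func_def Y_2func_def)
  next
    case (2 a)
    then show ?case by (simp add: cells1_WCmd comparison_lax S XY X_2func_def Y_2func_def)
  next
    case (3 a)
    then show ?case by (simp add: unit_cpt_def comparison_inverse XY)
  next
    case (4 a)
    then show ?case using comparison_inverse[OF XY(1) _ XY(2)[symmetric], of a]
      by (simp add: unit_cpt_def X_2func_def Y_2func_def)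
  next
    case (5 f a b)
    then show ?case using unit_natural1[of f] by (auto simp: X_2func_def Y_2func_def cells1_WCmd)
  next
    case (6 f g a b \<alpha>)
    then show ?case using unit_natural2[of \<alpha>]
      by (auto simp: X_2func_def Y_2func_def cells1_WCmd cells2_WCmd)
  next
    case (7 a)
    then show ?case by (simp add: unit_cpt_def X_2func_def Y_2func_def Y1_comparison XY)
  next
    case (8 d)
    \<comment> \<open>Here \<open>Y0 (X0 d) = d\<close>, so the unit is a comparison of
      \<open>X0 d\<close> with itself.\<close>
    then show ?case
      by (simp add: unit_cpt_def X_2func_def comprehension_category.Y0_X0 comparison_refl
        comprehension_category.X0)
  qed
  \<comment> \<open>\<open>strict_pn\<close> does not depend on the carriers, so the transformations
    formed in the sub-2-categories are the stated ones.\<close>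
  then show ?thesis by (simp add: strict_pn_def)
qed

theorem theorem4p8:
  shows "(\<exists>\<eta> \<epsilon>.
      adjoint_biequivalence (WCmd :: ('e, 'f, 'o, 'a) wcmd_2cat) CompCat Y_2func X_2func \<eta> \<epsilon> \<and>
      adjoint_biequivalence (WCmd_ps :: ('e, 'f, 'o, 'a) wcmd_2cat) CompCat_ps Y_2func X_2func \<eta> \<epsilon>) \<and>
    eq_2func_on (CompCat :: ('e, 'f, 'o, 'a) compcat_2cat) (Y_2func \<circ>\<^sub>2 X_2func) id_2func"
proof (intro conjI exI)
  \<comment> \<open>The unrestricted case is the instance with constantly true predicates.\<close>
  show "adjoint_biequivalence WCmd CompCat Y_2func X_2func
      (strict_pn WCmd WCmd (X_2func \<circ>\<^sub>2 Y_2func) unit_cpt) (strict_pn CompCat CompCat id_2func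
        (id1 CompCat))"
    using adjoint_biequivalence_wide_2full[of "\<lambda>_. True" "\<lambda>_. True"] two_functor_Y two_functor_X
    by (simp add: wide_2full_True)
  show "adjoint_biequivalence WCmd_ps CompCat_ps Y_2func X_2func
      (strict_pn WCmd WCmd (X_2func \<circ>\<^sub>2 Y_2func) unit_cpt) (strict_pn CompCat CompCat id_2func
        (id1 CompCat))"
    using two_functor_Y_ps two_functor_X_ps comparison_pseudo unfolding WCmd_ps_def CompCat_ps_def
    by (intro adjoint_biequivalence_wide_2full)
qed (rule YX_id)

end
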